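(* Let $n\ge1$. There exists a homomorphism (of $R^a$-algebras) $\rho_n^a:R^a[\mathrm{VB}_n]\to\mathrm{ATL}_n(R^a)$ which sends $\sigma_i$ to $-A^{-2}\,1-A^{-4}F_i$ and $\tau_i$ to $w_i$ for all $i\in\{1,\dots,n-1\}$.
   Context: $\mathrm{VB}_n$ is the virtual braid group on $n$ strands: the group presented by generators $\sigma_1,\dots,\sigma_{n-1},\tau_1,\dots,\tau_{n-1}$ and relations $\tau_i^2=1$ for $1\le i\le n-1$; $\sigma_i\sigma_j=\sigma_j\sigma_i$, $\tau_i\tau_j=\tau_j\tau_i$, $\tau_i\sigma_j=\sigma_j\tau_i$ for $|i-j|\ge 2$; $\sigma_i\sigma_j\sigma_i=\sigma_j\sigma_i\sigma_j$, $\tau_i\tau_j\tau_i=\tau_j\tau_i\tau_j$, $\tau_i\tau_j\sigma_i=\sigma_j\tau_i\tau_j$ for $|i-j|=1$. $R[\mathrm{VB}_n]$ denotes the group algebra over a ring $R$. Let $R_0^a=\mathbb{Z}[z_0,z_1,z_2,\dots]$ and $R^a=\mathbb{Z}[A^{\pm1},z_1,z_2,\dots]$, with $R_0^a$ embedded in $R^a$ via $z_0=-A^2-A^{-2}$. For $n\ge1$ let $V_n=\{0,1\}\times\{1,\dots,n\}$, ordered by $(0,1)<(0,2)<\cdots<(0,n)<(1,n)<\cdots<(1,2)<(1,1)$. A flat virtual $n$-tangle is a partition of $V_n$ into pairs; $\mathcal{E}_n$ is the set of these. An arrow flat $n$-tangle is a pair $F=(E,f)$ with $E\in\mathcal{E}_n$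 and $f:E\to\mathbb{Z}$ such that, for $\alpha=\{(a,b),(c,d)\}\in E$, $f(\alpha)$ is odd if $a=c$ and even if $a\ne c$. $\mathcal{F}_n$ is the set of arrow flat $n$-tangles, and $\mathrm{ATL}_n$ is the free $R_0^a$-module with basis $\mathcal{F}_n$, with the multiplication defined as follows. Let $E,E'\in\mathcal{E}_n$. An arc of length $\ell$ in $E\sqcup E'$ is an $\ell$-tuple $\hat\alpha=(\alpha_1,\dots,\alpha_\ell)$ of elements of $E\sqcup E'$, $\alpha_i=\{(a_i,b_{i-1}),(c_i,b_i)\}$, such that: (a) if $\alpha_i\in E$ and $i<\ell$, then $c_i=1$, $\alpha_{i+1}\in E'$ and $a_{i+1}=0$; (b) if $\alpha_i\in E'$ and $i<\ell$, then $c_i=0$, $\alpha_{i+1}\in E$ and $a_{i+1}=1$; (c) $a_1=0$ if $\alpha_1\in E$, $a_1=1$ if $\alpha_1\in E'$, $c_\ell=0$ if $\alpha_\ell\in E$, $c_\ell=1$ if $\alpha_\ell\in E'$, and $(a_1,b_0)<(c_\ell,b_\ell)$. Its boundary is $\partial\hat\alpha=\{(a_1,b_0),(c_\ell,b_\ell)\}$. There are $n$ arcs and their boundaries form a flat virtual $n$-tangle $E*E'$. A cycle of length $2p\ge2$ in $E\sqcup E'$ is a $2p$-tuple $\hat\gamma=(\gamma_1,\dots,\gamma_{2p})$, $\gamma_i=\{(a_i,b_{i-1}),(c_i,b_i)\}$, such that $\gamma_i\in E$ and $a_i=c_i=1$ for $i$ odd, $\gamma_i\in E'$ and $a_i=c_i=0$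 for $i$ even, and $b_0=b_{2p}<b_i$ for $1\le i\le 2p-1$. The parity of $\alpha=\{(a,b),(c,d)\}$ is $\varpi(\alpha)=-1$ if $a=c$ and $\varpi(\alpha)=1$ if $a\ne c$. For an arc or cycle $(\alpha_1,\dots,\alpha_\ell)$ with $\alpha_i=\{(a_i,b_{i-1}),(c_i,b_i)\}$, the cumulated parity is $\varpi^c(\alpha_i)=\prod_{j=1}^{i-1}\varpi(\alpha_j)$ if $(a_i,b_{i-1})<(c_i,b_i)$, and $\varpi^c(\alpha_i)=\prod_{j=1}^{i}\varpi(\alpha_j)$ if $(c_i,b_i)<(a_i,b_{i-1})$. Let $F=(E,f)$, $F'=(E',f')\in\mathcal{F}_n$, and let $f^*$ equal $f$ on $E$ and $f'$ on $E'$. For an arc $\hat\alpha$ of $E\sqcup E'$ put $g(\partial\hat\alpha)=\sum_{i=1}^\ell\varpi^c(\alpha_i)f^*(\alpha_i)$, and set $F*F'=(E*E',g)\in\mathcal{F}_n$. For a cycle $\hat\gamma$ put $h(\hat\gamma)=\sum_i\varpi^c(\gamma_i)f^*(\gamma_i)$ (an even number) and $\zeta(\hat\gamma)=|h(\hat\gamma)|/2$. If $\hat\gamma_1,\dots,\hat\gamma_m$ are the cycles of $E\sqcup E'$, then $F\,F'=z_{\zeta(\hat\gamma_1)}\cdots z_{\zeta(\hat\gamma_m)}(F*F')$. This makes $\mathrm{ATL}_n$ an associative unital algebra (unit: all pairs $\{(0,k),(1,k)\}$ labeled $0$). Set $\mathrm{ATL}_n(R^a)=R^a\otimes_{R_0^a}\mathrm{ATL}_n$.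 For $1\le i\le n-1$: $F_i$ has pairs $\{(0,i),(0,i+1)\}$ and $\{(1,i),(1,i+1)\}$ both labeled $1$, and $\{(0,k),(1,k)\}$ labeled $0$ for $k\ne i,i+1$; $w_i$ has pairs $\{(0,i),(1,i+1)\}$, $\{(0,i+1),(1,i)\}$, and $\{(0,k),(1,k)\}$ for $k\ne i,i+1$, all labeled $0$. *)

theory Defs
  imports
    "HOL-Algebra.Module"
    "HOL-Library.Poly_Mapping"
    "HOL-Library.Product_Plus"
    "HOL-Library.Disjoint_Sets"
    "HOL-Library.FuncSet"
begin

section \<open>Groups given by generators and relations\<close>

text \<open>A letter \<open>(x, True)\<close> stands for the generator \<open>x\<close>, and \<open>(x, False)\<close> for its inverse.\<close>

type_synonym 'g word = "('g \<times> bool) list"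

inductive pres_cong :: "'g set \<Rightarrow> ('g word \<times> 'g word) set \<Rightarrow> 'g word \<Rightarrow> 'g word \<Rightarrow> bool"
  for X :: "'g set" and Rel :: "('g word \<times> 'g word) set" where
  refl: "w \<in> lists (X \<times> UNIV) \<Longrightarrow> pres_cong X Rel w w"
| sym: "pres_cong X Rel u v \<Longrightarrow> pres_cong X Rel v u"
| trans: "pres_cong X Rel u v \<Longrightarrow> pres_cong X Rel v w \<Longrightarrow> pres_cong X Rel u w"
| append: "pres_cong X Rel u u' \<Longrightarrow> pres_cong X Rel v v' \<Longrightarrow> pres_cong X Rel (u @ v) (u' @ v')"
| cancel: "x \<in> X \<Longrightarrow> pres_cong X Rel [(x, b), (x, \<not> b)] []"
| rel: "(u, v) \<in> Rel \<Longrightarrow> u \<in> lists (X \<times> UNIV) \<Longrightarrow> v \<in> lists (X \<times> UNIV) \<Longrightarrow> pres_cong X Rel u v"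

definition pres_class :: "'g set \<Rightarrow> ('g word \<times> 'g word) set \<Rightarrow> 'g word \<Rightarrow> 'g word set" where
  "pres_class X Rel w = {v. pres_cong X Rel w v}"

definition presented_group :: "'g set \<Rightarrow> ('g word \<times> 'g word) set \<Rightarrow> 'g word set monoid" where
  "presented_group X Rel =
    \<lparr>carrier = pres_class X Rel ` lists (X \<times> UNIV),
     mult = (\<lambda>P Q. \<Union>u\<in>P. \<Union>v\<in>Q. pres_class X Rel (u @ v)),
     one = pres_class X Rel []\<rparr>"

lemma pres_cong_lists:
  "pres_cong X Rel u v \<Longrightarrow> u \<in> lists (X \<times> UNIV) \<and> v \<in> lists (X \<times> UNIV)"
  by (induction rule: pres_cong.induct) auto

lemma pres_class_eq_iff:
  assumes "u \<in> lists (X \<times> UNIV)"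
  shows "pres_class X Rel u = pres_class X Rel v \<longleftrightarrow> pres_cong X Rel u v"
proof
  assume "pres_class X Rel u = pres_class X Rel v"
  moreover have "u \<in> pres_class X Rel u"
    using assms by (simp add: pres_class_def pres_cong.refl)
  ultimately have "u \<in> pres_class X Rel v" by simp
  then show "pres_cong X Rel u v" by (simp add: pres_class_def pres_cong.sym)
next
  assume "pres_cong X Rel u v"
  then show "pres_class X Rel u = pres_class X Rel v"
    unfolding pres_class_def by (blast dest: pres_cong.sym pres_cong.trans)
qed

lemma presented_group_mult:
  assumes "u \<in> lists (X \<times> UNIV)" "v \<in> lists (X \<times> UNIV)"
  shows "pres_class X Rel u \<otimes>\<^bsub>presented_group X Rel\<^esub> pres_class X Rel v = pres_class X Rel (u @ v)"
proof -
  have "pres_class X Rel (u' @ v') = pres_class X Rel (u @ v)"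
    if "pres_cong X Rel u u'" "pres_cong X Rel v v'" for u' v'
  proof -
    have "pres_cong X Rel (u @ v) (u' @ v')" by (rule pres_cong.append[OF that])
    then show ?thesis using assms by (subst eq_commute) (simp add: pres_class_eq_iff)
  qed
  moreover have "u \<in> pres_class X Rel u" "v \<in> pres_class X Rel v"
    using assms by (auto simp: pres_class_def intro: pres_cong.refl)
  ultimately have "(\<Union>u'\<in>pres_class X Rel u. \<Union>v'\<in>pres_class X Rel v. pres_class X Rel (u' @ v'))
      = pres_class X Rel (u @ v)"
    unfolding pres_class_def[of X Rel u] pres_class_def[of X Rel v] by blast
  then show ?thesis by (simp add: presented_group_def)
qed

lemma group_presented_group: "group (presented_group X Rel)"
proof (rule groupI)
  let ?G = "presented_group X Rel"
  have car: "carrier ?G = pres_class X Rel ` lists (X \<times> UNIV)"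
    and one: "\<one>\<^bsub>?G\<^esub> = pres_class X Rel []"
    by (simp_all add: presented_group_def)
  show "\<one>\<^bsub>?G\<^esub> \<in> carrier ?G" unfolding car one by blast
  have cls: "\<exists>u\<in>lists (X \<times> UNIV). x = pres_class X Rel u" if "x \<in> carrier ?G" for x
    using that unfolding car by blast
  show "x \<otimes>\<^bsub>?G\<^esub> y \<in> carrier ?G" if xy: "x \<in> carrier ?G" "y \<in> carrier ?G" for x y
  proof -
    from cls[OF xy(1)] cls[OF xy(2)] obtain u v where
      u: "u \<in> lists (X \<times> UNIV)" "x = pres_class X Rel u" and
      v: "v \<in> lists (X \<times> UNIV)" "y = pres_class X Rel v" by blast
    then have "x \<otimes>\<^bsub>?G\<^esub> y = pres_class X Rel (u @ v)" by (simp only: presented_group_mult)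
    moreover have "u @ v \<in> lists (X \<times> UNIV)" using u v by simp
    ultimately show ?thesis unfolding car by blast
  qed
  show "x \<otimes>\<^bsub>?G\<^esub> y \<otimes>\<^bsub>?G\<^esub> z = x \<otimes>\<^bsub>?G\<^esub> (y \<otimes>\<^bsub>?G\<^esub> z)"
    if xyz: "x \<in> carrier ?G" "y \<in> carrier ?G" "z \<in> carrier ?G" for x y z
  proof -
    from cls[OF xyz(1)] cls[OF xyz(2)] cls[OF xyz(3)] obtain u v w where
      "u \<in> lists (X \<times> UNIV)" "x = pres_class X Rel u"
      "v \<in> lists (X \<times> UNIV)" "y = pres_class X Rel v"
      "w \<in> lists (X \<times> UNIV)" "z = pres_class X Rel w" by blast
    then show ?thesis
      by (simp only: presented_group_mult append_in_lists_conv append_assoc simp_thms)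
  qed
  show "\<one>\<^bsub>?G\<^esub> \<otimes>\<^bsub>?G\<^esub> x = x" if x: "x \<in> carrier ?G" for x
    using cls[OF x] unfolding one
    by (metis presented_group_mult append_Nil lists.Nil)
  show "\<exists>y\<in>carrier ?G. y \<otimes>\<^bsub>?G\<^esub> x = \<one>\<^bsub>?G\<^esub>" if x: "x \<in> carrier ?G" for x
  proof -
    obtain w where w: "w \<in> lists (X \<times> UNIV)" "x = pres_class X Rel w"
      using cls[OF x] by blast
    define i where "i = (\<lambda>w :: 'a word. rev (map (\<lambda>(a, b). (a, \<not> b)) w))"
    have i: "i w \<in> lists (X \<times> UNIV)" if "w \<in> lists (X \<times> UNIV)" for w
      using that unfolding i_def by (auto simp: in_lists_conv_set)
    have "pres_cong X Rel (i w @ w) []" using w(1)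
    proof (induction w)
      case Nil
      then show ?case by (auto simp: i_def intro: pres_cong.refl)
    next
      case (Cons l w)
      obtain a b where l: "l = (a, b)" by (cases l)
      have a: "a \<in> X" and wl: "w \<in> lists (X \<times> UNIV)" using Cons l by auto
      have c: "pres_cong X Rel [(a, \<not> b), (a, b)] []"
        using pres_cong.cancel[OF a, of Rel "\<not> b"] by simp
      have "pres_cong X Rel (i w @ ([(a, \<not> b), (a, b)] @ w)) (i w @ ([] @ w))"
        by (intro pres_cong.append c pres_cong.refl i wl)
      moreover have "i (l # w) @ (l # w) = i w @ ([(a, \<not> b), (a, b)] @ w)"
        by (simp add: i_def l)
      ultimately show ?case using Cons.IH
        by (metis pres_cong.trans append_Nil)
    qed
    then have "pres_class X Rel (i w) \<otimes>\<^bsub>?G\<^esub> x = \<one>\<^bsub>?G\<^esub>"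
      using w i[OF w(1)]
      by (simp add: presented_group_mult one pres_class_eq_iff)
    then show ?thesis using i[OF w(1)] car by blast
  qed
qed

section \<open>The virtual braid group\<close>

datatype vb_gen = Sigma_gen nat | Tau_gen nat

definition vb_gens :: "nat \<Rightarrow> vb_gen set" where
  "vb_gens n = Sigma_gen ` {1..<n} \<union> Tau_gen ` {1..<n}"

abbreviation sg :: "nat \<Rightarrow> vb_gen \<times> bool" where "sg i \<equiv> (Sigma_gen i, True)"
abbreviation tg :: "nat \<Rightarrow> vb_gen \<times> bool" where "tg i \<equiv> (Tau_gen i, True)"

definition vb_rels :: "nat \<Rightarrow> (vb_gen word \<times> vb_gen word) set" where
  "vb_rels n =
    {([tg i, tg i], []) | i. i \<in> {1..<n}}
    \<union> (\<Union>(i, j) \<in> {(i, j). i \<in> {1..<n} \<and> j \<in> {1..<n} \<and> \<bar>int i - int j\<bar> \<ge> 2}.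
        {([sg i, sg j], [sg j, sg i]),
         ([tg i, tg j], [tg j, tg i]),
         ([tg i, sg j], [sg j, tg i])})
    \<union> (\<Union>(i, j) \<in> {(i, j). i \<in> {1..<n} \<and> j \<in> {1..<n} \<and> \<bar>int i - int j\<bar> = 1}.
        {([sg i, sg j, sg i], [sg j, sg i, sg j]),
         ([tg i, tg j, tg i], [tg j, tg i, tg j]),
         ([tg i, tg j, sg i], [sg j, tg i, tg j])})"

definition VB :: "nat \<Rightarrow> vb_gen word set monoid" where
  "VB n = presented_group (vb_gens n) (vb_rels n)"

definition vb_sigma :: "nat \<Rightarrow> nat \<Rightarrow> vb_gen word set" where
  "vb_sigma n i = pres_class (vb_gens n) (vb_rels n) [sg i]"

definition vb_tau :: "nat \<Rightarrow> nat \<Rightarrow> vb_gen word set" where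
  "vb_tau n i = pres_class (vb_gens n) (vb_rels n) [tg i]"

section \<open>Algebras on a free module\<close>

definition scale :: "'r::comm_ring_1 \<Rightarrow> ('b \<Rightarrow>\<^sub>0 'r) \<Rightarrow> ('b \<Rightarrow>\<^sub>0 'r)" where
  "scale c x = Poly_Mapping.map ((*) c) x"

text \<open>The free module over the (type) ring \<open>'r\<close> with basis \<open>B\<close>, the basis element \<open>b\<close> being
  \<open>Poly_Mapping.single b 1\<close>, with the multiplication that extends \<open>\<mu>\<close> bilinearly and with unit \<open>u\<close>.\<close>

definition free_algebra ::
  "'b set \<Rightarrow> ('b \<Rightarrow> 'b \<Rightarrow> ('b \<Rightarrow>\<^sub>0 'r)) \<Rightarrow> ('b \<Rightarrow>\<^sub>0 'r) \<Rightarrow> ('r::comm_ring_1, 'b \<Rightarrow>\<^sub>0 'r) module" where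
  "free_algebra B \<mu> u =
    \<lparr>carrier = {x. Poly_Mapping.keys x \<subseteq> B},
     mult = (\<lambda>x y. \<Sum>a\<in>Poly_Mapping.keys x. \<Sum>b\<in>Poly_Mapping.keys y.
               scale (Poly_Mapping.lookup x a * Poly_Mapping.lookup y b) (\<mu> a b)),
     one = u, zero = 0, add = (+), smult = scale\<rparr>"

definition group_algebra :: "'g monoid \<Rightarrow> ('r::comm_ring_1, 'g \<Rightarrow>\<^sub>0 'r) module" where
  "group_algebra G =
    free_algebra (carrier G) (\<lambda>g h. Poly_Mapping.single (g \<otimes>\<^bsub>G\<^esub> h) 1) (Poly_Mapping.single \<one>\<^bsub>G\<^esub> 1)"

text \<open>Homomorphisms of unital algebras over the (type) ring \<open>'r\<close>.\<close>

definition alg_hom :: "('r, 'a) module \<Rightarrow> ('r, 'b) module \<Rightarrow> ('a \<Rightarrow> 'b) set" where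
  "alg_hom S T = {h \<in> ring_hom S T. \<forall>r. \<forall>x\<in>carrier S. h (r \<odot>\<^bsub>S\<^esub> x) = r \<odot>\<^bsub>T\<^esub> h x}"

text \<open>Extension of scalars along a ring homomorphism \<open>\<iota>\<close>, for an algebra \<open>M\<close> that is free as a
  module with basis \<open>B\<close>: the product of two elements of \<open>B\<close> is their product in \<open>M\<close> with \<open>\<iota>\<close> applied
  to the coefficients.  The lemmas \<open>base_change_*\<close> below show that this, with the map
  \<open>(r, x) \<mapsto> scale r (Poly_Mapping.map \<iota> x)\<close>, is the tensor product \<open>'s \<otimes> M\<close> over \<open>'r\<close>.\<close>

definition base_change ::
  "('r::comm_ring_1 \<Rightarrow> 's::comm_ring_1) \<Rightarrow> 'b set \<Rightarrow> ('r, 'b \<Rightarrow>\<^sub>0 'r) module \<Rightarrow> ('s, 'b \<Rightarrow>\<^sub>0 's) module" where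
  "base_change \<iota> B M =
    free_algebra B
      (\<lambda>a b. Poly_Mapping.map \<iota> (Poly_Mapping.single a 1 \<otimes>\<^bsub>M\<^esub> Poly_Mapping.single b 1))
      (Poly_Mapping.map \<iota> \<one>\<^bsub>M\<^esub>)"

lemma lookup_map_zero:
  assumes "f 0 = 0"
  shows "Poly_Mapping.lookup (Poly_Mapping.map f p) k = f (Poly_Mapping.lookup p k)"
  using assms by transfer (simp add: when_def)

lemma lookup_scale [simp]: "Poly_Mapping.lookup (scale c x) k = c * Poly_Mapping.lookup x k"
  by (simp add: scale_def lookup_map_zero)

lemma sum_singles: 
  fixes x :: "'b \<Rightarrow>\<^sub>0 'r::comm_monoid_add"
  shows "x = (\<Sum>b\<in>Poly_Mapping.keys x. Poly_Mapping.single b (Poly_Mapping.lookup x b))"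
proof (rule poly_mapping_eqI)
  fix k
  have "Poly_Mapping.lookup (\<Sum>b\<in>Poly_Mapping.keys x. Poly_Mapping.single b (Poly_Mapping.lookup x b)) k
      = (\<Sum>b\<in>Poly_Mapping.keys x. if b = k then Poly_Mapping.lookup x b else 0)"
    unfolding lookup_sum by (intro sum.cong) (auto simp: lookup_single when_def)
  also have "\<dots> = Poly_Mapping.lookup x k" by (simp add: sum.delta in_keys_iff)
  finally show "Poly_Mapping.lookup x k =
    Poly_Mapping.lookup (\<Sum>b\<in>Poly_Mapping.keys x. Poly_Mapping.single b (Poly_Mapping.lookup x b)) k"
    by simp
qed

lemma free_algebra_mult:
  assumes "finite K" "Poly_Mapping.keys x \<subseteq> K" "finite L" "Poly_Mapping.keys y \<subseteq> L"
  shows "x \<otimes>\<^bsub>free_algebra B \<mu> u\<^esub> y =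
    (\<Sum>a\<in>K. \<Sum>b\<in>L. scale (Poly_Mapping.lookup x a * Poly_Mapping.lookup y b) (\<mu> a b))"
proof -
  have z: "scale 0 v = 0" for v :: "'a \<Rightarrow>\<^sub>0 'b" by (rule poly_mapping_eqI) simp
  have "x \<otimes>\<^bsub>free_algebra B \<mu> u\<^esub> y =
    (\<Sum>a\<in>Poly_Mapping.keys x. \<Sum>b\<in>Poly_Mapping.keys y.
      scale (Poly_Mapping.lookup x a * Poly_Mapping.lookup y b) (\<mu> a b))"
    by (simp add: free_algebra_def)
  also have "\<dots> = (\<Sum>a\<in>Poly_Mapping.keys x. \<Sum>b\<in>L.
      scale (Poly_Mapping.lookup x a * Poly_Mapping.lookup y b) (\<mu> a b))"
    by (rule sum.cong[OF HOL.refl], rule sum.mono_neutral_left) (use assms in \<open>auto simp: in_keys_iff z\<close>)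
  also have "\<dots> = (\<Sum>a\<in>K. \<Sum>b\<in>L.
      scale (Poly_Mapping.lookup x a * Poly_Mapping.lookup y b) (\<mu> a b))"
    using assms by (intro sum.mono_neutral_left) (auto simp: in_keys_iff z)
  finally show ?thesis .
qed

lemma free_algebra_mult_single:
  "Poly_Mapping.single a 1 \<otimes>\<^bsub>free_algebra B \<mu> u\<^esub> Poly_Mapping.single b 1 = \<mu> a b"
  by (subst free_algebra_mult[of "{a}" _ "{b}"]) (auto intro: poly_mapping_eqI)

context
  fixes \<iota> :: "'r::comm_ring_1 \<Rightarrow> 's::comm_ring_1"
  assumes hom_add: "\<And>x y. \<iota> (x + y) = \<iota> x + \<iota> y"
    and hom_mult: "\<And>x y. \<iota> (x * y) = \<iota> x * \<iota> y"
    and hom_one: "\<iota> 1 = 1"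
begin

lemma hom_zero: "\<iota> 0 = 0"
  using hom_add[of 0 0] by simp

lemma base_change_balanced:
  shows "scale (r + s) (Poly_Mapping.map \<iota> x) = scale r (Poly_Mapping.map \<iota> x) + scale s (Poly_Mapping.map \<iota> x)"
    and "scale r (Poly_Mapping.map \<iota> (x + y)) = scale r (Poly_Mapping.map \<iota> x) + scale r (Poly_Mapping.map \<iota> y)"
    and "scale (r * \<iota> c) (Poly_Mapping.map \<iota> x) = scale r (Poly_Mapping.map \<iota> (scale c x))"
  by (auto intro!: poly_mapping_eqI
      simp: lookup_add lookup_map_zero hom_zero hom_add hom_mult algebra_simps)

lemma base_change_mult:
  fixes x y :: "'b \<Rightarrow>\<^sub>0 'r" and \<mu> :: "'b \<Rightarrow> 'b \<Rightarrow> ('b \<Rightarrow>\<^sub>0 'r)"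
  shows "scale r (Poly_Mapping.map \<iota> x) \<otimes>\<^bsub>base_change \<iota> B (free_algebra B \<mu> u)\<^esub> scale s (Poly_Mapping.map \<iota> y)
    = scale (r * s) (Poly_Mapping.map \<iota> (x \<otimes>\<^bsub>free_algebra B \<mu> u\<^esub> y))" (is "?l = ?r")
proof -
  have k: "Poly_Mapping.keys (scale r (Poly_Mapping.map \<iota> x)) \<subseteq> Poly_Mapping.keys x"
    for r and x :: "'b \<Rightarrow>\<^sub>0 'r"
    by (auto simp: in_keys_iff lookup_map_zero hom_zero)
  have hs: "\<iota> (sum g I) = (\<Sum>i\<in>I. \<iota> (g i))" for g and I :: "'b set"
    by (induction I rule: infinite_finite_induct) (auto simp: hom_zero hom_add)
  show ?thesis
    unfolding base_change_def free_algebra_mult_single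
    by (subst free_algebra_mult[of "Poly_Mapping.keys x" _ "Poly_Mapping.keys y"],
        (simp_all add: k)[4], subst free_algebra_mult[of "Poly_Mapping.keys x" _ "Poly_Mapping.keys y"],
        simp_all)
      (auto intro!: poly_mapping_eqI sum.cong
        simp: lookup_sum lookup_map_zero hom_zero hs hom_mult sum_distrib_left mult_ac)
qed

lemma base_change_universal:
  fixes \<beta> :: "'s \<Rightarrow> ('b \<Rightarrow>\<^sub>0 'r) \<Rightarrow> 'c::ab_group_add"
    and \<mu> :: "'b \<Rightarrow> 'b \<Rightarrow> ('b \<Rightarrow>\<^sub>0 'r)" and u :: "'b \<Rightarrow>\<^sub>0 'r"
  assumes add_left: "\<And>r s x. Poly_Mapping.keys x \<subseteq> B \<Longrightarrow> \<beta> (r + s) x = \<beta> r x + \<beta> s x"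
    and add_right: "\<And>r x y. Poly_Mapping.keys x \<subseteq> B \<Longrightarrow> Poly_Mapping.keys y \<subseteq> B \<Longrightarrow>
          \<beta> r (x + y) = \<beta> r x + \<beta> r y"
    and balanced: "\<And>r c x. Poly_Mapping.keys x \<subseteq> B \<Longrightarrow> \<beta> (r * \<iota> c) x = \<beta> r (scale c x)"
  defines "C \<equiv> carrier (base_change \<iota> B (free_algebra B \<mu> u))"
  shows "\<exists>!\<phi>. \<phi> \<in> extensional C \<and> (\<forall>v\<in>C. \<forall>w\<in>C. \<phi> (v + w) = \<phi> v + \<phi> w) \<and>
    (\<forall>r x. Poly_Mapping.keys x \<subseteq> B \<longrightarrow> \<phi> (scale r (Poly_Mapping.map \<iota> x)) = \<beta> r x)"
proof -
  have C: "C = {w. Poly_Mapping.keys w \<subseteq> B}"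
    by (simp add: C_def base_change_def free_algebra_def)
  have k: "Poly_Mapping.keys (scale r (Poly_Mapping.map \<iota> x)) \<subseteq> Poly_Mapping.keys x"
    for r and x :: "'b \<Rightarrow>\<^sub>0 'r"
    by (auto simp: in_keys_iff lookup_map_zero hom_zero)
  have sg_eq: "Poly_Mapping.single b r = scale r (Poly_Mapping.map \<iota> (Poly_Mapping.single b 1))" for b :: 'b and r
    by (rule poly_mapping_eqI) (simp add: lookup_single lookup_map_zero hom_zero hom_one when_def)
  have zl: "\<beta> 0 x = 0" if "Poly_Mapping.keys x \<subseteq> B" for x using add_left[OF that, of 0 0] by simp
  have zr: "\<beta> r 0 = 0" for r using add_right[of 0 0 r] by simp
  define \<phi>0 where "\<phi>0 w = (\<Sum>b\<in>Poly_Mapping.keys w. \<beta> (Poly_Mapping.lookup w b) (Poly_Mapping.single b 1))" for w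
  have ext: "\<phi>0 w = (\<Sum>b\<in>K. \<beta> (Poly_Mapping.lookup w b) (Poly_Mapping.single b 1))"
    if "finite K" "Poly_Mapping.keys w \<subseteq> K" "K \<subseteq> B" for w K
    unfolding \<phi>0_def using that by (intro sum.mono_neutral_left) (auto simp: in_keys_iff intro!: zl)
  have add: "\<phi>0 (v + w) = \<phi>0 v + \<phi>0 w" if "v \<in> C" "w \<in> C" for v w
  proof -
    let ?K = "Poly_Mapping.keys v \<union> Poly_Mapping.keys w"
    have K: "finite ?K" "?K \<subseteq> B" using that C by auto
    have "\<phi>0 (v + w) = (\<Sum>b\<in>?K. \<beta> (Poly_Mapping.lookup (v + w) b) (Poly_Mapping.single b 1))"
      by (rule ext) (use K keys_add[of v w] in auto)
    also have "\<dots> = (\<Sum>b\<in>?K. \<beta> (Poly_Mapping.lookup v b) (Poly_Mapping.single b 1))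
        + (\<Sum>b\<in>?K. \<beta> (Poly_Mapping.lookup w b) (Poly_Mapping.single b 1))"
      unfolding lookup_add sum.distrib[symmetric] using K(2)
      by (intro sum.cong HOL.refl add_left) auto
    also have "\<dots> = \<phi>0 v + \<phi>0 w" using ext[OF K(1) _ K(2)] by simp
    finally show ?thesis .
  qed
  have br: "\<beta> r (sum g I) = (\<Sum>i\<in>I. \<beta> r (g i)) \<and> Poly_Mapping.keys (sum g I) \<subseteq> B"
    if "finite I" "\<And>i. i \<in> I \<Longrightarrow> Poly_Mapping.keys (g i) \<subseteq> B" for r g and I :: "'b set"
    using that
  proof (induction I rule: finite_induct)
    case (insert i I)
    then have i: "Poly_Mapping.keys (g i) \<subseteq> B"
      and I: "\<beta> r (sum g I) = (\<Sum>i\<in>I. \<beta> r (g i))" "Poly_Mapping.keys (sum g I) \<subseteq> B" by auto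
    show ?case using insert.hyps i I keys_add[of "g i" "sum g I"] by (auto simp: add_right)
  qed (simp add: zr)
  have val: "\<phi>0 (scale r (Poly_Mapping.map \<iota> x)) = \<beta> r x" if x: "Poly_Mapping.keys x \<subseteq> B" for r x
  proof -
    have "\<phi>0 (scale r (Poly_Mapping.map \<iota> x)) =
      (\<Sum>b\<in>Poly_Mapping.keys x. \<beta> (r * \<iota> (Poly_Mapping.lookup x b)) (Poly_Mapping.single b 1))"
      by (subst ext[OF _ k x]) (simp_all add: lookup_map_zero hom_zero)
    also have "\<dots> = (\<Sum>b\<in>Poly_Mapping.keys x. \<beta> r (Poly_Mapping.single b (Poly_Mapping.lookup x b)))"
    proof (intro sum.cong HOL.refl)
      fix b assume "b \<in> Poly_Mapping.keys x"
      then have "\<beta> (r * \<iota> (Poly_Mapping.lookup x b)) (Poly_Mapping.single b 1) =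
          \<beta> r (scale (Poly_Mapping.lookup x b) (Poly_Mapping.single b 1))"
        using x by (intro balanced) auto
      then show "\<beta> (r * \<iota> (Poly_Mapping.lookup x b)) (Poly_Mapping.single b 1) =
          \<beta> r (Poly_Mapping.single b (Poly_Mapping.lookup x b))"
        by (simp add: scale_def)
    qed
    also have "\<dots> = \<beta> r (\<Sum>b\<in>Poly_Mapping.keys x. Poly_Mapping.single b (Poly_Mapping.lookup x b))"
      using x by (intro br[THEN conjunct1, symmetric]) auto
    also have "\<dots> = \<beta> r x" using sum_singles[of x] by simp
    finally show ?thesis .
  qed
  have uniq: "\<psi> w = \<phi>0 w"
    if ad: "\<forall>v\<in>C. \<forall>w\<in>C. \<psi> (v + w) = \<psi> v + \<psi> w"
      and vl: "\<forall>r x. Poly_Mapping.keys x \<subseteq> B \<longrightarrow> \<psi> (scale r (Poly_Mapping.map \<iota> x)) = \<beta> r x"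
      and w: "w \<in> C" for \<psi> w
  proof -
    have z: "\<psi> 0 = 0" using ad[rule_format, of 0 0] C by simp
    have ps: "\<psi> (sum g I) = (\<Sum>i\<in>I. \<psi> (g i)) \<and> sum g I \<in> C"
      if "finite I" "\<And>i. i \<in> I \<Longrightarrow> g i \<in> C" for g and I :: "'b set"
      using that
    proof (induction I rule: finite_induct)
      case empty
      then show ?case using z C by simp
    next
      case (insert i I)
      then have i: "g i \<in> C" and I: "\<psi> (sum g I) = (\<Sum>i\<in>I. \<psi> (g i))" "sum g I \<in> C" by auto
      have "g i + sum g I \<in> C" using i I(2) keys_add[of "g i" "sum g I"] unfolding C by auto
      then show ?case using insert.hyps i I ad by simp
    qed
    have "\<psi> (\<Sum>b\<in>Poly_Mapping.keys w. Poly_Mapping.single b (Poly_Mapping.lookup w b)) =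
        (\<Sum>b\<in>Poly_Mapping.keys w. \<psi> (Poly_Mapping.single b (Poly_Mapping.lookup w b)))"
      by (rule ps[THEN conjunct1]) (use w C in auto)
    also have "\<dots> = (\<Sum>b\<in>Poly_Mapping.keys w. \<beta> (Poly_Mapping.lookup w b) (Poly_Mapping.single b 1))"
    proof (intro sum.cong HOL.refl)
      fix b assume "b \<in> Poly_Mapping.keys w"
      then have "Poly_Mapping.keys (Poly_Mapping.single b (1::'r)) \<subseteq> B" using w C by auto
      then show "\<psi> (Poly_Mapping.single b (Poly_Mapping.lookup w b)) =
          \<beta> (Poly_Mapping.lookup w b) (Poly_Mapping.single b 1)"
        using vl by (simp add: sg_eq)
    qed
    finally show ?thesis using sum_singles[of w] by (simp add: \<phi>0_def)
  qed
  have Cadd: "v + w \<in> C" if "v \<in> C" "w \<in> C" for v w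
    using that keys_add[of v w] unfolding C by auto
  have Cs: "scale r (Poly_Mapping.map \<iota> x) \<in> C" if "Poly_Mapping.keys x \<subseteq> B" for r x
    using that k[of r x] unfolding C by auto
  show ?thesis
  proof (rule ex1I[of _ "restrict \<phi>0 C"])
    show "restrict \<phi>0 C \<in> extensional C \<and>
      (\<forall>v\<in>C. \<forall>w\<in>C. restrict \<phi>0 C (v + w) = restrict \<phi>0 C v + restrict \<phi>0 C w) \<and>
      (\<forall>r x. Poly_Mapping.keys x \<subseteq> B \<longrightarrow> restrict \<phi>0 C (scale r (Poly_Mapping.map \<iota> x)) = \<beta> r x)"
      using add val Cadd Cs by simp
  next
    fix \<psi>
    assume \<psi>: "\<psi> \<in> extensional C \<and> (\<forall>v\<in>C. \<forall>w\<in>C. \<psi> (v + w) = \<psi> v + \<psi> w) \<and>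
      (\<forall>r x. Poly_Mapping.keys x \<subseteq> B \<longrightarrow> \<psi> (scale r (Poly_Mapping.map \<iota> x)) = \<beta> r x)"
    have "\<psi> w = restrict \<phi>0 C w" if "w \<in> C" for w
      unfolding restrict_apply'[OF that]
      by (rule uniq[OF conjunct1[OF conjunct2[OF \<psi>]] conjunct2[OF conjunct2[OF \<psi>]] that])
    then show "\<psi> = restrict \<phi>0 C"
      by (rule extensionalityI[OF conjunct1[OF \<psi>] restrict_extensional])
  qed
qed

end

section \<open>The coefficient rings\<close>

text \<open>In \<open>R0a\<close> the monomial exponent \<open>m :: nat \<Rightarrow>\<^sub>0 nat\<close> is the product of all \<open>z\<^sub>k\<close> to the power \<open>m k\<close>.
  In \<open>Ra\<close> the exponent \<open>(e, m)\<close> is \<open>A\<close> to the power \<open>e\<close> times the product of all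
  \<open>z\<^sub>k\<^sub>+\<^sub>1\<close> to the power \<open>m k\<close> (there is no variable \<open>z\<^sub>0\<close>).\<close>

type_synonym R0a = "(nat \<Rightarrow>\<^sub>0 nat) \<Rightarrow>\<^sub>0 int"
type_synonym Ra = "(int \<times> (nat \<Rightarrow>\<^sub>0 nat)) \<Rightarrow>\<^sub>0 int"

definition z_var :: "nat \<Rightarrow> R0a" where
  "z_var k = Poly_Mapping.single (Poly_Mapping.single k 1) 1"

definition A_pow :: "int \<Rightarrow> Ra" where
  "A_pow e = Poly_Mapping.single (e, 0) 1"

definition z_img :: "nat \<Rightarrow> Ra" where
  "z_img k = (if k = 0 then - A_pow 2 - A_pow (- 2)
              else Poly_Mapping.single (0, Poly_Mapping.single (k - 1) 1) 1)"

definition R0a_embed :: "R0a \<Rightarrow> Ra" where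
  "R0a_embed p = (\<Sum>m\<in>Poly_Mapping.keys p. of_int (Poly_Mapping.lookup p m) *
      (\<Prod>k\<in>Poly_Mapping.keys m. z_img k ^ Poly_Mapping.lookup m k))"

context
begin

private definition zmon :: "(nat \<Rightarrow>\<^sub>0 nat) \<Rightarrow> Ra" where
  "zmon m = (\<Prod>k\<in>Poly_Mapping.keys m. z_img k ^ Poly_Mapping.lookup m k)"

private lemma zmon_superset:
  assumes "finite K" "Poly_Mapping.keys m \<subseteq> K"
  shows "zmon m = (\<Prod>k\<in>K. z_img k ^ Poly_Mapping.lookup m k)"
  unfolding zmon_def using assms by (intro prod.mono_neutral_left) (auto simp: in_keys_iff)

private lemma zmon_add: "zmon (m + m') = zmon m * zmon m'"
proof -
  let ?K = "Poly_Mapping.keys m \<union> Poly_Mapping.keys m'"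
  have "zmon (m + m') = (\<Prod>k\<in>?K. z_img k ^ Poly_Mapping.lookup (m + m') k)"
    by (rule zmon_superset) (use keys_add[of m m'] in auto)
  also have "\<dots> = zmon m * zmon m'"
    by (simp add: zmon_superset[of ?K] lookup_add power_add prod.distrib)
  finally show ?thesis .
qed

private lemma embed_superset:
  assumes "finite K" "Poly_Mapping.keys p \<subseteq> K"
  shows "R0a_embed p = (\<Sum>m\<in>K. of_int (Poly_Mapping.lookup p m) * zmon m)"
  unfolding R0a_embed_def zmon_def[symmetric] using assms
  by (intro sum.mono_neutral_left) (auto simp: in_keys_iff)

private lemma embed_single: "R0a_embed (Poly_Mapping.single m c) = of_int c * zmon m"
  by (subst embed_superset[of "{m}"]) auto

lemma R0a_embed_add: "R0a_embed (p + q) = R0a_embed p + R0a_embed q"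
proof -
  let ?K = "Poly_Mapping.keys p \<union> Poly_Mapping.keys q"
  have "R0a_embed (p + q) = (\<Sum>m\<in>?K. of_int (Poly_Mapping.lookup (p + q) m) * zmon m)"
    by (rule embed_superset) (use keys_add[of p q] in auto)
  also have "\<dots> = R0a_embed p + R0a_embed q"
    by (simp add: embed_superset[of ?K] lookup_add distrib_right sum.distrib)
  finally show ?thesis .
qed

private lemma embed_sum: "R0a_embed (sum g I) = (\<Sum>i\<in>I. R0a_embed (g i))"
  by (induction I rule: infinite_finite_induct)
    (simp_all add: R0a_embed_add, simp_all add: R0a_embed_def)

lemma R0a_embed_mult: "R0a_embed (p * q) = R0a_embed p * R0a_embed q"
proof -
  have "p * q = (\<Sum>m\<in>Poly_Mapping.keys p. \<Sum>m'\<in>Poly_Mapping.keys q.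
      Poly_Mapping.single (m + m') (Poly_Mapping.lookup p m * Poly_Mapping.lookup q m'))"
    by (subst sum_singles[of p], subst sum_singles[of q])
      (simp add: sum_product mult_single)
  then have "R0a_embed (p * q) = (\<Sum>m\<in>Poly_Mapping.keys p. \<Sum>m'\<in>Poly_Mapping.keys q.
      (of_int (Poly_Mapping.lookup p m) * zmon m) * (of_int (Poly_Mapping.lookup q m') * zmon m'))"
    by (simp add: embed_sum embed_single zmon_add mult_ac)
  also have "\<dots> = R0a_embed p * R0a_embed q"
    by (simp add: sum_product R0a_embed_def zmon_def)
  finally show ?thesis .
qed

lemma R0a_embed_one: "R0a_embed 1 = 1"
  using embed_single[of 0 1] by (simp add: zmon_def)

lemma R0a_embed_z_var: "R0a_embed (z_var k) = z_img k"
  by (simp add: z_var_def embed_single zmon_def)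

end

section \<open>Arrow flat tangles\<close>

type_synonym point = "nat \<times> nat"

definition points :: "nat \<Rightarrow> point set" where
  "points n = {0, 1} \<times> {1..n}"

text \<open>The order \<open>(0,1) < \<dots> < (0,n) < (1,n) < \<dots> < (1,1)\<close>.\<close>

definition pless :: "point \<Rightarrow> point \<Rightarrow> bool" where
  "pless p q \<longleftrightarrow> fst p < fst q \<or> (fst p = 0 \<and> fst q = 0 \<and> snd p < snd q)
                 \<or> (fst p = 1 \<and> fst q = 1 \<and> snd q < snd p)"

type_synonym flat = "point set set"
type_synonym arrow_flat = "flat \<times> (point set \<Rightarrow> int)"

definition flat_tangles :: "nat \<Rightarrow> flat set" where
  "flat_tangles n = {E. partition_on (points n) E \<and> (\<forall>\<alpha>\<in>E. card \<alpha> = 2)}"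

definition arrow_flat_tangles :: "nat \<Rightarrow> arrow_flat set" where
  "arrow_flat_tangles n = {(E, f). E \<in> flat_tangles n \<and> f \<in> E \<rightarrow>\<^sub>E UNIV \<and>
     (\<forall>a b c d. {(a, b), (c, d)} \<in> E \<longrightarrow>
        (if a = c then odd (f {(a, b), (c, d)}) else even (f {(a, b), (c, d)})))}"

text \<open>A step is an element \<open>{(a, b), (c, d)}\<close> of the disjoint union of \<open>E\<close> and \<open>E'\<close>, together with
  the choice of its source \<open>(a, b)\<close> and its target \<open>(c, d)\<close>.  The index \<open>i\<close> of the lists below starts
  at \<open>0\<close>.\<close>

datatype layer = First | Second
datatype step = Step (layer: layer) (src: point) (tgt: point)

definition steps :: "flat \<Rightarrow> flat \<Rightarrow> step set" where
  "steps E E' = {s. {src s, tgt s} \<in> (case layer s of First \<Rightarrow> E | Second \<Rightarrow> E')}"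

definition arcs :: "flat \<Rightarrow> flat \<Rightarrow> step list set" where
  "arcs E E' = {xs. xs \<noteq> [] \<and> set xs \<subseteq> steps E E' \<and>
     (\<forall>i. Suc i < length xs \<longrightarrow>
        snd (tgt (xs ! i)) = snd (src (xs ! Suc i)) \<and>
        (layer (xs ! i) = First \<longrightarrow>
           fst (tgt (xs ! i)) = 1 \<and> layer (xs ! Suc i) = Second \<and> fst (src (xs ! Suc i)) = 0) \<and>
        (layer (xs ! i) = Second \<longrightarrow>
           fst (tgt (xs ! i)) = 0 \<and> layer (xs ! Suc i) = First \<and> fst (src (xs ! Suc i)) = 1)) \<and>
     fst (src (hd xs)) = (case layer (hd xs) of First \<Rightarrow> 0 | Second \<Rightarrow> 1) \<and>
     fst (tgt (last xs)) = (case layer (last xs) of First \<Rightarrow> 0 | Second \<Rightarrow> 1) \<and>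
     pless (src (hd xs)) (tgt (last xs))}"

definition arc_boundary :: "step list \<Rightarrow> point set" where
  "arc_boundary xs = {src (hd xs), tgt (last xs)}"

definition cycles :: "flat \<Rightarrow> flat \<Rightarrow> step list set" where
  "cycles E E' = {xs. even (length xs) \<and> length xs \<ge> 2 \<and> set xs \<subseteq> steps E E' \<and>
     (\<forall>i. Suc i < length xs \<longrightarrow> snd (tgt (xs ! i)) = snd (src (xs ! Suc i))) \<and>
     (\<forall>i < length xs.
        (even i \<longrightarrow> layer (xs ! i) = First \<and> fst (src (xs ! i)) = 1 \<and> fst (tgt (xs ! i)) = 1) \<and>
        (odd i \<longrightarrow> layer (xs ! i) = Second \<and> fst (src (xs ! i)) = 0 \<and> fst (tgt (xs ! i)) = 0)) \<and>
     snd (src (hd xs)) = snd (tgt (last xs)) \<and>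
     (\<forall>i. Suc i < length xs \<longrightarrow> snd (src (hd xs)) < snd (tgt (xs ! i)))}"

definition parity :: "step \<Rightarrow> int" where
  "parity s = (if fst (src s) = fst (tgt s) then - 1 else 1)"

definition cum_parity :: "step list \<Rightarrow> nat \<Rightarrow> int" where
  "cum_parity xs i =
     (if pless (src (xs ! i)) (tgt (xs ! i)) then (\<Prod>j<i. parity (xs ! j))
      else (\<Prod>j\<le>i. parity (xs ! j)))"

definition step_label :: "(point set \<Rightarrow> int) \<Rightarrow> (point set \<Rightarrow> int) \<Rightarrow> step \<Rightarrow> int" where
  "step_label f f' s = (case layer s of First \<Rightarrow> f {src s, tgt s} | Second \<Rightarrow> f' {src s, tgt s})"

definition total_label :: "(point set \<Rightarrow> int) \<Rightarrow> (point set \<Rightarrow> int) \<Rightarrow> step list \<Rightarrow> int" where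
  "total_label f f' xs = (\<Sum>i<length xs. cum_parity xs i * step_label f f' (xs ! i))"

definition flat_comp :: "flat \<Rightarrow> flat \<Rightarrow> flat" where
  "flat_comp E E' = arc_boundary ` arcs E E'"

definition arrow_comp :: "arrow_flat \<Rightarrow> arrow_flat \<Rightarrow> arrow_flat" where
  "arrow_comp = (\<lambda>(E, f) (E', f'). (flat_comp E E',
     \<lambda>\<beta>\<in>flat_comp E E'. total_label f f' (THE xs. xs \<in> arcs E E' \<and> arc_boundary xs = \<beta>)))"

definition zeta_index :: "(point set \<Rightarrow> int) \<Rightarrow> (point set \<Rightarrow> int) \<Rightarrow> step list \<Rightarrow> nat" where
  "zeta_index f f' xs = nat (\<bar>total_label f f' xs\<bar> div 2)"

definition cycle_weight :: "arrow_flat \<Rightarrow> arrow_flat \<Rightarrow> R0a" where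
  "cycle_weight = (\<lambda>(E, f) (E', f'). \<Prod>xs\<in>cycles E E'. z_var (zeta_index f f' xs))"

definition vertical :: "nat set \<Rightarrow> flat" where
  "vertical K = (\<lambda>k. {(0, k), (1, k)}) ` K"

definition id_tangle :: "nat \<Rightarrow> arrow_flat" where
  "id_tangle n = (vertical {1..n}, \<lambda>\<alpha>\<in>vertical {1..n}. 0)"

definition F_tangle :: "nat \<Rightarrow> nat \<Rightarrow> arrow_flat" where
  "F_tangle n i =
    (let H = {{(0, i), (0, i + 1)}, {(1, i), (1, i + 1)}}; E = H \<union> vertical ({1..n} - {i, i + 1})
     in (E, \<lambda>\<alpha>\<in>E. if \<alpha> \<in> H then 1 else 0))"

definition w_tangle :: "nat \<Rightarrow> nat \<Rightarrow> arrow_flat" where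
  "w_tangle n i =
    (let E = {{(0, i), (1, i + 1)}, {(0, i + 1), (1, i)}} \<union> vertical ({1..n} - {i, i + 1})
     in (E, \<lambda>\<alpha>\<in>E. 0))"

section \<open>The arrow Temperley-Lieb algebra\<close>

definition ATL :: "nat \<Rightarrow> (R0a, arrow_flat \<Rightarrow>\<^sub>0 R0a) module" where
  "ATL n = free_algebra (arrow_flat_tangles n)
     (\<lambda>F F'. Poly_Mapping.single (arrow_comp F F') (cycle_weight F F'))
     (Poly_Mapping.single (id_tangle n) 1)"

definition ATL_Ra :: "nat \<Rightarrow> (Ra, arrow_flat \<Rightarrow>\<^sub>0 Ra) module" where
  "ATL_Ra n = base_change R0a_embed (arrow_flat_tangles n) (ATL n)"

end

theory Submission
  imports Defs
begin

text \<open>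
  A tangle is encoded as a pairing of its end points with a label for each direction of travel. The
  product of two tangles is obtained by placing them side by side and joining the \<open>n\<close> pairs of inner
  points one at a time. Joinings of disjoint pairs of points commute, loop coefficients included.
  Left multiplication by \<open>F\<^sub>i\<close> is itself such a joining, of two outer points, and left
  multiplication by \<open>w\<^sub>i\<close> renames two outer points. Hence both commute with taking products, that
  is, \<open>G (X Y) = (G X) Y\<close> for every generator \<open>G\<close>. This much associativity suffices: the value of a
  word, multiplied out from the right, is multiplicative in the word, and each defining relation
  only has to be checked on the identity tangle. There \<open>F\<^sub>i F\<^sub>i = z\<^sub>0 F\<^sub>i\<close> and \<open>F\<^sub>i F\<^sub>j F\<^sub>i = F\<^sub>i\<close> for
  neighbouring \<open>i\<close> and \<open>j\<close>, which gives invertibility and the braid relation by Kauffman's computation.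
\<close>

text \<open>A product is defined through lists of steps, and associativity in these terms would mean
  cutting and splicing such lists for three factors. Lists are therefore confined to the comparison
  of one product with its gluing and to the identity as a left factor; everything else is a local
  update of a diagram. Two choices make these updates commute. A joining does not remove its two
  points but leaves a new strand on them, so that all joinings act on one fixed set of points, and
  the two arcs of \<open>F_i\<close> come from a single joining. And the label of a strand is kept
  at both ends, because a joining may force the strand to be read in either direction.

  \<open>-A^-2 1 - A^-4 F_i\<close> is Kauffman's \<open>A 1 + A^-1 F_i\<close> multiplied by
  \<open>-A^-3\<close>. Replacing \<open>A\<close> by \<open>A^-1\<close> gives its inverse because
  \<open>z_0 = -A^2 - A^-2\<close>.\<close>

section \<open>Labelled pairings and hooks\<close>

text \<open>Reading a label along an oriented strand, the labels of consecutive pieces compose by \<open>\<star>\<close> (the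
  infinite dihedral group: the parity sign of a piece is \<open>- 1\<close> exactly when its label is odd), and
  reversing the orientation turns a label \<open>a\<close> into \<open>lrev a\<close>.\<close>

definition lmul :: "int \<Rightarrow> int \<Rightarrow> int" (infixl "\<star>" 70) where
  "a \<star> b = (if even a then a + b else a - b)"

definition lrev :: "int \<Rightarrow> int" where
  "lrev a = (if even a then a else - a)"

text \<open>Only even labels occur on loops; the value at odd ones makes \<open>loop_index\<close> a class function.\<close>

definition loop_index :: "int \<Rightarrow> nat" where
  "loop_index h = (if even h then nat (\<bar>h\<bar> div 2) else 0)"

lemma lmul_assoc: "a \<star> b \<star> c = a \<star> (b \<star> c)"
  by (auto simp: lmul_def)

lemma lmul_0 [simp]: "a \<star> 0 = a" "0 \<star> a = a"
  by (auto simp: lmul_def)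

lemma even_lmul [simp]: "even (a \<star> b) \<longleftrightarrow> (even a \<longleftrightarrow> even b)"
  by (auto simp: lmul_def)

lemma even_lrev [simp]: "even (lrev a) \<longleftrightarrow> even a"
  by (auto simp: lrev_def)

text \<open>The inverse of \<open>a\<close> for \<open>\<star>\<close> is \<open>- a\<close> if
  \<open>a\<close> is even and \<open>a\<close> itself if \<open>a\<close> is odd, so
  \<open>lrev\<close> is inversion followed by negation, and negation is an automorphism of
  \<open>\<star>\<close>.\<close>

lemma lrev_lmul: "lrev (a \<star> b) = lrev b \<star> lrev a"
  by (auto simp: lmul_def lrev_def)

lemma lrev_lrev [simp]: "lrev (lrev a) = a"
  by (auto simp: lrev_def)

lemma lrev_0 [simp]: "lrev 0 = 0"
  by (simp add: lrev_def)

text \<open>Moves the base point of a loop past one of its pieces. For two odd pieces this changes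
  the sign of the total label, which the absolute value in \<open>loop_index\<close>
  absorbs.\<close>

lemma loop_index_commute: "loop_index (a \<star> b) = loop_index (b \<star> a)"
  by (auto simp: loop_index_def lmul_def add.commute abs_minus_commute)

lemma loop_index_lrev: "loop_index (lrev a) = loop_index a"
  by (auto simp: loop_index_def lrev_def)

text \<open>A diagram consists of the partner of each point (unused points are their own partner), the
  label read from each point to its partner, and a coefficient.\<close>

type_synonym 'p diagram = "('p \<Rightarrow> 'p) \<times> ('p \<Rightarrow> int) \<times> R0a"

definition well_paired :: "'p diagram \<Rightarrow> bool" where
  "well_paired = (\<lambda>(e, l, w). \<forall>x. e (e x) = x \<and> l (e x) = lrev (l x))"

text \<open>Join the strands ending at \<open>p\<close> and \<open>q\<close> by an arc labelled \<open>c\<close> from \<open>p\<close> to \<open>q\<close>, and then start a new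
  strand labelled \<open>d\<close> from \<open>p\<close> to \<open>q\<close>.\<close>

definition hook :: "'p \<Rightarrow> 'p \<Rightarrow> int \<Rightarrow> int \<Rightarrow> 'p diagram \<Rightarrow> 'p diagram" where
  "hook p q c d = (\<lambda>(e, l, w).
     if e p = q then (e, l(p := d, q := lrev d), w * z_var (loop_index (l p \<star> lrev c)))
     else (e(e p := e q, e q := e p, p := q, q := p),
           l(e p := l (e p) \<star> c \<star> l q, e q := l (e q) \<star> lrev c \<star> l p, p := d, q := lrev d), w))"

lemma hook_loop:
  assumes "e p = q"
  shows "hook p q c d (e, l, w) =
    (e, l(p := d, q := lrev d), w * z_var (loop_index (l p \<star> lrev c)))"
  using assms by (simp add: hook_def)

lemma hook_join:
  assumes "e p = a" "e q = b" "a \<noteq> q"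
  shows "hook p q c d (e, l, w) = (e(a := b, b := a, p := q, q := p),
     l(a := l a \<star> c \<star> l q, b := l b \<star> lrev c \<star> l p, p := d, q := lrev d), w)"
  using assms by (simp add: hook_def)

text \<open>An arc may be read from either of its ends. When it closes a loop, the two readings
  traverse the loop in opposite directions, and \<open>loop_index\<close> depends neither on
  direction nor on base point.\<close>

lemma hook_flip:
  assumes "well_paired D" "p \<noteq> q" "fst D p \<noteq> p" "fst D q \<noteq> q"
  shows "hook q p (lrev c) (lrev d) D = hook p q c d D"
proof -
  obtain e l w where D: "D = (e, l, w)" by (metis prod_cases3)
  have ee: "\<And>x. e (e x) = x" and ll: "\<And>x. l (e x) = lrev (l x)"
    using assms(1) by (auto simp: D well_paired_def)
  show ?thesis
  proof (cases "e p = q")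
    case True
    then have "e q = p" using ee by metis
    have "l q = lrev (l p)" using True ll by metis
    then have "loop_index (l q \<star> c) = loop_index (l p \<star> lrev c)"
      by (metis loop_index_commute loop_index_lrev lrev_lmul lrev_lrev)
    then show ?thesis using True \<open>e q = p\<close> assms(2) by (auto simp: D hook_def fun_eq_iff)
  next
    case False
    then have "e q \<noteq> p" "e p \<noteq> e q" using ee assms(2) by metis+
    then show ?thesis using False assms(2-4) by (auto simp: D hook_def fun_eq_iff)
  qed
qed

text \<open>With \<open>hook_fixpoint\<close>: a hook keeps the set of points in use, so the side
  conditions of one hook survive the application of others.\<close>

lemma hook_no_fixpoint:
  assumes "well_paired D" "p \<noteq> q" "fst D p \<noteq> p" "fst D q \<noteq> q" "fst D x \<noteq> x"
  shows "fst (hook p q c d D) x \<noteq> x"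
proof -
  obtain e l w where D: "D = (e, l, w)" by (metis prod_cases3)
  have ee: "e (e p) = p" "e (e q) = q" using assms(1) by (auto simp: D well_paired_def)
  have "e p \<noteq> e q" using ee assms(2) by metis
  then show ?thesis using assms by (auto simp: D hook_def)
qed

lemma hook_fixpoint:
  assumes "well_paired D" "fst D p \<noteq> p" "fst D q \<noteq> q" "fst D x = x"
  shows "fst (hook p q c d D) x = x" "fst (snd (hook p q c d D)) x = fst (snd D) x"
proof -
  obtain e l w where D: "D = (e, l, w)" by (metis prod_cases3)
  have ee: "e (e p) = p" "e (e q) = q" using assms(1) by (auto simp: D well_paired_def)
  have "x \<noteq> p" "x \<noteq> q" "x \<noteq> e p" "x \<noteq> e q" "e x = x" using assms ee by (auto simp: D)
  then show "fst (hook p q c d D) x = x" "fst (snd (hook p q c d D)) x = fst (snd D) x"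
    by (simp_all add: D hook_def)
qed

lemma well_paired_hook:
  assumes "well_paired D" "p \<noteq> q" "fst D p \<noteq> p" "fst D q \<noteq> q"
  shows "well_paired (hook p q c d D)"
proof -
  obtain e l w where D: "D = (e, l, w)" by (metis prod_cases3)
  have ee: "\<And>x. e (e x) = x" and ll: "\<And>x. l (e x) = lrev (l x)"
    using assms(1) by (auto simp: D well_paired_def)
  show ?thesis
  proof (cases "e p = q")
    case True
    then have "e q = p" using ee by metis
    have "e x \<noteq> p" "e x \<noteq> q" if "x \<noteq> p" "x \<noteq> q" for x
      using that \<open>e q = p\<close> True ee by metis+
    then show ?thesis using True \<open>e q = p\<close> assms(2) ee ll by (auto simp: D hook_def well_paired_def)
  next
    case False
    then have *: "e q \<noteq> p" "e p \<noteq> e q" using ee assms(2) by metis+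
    have **: "e x \<noteq> p" "e x \<noteq> q" "e x \<noteq> e p" "e x \<noteq> e q" if "x \<noteq> p" "x \<noteq> q" "x \<noteq> e p" "x \<noteq> e q" for x
      using that ee by metis+
    show ?thesis using False assms(2-4) ee ll * **
      by (auto simp: D hook_def well_paired_def lrev_lmul lmul_assoc)
  qed
qed

section \<open>Hooks at disjoint pairs of points commute\<close>

lemma hook_commute_adjacent:
  assumes wp: "well_paired (e, l, w)" and dist: "distinct [p, q, r, s]"
    and act: "e q \<noteq> q" "e s \<noteq> s" and pr: "e p = r"
  shows "hook p q c d (hook r s c' d' (e, l, w)) = hook r s c' d' (hook p q c d (e, l, w))"
proof -
  have ee: "\<And>x. e (e x) = x" and ll: "\<And>x. l (e x) = lrev (l x)"
    using wp by (auto simp: well_paired_def)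
  have rp: "e r = p" using ee pr by metis
  have ne: "p \<noteq> q" "p \<noteq> r" "p \<noteq> s" "q \<noteq> r" "q \<noteq> s" "r \<noteq> s" using dist by auto
  show ?thesis
  proof (cases "e q = s")
    \<comment> \<open>The strands \<open>p\<close>-\<open>r\<close> and
      \<open>q\<close>-\<open>s\<close> and the two arcs form a single loop. Whichever arc comes
      first joins the strands, and the second one closes the loop.\<close>
    case True
    then have sq: "e s = q" using ee by metis
    note ne = ne ne[symmetric]
    have lr: "l r = lrev (l p)" "l s = lrev (l q)" using pr True ll by metis+
    \<comment> \<open>The loop read from \<open>r\<close> through \<open>p\<close>,
      \<open>q\<close>, \<open>s\<close> is the reverse of the loop read from \<open>p\<close>
      through \<open>r\<close>, \<open>s\<close>, \<open>q\<close>, up to the base point.\<close>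
    have "loop_index (l r \<star> c \<star> l q \<star> lrev c') = loop_index (lrev (l r \<star> c \<star> l q \<star> lrev c'))"
      by (simp only: loop_index_lrev)
    also have "\<dots> = loop_index ((c' \<star> l s \<star> lrev c) \<star> l p)"
      by (simp add: lrev_lmul lmul_assoc lr)
    also have "\<dots> = loop_index (l p \<star> c' \<star> l s \<star> lrev c)"
      by (subst loop_index_commute) (simp add: lmul_assoc)
    finally have li: "loop_index (l r \<star> c \<star> l q \<star> lrev c') = loop_index (l p \<star> c' \<star> l s \<star> lrev c)" .
    show ?thesis
      apply (subst hook_join[of e, OF rp sq], simp add: ne)
      apply (subst hook_loop, simp add: ne)
      apply (subst hook_join[of e, OF pr True], simp add: ne)
      apply (subst hook_loop, simp add: ne)
      apply (simp add: ne li)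
      apply (intro conjI ext)
      subgoal for x
        by (cases "x \<in> {p, q, r, s}", elim insertE emptyE; simp add: ne)
      subgoal for x
        by (cases "x \<in> {p, q, r, s}", elim insertE emptyE; simp add: ne)
      done
  next
    case False
    \<comment> \<open>Here the strands form one path from \<open>u\<close> over \<open>q\<close>,
      \<open>p\<close>, \<open>r\<close>, \<open>s\<close> to \<open>v\<close>; associativity of
      \<open>\<star>\<close> makes its label independent of the order of joining.\<close>
    define u v where "u = e q" and "v = e s"
    have e: "e q = u" "e s = v" by (simp_all add: u_def v_def)
    have "p \<noteq> u" "p \<noteq> v" "q \<noteq> u" "q \<noteq> v" "r \<noteq> u" "r \<noteq> v" "s \<noteq> u" "s \<noteq> v" "u \<noteq> v"
      using ee ne act rp pr False unfolding u_def v_def by metis+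
    note ne = ne this ne[symmetric] this[symmetric]
    show ?thesis
      apply (subst hook_join[of e, OF rp e(2)], simp add: ne)
      apply (subst hook_join[of _ p v q u], simp_all add: ne e)
      apply (subst hook_join[of e, OF pr e(1)], simp add: ne)
      apply (subst hook_join[of _ r u s v], simp_all add: ne e)
      apply (intro conjI ext)
      subgoal for x
        by (cases "x \<in> {p, q, r, s, u, v}", elim insertE emptyE; simp add: ne)
      subgoal for x
        by (cases "x \<in> {p, q, r, s, u, v}", elim insertE emptyE; simp add: ne lmul_assoc)
      done
  qed
qed

text \<open>Each hook changes the diagram only at its two points and their partners, and here the
  two sets are disjoint. The cases record which of the hooks close a loop.\<close>

lemma hook_commute_apart:
  assumes wp: "well_paired (e, l, w)" and dist: "distinct [p, q, r, s]"
    and act: "e p \<noteq> p" "e q \<noteq> q" "e r \<noteq> r" "e s \<noteq> s"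
    and apart: "e p \<notin> {r, s}" "e q \<notin> {r, s}"
  shows "hook p q c d (hook r s c' d' (e, l, w)) = hook r s c' d' (hook p q c d (e, l, w))"
proof -
  define a b u v where "a = e p" and "b = e q" and "u = e r" and "v = e s"
  have e: "e p = a" "e q = b" "e r = u" "e s = v" by (simp_all add: a_def b_def u_def v_def)
  have ee: "\<And>x. e (e x) = x" using wp by (auto simp: well_paired_def)
  have ne: "p \<noteq> q" "p \<noteq> r" "p \<noteq> s" "q \<noteq> r" "q \<noteq> s" "r \<noteq> s"
    "p \<noteq> a" "p \<noteq> u" "p \<noteq> v" "q \<noteq> b" "q \<noteq> u" "q \<noteq> v" "r \<noteq> a" "r \<noteq> b" "r \<noteq> u" "s \<noteq> a" "s \<noteq> b" "s \<noteq> v"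
    "a \<noteq> b" "a \<noteq> u" "a \<noteq> v" "b \<noteq> u" "b \<noteq> v" "u \<noteq> v"
    using dist apart act ee unfolding a_def b_def u_def v_def
    by (simp_all, metis+)
  note ne = ne ne[symmetric]
  have eqs: "a = q \<longleftrightarrow> b = p" "u = s \<longleftrightarrow> v = r" using e ee by metis+
  show ?thesis
  proof (cases "a = q"; cases "u = s")
    assume "a = q" "u = s"
    then show ?thesis using e ne
      by (simp add: hook_loop mult_ac fun_upd_twist)
  next
    assume *: "a = q" "u \<noteq> s"
    then have "hook p q c d (hook r s c' d' (e, l, w)) = hook p q c d (e(u := v, v := u, r := s, s := r),
     l(u := l u \<star> c' \<star> l s, v := l v \<star> lrev c' \<star> l r, r := d', s := lrev d'), w)"
      using e by (simp add: hook_join)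
    also have "\<dots> = hook r s c' d' (hook p q c d (e, l, w))"
      using * e ne
      apply (simp add: hook_loop hook_join[of e r u s v])
      apply (intro ext)
      subgoal for x
        by (cases "x \<in> {p, q, r, s, u, v}", elim insertE emptyE; simp add: ne)
      done
    finally show ?thesis .
  next
    assume *: "a \<noteq> q" "u = s"
    then have "hook r s c' d' (hook p q c d (e, l, w)) = hook r s c' d' (e(a := b, b := a, p := q, q := p),
     l(a := l a \<star> c \<star> l q, b := l b \<star> lrev c \<star> l p, p := d, q := lrev d), w)"
      using e by (simp add: hook_join)
    also have "\<dots> = hook p q c d (hook r s c' d' (e, l, w))"
      using * e ne
      apply (simp add: hook_loop hook_join[of e p a q b])
      apply (intro ext)
      subgoal for x
        by (cases "x \<in> {p, q, r, s, a, b}", elim insertE emptyE; simp add: ne)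
      done
    finally show ?thesis by simp
  next
    assume *: "a \<noteq> q" "u \<noteq> s"
    then have "b \<noteq> p" "v \<noteq> r" "p \<noteq> b" "r \<noteq> v" using eqs by auto
    note ne = ne * *[symmetric] this
    show ?thesis
      apply (subst hook_join[of e, OF e(3,4)], simp add: ne)
      apply (subst hook_join[of _ p a q b], simp_all add: ne e)
      apply (subst hook_join[of e, OF e(1,2)], simp add: ne)
      apply (subst hook_join[of _ r u s v], simp_all add: ne e)
      apply (intro conjI ext)
      subgoal for x
        by (cases "x \<in> {p, q, r, s, a, b, u, v}", elim insertE emptyE; simp add: ne)
      subgoal for x
        by (cases "x \<in> {p, q, r, s, a, b, u, v}", elim insertE emptyE; simp add: ne)
      done
  qed
qed

text \<open>A strand between the two arcs can connect four pairs of ends. Reading the arcs backwards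
  reduces all of them to \<open>e p = r\<close>.\<close>

lemma hook_commute:
  assumes wp: "well_paired D" and dist: "distinct [p, q, r, s]"
    and act: "fst D p \<noteq> p" "fst D q \<noteq> q" "fst D r \<noteq> r" "fst D s \<noteq> s"
  shows "hook p q c d (hook r s c' d' D) = hook r s c' d' (hook p q c d D)"
proof -
  obtain e l w where D: "D = (e, l, w)" by (metis prod_cases3)
  have ee: "\<And>x. e (e x) = x" using wp by (auto simp: D well_paired_def)
  have adj: "hook x y c d (hook x' y' c' d' D) = hook x' y' c' d' (hook x y c d D)"
    if "distinct [x, y, x', y']" "e y \<noteq> y" "e y' \<noteq> y'" "e x = x'" for x y x' y' c d c' d'
    using hook_commute_adjacent[of e l w x y x' y'] that wp by (simp add: D)
  have pq: "hook q p (lrev c) (lrev d) D = hook p q c d D"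
    and rs: "hook s r (lrev c') (lrev d') D = hook r s c' d' D"
    by (rule hook_flip; use wp dist act in simp)+
  have pq': "hook q p (lrev c) (lrev d) (hook r s c' d' D) = hook p q c d (hook r s c' d' D)"
    and rs': "hook s r (lrev c') (lrev d') (hook p q c d D) = hook r s c' d' (hook p q c d D)"
    by (rule hook_flip; (rule well_paired_hook hook_no_fixpoint)?; use wp dist act in simp)+
  have ne: "q \<noteq> p" "r \<noteq> p" "s \<noteq> p" "r \<noteq> q" "s \<noteq> q" "s \<noteq> r" using dist by auto
  consider "e p = r" | "e p = s" | "e q = r" | "e q = s" | "e p \<notin> {r, s}" "e q \<notin> {r, s}"
    by auto
  then show ?thesis
  proof cases
    case 1
    then show ?thesis using adj[of p q r s c d c' d'] dist act by (simp add: D)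
  next
    case 2
    then show ?thesis using adj[of p q s r c d "lrev c'" "lrev d'"] dist ne act rs rs' by (simp add: D)
  next
    case 3
    then show ?thesis using adj[of q p r s "lrev c" "lrev d" c' d'] dist ne act pq pq' by (simp add: D)
  next
    case 4
    then show ?thesis using adj[of q p s r "lrev c" "lrev d" "lrev c'" "lrev d'"] dist ne act pq pq' rs rs'
      by (simp add: D)
  next
    case 5
    then show ?thesis using hook_commute_apart wp dist act by (simp add: D)
  qed
qed

text \<open>Conjugation by \<open>\<pi>\<close>, written without an inverse because
  \<open>\<pi>\<close> will always be an involution.\<close>

definition relabel :: "('p \<Rightarrow> 'p) \<Rightarrow> 'p diagram \<Rightarrow> 'p diagram" where
  "relabel \<pi> = (\<lambda>(e, l, w). (\<pi> \<circ> e \<circ> \<pi>, l \<circ> \<pi>, w))"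

lemma hook_relabel:
  assumes "\<And>x. \<pi> (\<pi> x) = x"
  shows "hook (\<pi> p) (\<pi> q) c d (relabel \<pi> D) = relabel \<pi> (hook p q c d D)"
proof -
  obtain e l w where D: "D = (e, l, w)" by (metis prod_cases3)
  have j: "\<pi> x = y \<longleftrightarrow> x = \<pi> y" and i: "\<pi> x = \<pi> y \<longleftrightarrow> x = y" for x y
    using assms by metis+
  show ?thesis
    by (auto simp: D hook_def relabel_def fun_eq_iff i assms j[of _ p] j[of _ q] j[of _ "e p"] j[of _ "e q"])
qed

section \<open>Tangles as labelled pairings\<close>

lemma pless_iff_not:
  assumes "p \<in> points n" "q \<in> points n" "p \<noteq> q"
  shows "pless q p \<longleftrightarrow> \<not> pless p q"
  using assms by (cases p; cases q) (auto simp: points_def pless_def)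

definition partner :: "nat \<Rightarrow> flat \<Rightarrow> point \<Rightarrow> point" where
  "partner n E p = (if p \<in> points n then THE q. {p, q} \<in> E else p)"

text \<open>The value \<open>f \<alpha>\<close> is the label read from the smaller end of
  \<open>\<alpha>\<close>: in \<open>cum_parity\<close> a step read from its larger end takes in its
  own parity as well, which turns \<open>a\<close> into \<open>lrev a\<close>.\<close>

definition dart_label :: "nat \<Rightarrow> arrow_flat \<Rightarrow> point \<Rightarrow> int" where
  "dart_label n F p = (if p \<in> points n then
     (let q = partner n (fst F) p; a = snd F {p, q} in if pless p q then a else lrev a) else 0)"

definition diagram :: "nat \<Rightarrow> arrow_flat \<Rightarrow> point diagram" where
  "diagram n F = (partner n (fst F), dart_label n F, 1)"

context
  fixes n :: nat and E :: flat
  assumes E: "E \<in> flat_tangles n"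
begin

lemma flat_edge_unique:
  assumes "{p, q} \<in> E" "{p, q'} \<in> E"
  shows "q = q'"
proof -
  have "{p, q} = {p, q'}"
    using disjointD[of E "{p, q}" "{p, q'}"] assms E by (auto simp: flat_tangles_def partition_on_def)
  moreover have "card {p, q} = 2" using assms E by (simp add: flat_tangles_def)
  ultimately show ?thesis by (auto simp: doubleton_eq_iff)
qed

lemma flat_edge_points:
  assumes "{p, q} \<in> E"
  shows "p \<in> points n" "q \<in> points n" "p \<noteq> q"
proof -
  have "\<Union>E = points n" "card {p, q} = 2" using assms E by (auto simp: flat_tangles_def partition_on_def)
  then show "p \<in> points n" "q \<in> points n" "p \<noteq> q" using assms by (blast, blast, auto)
qed

lemma partner_eqI:
  assumes "{p, q} \<in> E"
  shows "partner n E p = q"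
proof -
  have "(THE q. {p, q} \<in> E) = q"
    using assms flat_edge_unique by (intro the_equality) blast+
  then show ?thesis using flat_edge_points(1)[OF assms] by (simp add: partner_def)
qed

lemma partner_edge:
  assumes "p \<in> points n"
  shows "{p, partner n E p} \<in> E"
proof -
  have "p \<in> \<Union>E" using assms E by (auto simp: flat_tangles_def partition_on_def)
  then obtain \<alpha> where a: "\<alpha> \<in> E" "p \<in> \<alpha>" by blast
  then have "card \<alpha> = 2" using E by (auto simp: flat_tangles_def)
  then obtain q where "\<alpha> = {p, q}" using a(2) by (auto simp: card_2_iff)
  then show ?thesis using a partner_eqI by auto
qed

lemma partner_points [simp]: "partner n E p \<in> points n \<longleftrightarrow> p \<in> points n"
  using flat_edge_points(2)[OF partner_edge] by (metis partner_def)

lemma partner_neq: "p \<in> points n \<Longrightarrow> partner n E p \<noteq> p"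
  using partner_edge[of p] flat_edge_points(3)[of p "partner n E p"] by auto

lemma partner_partner [simp]: "partner n E (partner n E p) = p"
proof (cases "p \<in> points n")
  case True
  then show ?thesis using partner_edge[OF True] by (intro partner_eqI) (simp add: insert_commute)
qed (simp add: partner_def)

lemma flat_eq_partner: "E = (\<lambda>p. {p, partner n E p}) ` points n"
proof -
  have "\<exists>p\<in>points n. \<alpha> = {p, partner n E p}" if "\<alpha> \<in> E" for \<alpha>
  proof -
    have "card \<alpha> = 2" using that E by (simp add: flat_tangles_def)
    then obtain p q where "\<alpha> = {p, q}" by (auto simp: card_2_iff)
    then show ?thesis using that partner_eqI flat_edge_points by metis
  qed
  then show ?thesis using partner_edge by blast
qed

end

lemma arrow_flat_tanglesD:
  assumes "F \<in> arrow_flat_tangles n"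
  shows "fst F \<in> flat_tangles n" "snd F \<in> extensional (fst F)"
    "{p, q} \<in> fst F \<Longrightarrow> even (snd F {p, q}) \<longleftrightarrow> fst p \<noteq> fst q"
  using assms by (cases p; cases q; auto simp: arrow_flat_tangles_def PiE_def split: if_splits)+

lemma even_dart_label:
  assumes "F \<in> arrow_flat_tangles n" "p \<in> points n"
  shows "even (dart_label n F p) \<longleftrightarrow> fst p \<noteq> fst (partner n (fst F) p)"
  using assms arrow_flat_tanglesD(3)[OF assms(1) partner_edge[OF arrow_flat_tanglesD(1)[OF assms(1)] assms(2)]]
  by (simp add: dart_label_def Let_def)

lemma well_paired_diagram:
  assumes F: "F \<in> arrow_flat_tangles n"
  shows "well_paired (diagram n F)"
proof -
  note E = arrow_flat_tanglesD(1)[OF F]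
  have "dart_label n F (partner n (fst F) p) = lrev (dart_label n F p)" for p
  proof (cases "p \<in> points n")
    case True
    then show ?thesis using E pless_iff_not[of p n "partner n (fst F) p"] partner_neq[OF E True]
      by (auto simp: dart_label_def Let_def insert_commute)
  next
    case False
    then show ?thesis by (simp add: dart_label_def partner_def)
  qed
  then show ?thesis using E by (simp add: diagram_def well_paired_def)
qed

text \<open>Recognises the explicit tangles, and later the product, by their diagrams. The label
  equation is asked at the smaller end of each pair; well-pairedness supplies the other end.\<close>

lemma tangle_of_diagram:
  assumes E: "E = (\<lambda>p. {p, e p}) ` points n" and f: "f \<in> extensional E"
    and e: "\<And>p. p \<in> points n \<Longrightarrow> e p \<in> points n \<and> e p \<noteq> p"
    and lab: "\<And>p. p \<in> points n \<Longrightarrow> pless p (e p) \<Longrightarrow> f {p, e p} = l p"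
    and par: "\<And>p. p \<in> points n \<Longrightarrow> even (l p) \<longleftrightarrow> fst p \<noteq> fst (e p)"
    and wp: "well_paired (e, l, w)"
    and out: "\<And>p. p \<notin> points n \<Longrightarrow> e p = p \<and> l p = 0"
  shows "(E, f) \<in> arrow_flat_tangles n" "diagram n (E, f) = (e, l, 1)"
proof -
  have ee: "\<And>x. e (e x) = x" and ll: "\<And>x. l (e x) = lrev (l x)"
    using wp by (auto simp: well_paired_def)
  have disj: "\<alpha> = {p, e p}" if "\<alpha> \<in> E" "p \<in> \<alpha>" for \<alpha> p
  proof -
    obtain x where "\<alpha> = {x, e x}" using \<open>\<alpha> \<in> E\<close> unfolding E by blast
    then show ?thesis using \<open>p \<in> \<alpha>\<close> ee[of x] by (metis insert_commute insert_iff singletonD)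
  qed
  have flat: "E \<in> flat_tangles n"
    unfolding flat_tangles_def partition_on_def disjoint_def
  proof (intro CollectI conjI)
    show "\<Union>E = points n" using e by (auto simp: E)
    show "\<forall>a\<in>E. \<forall>b\<in>E. a \<noteq> b \<longrightarrow> a \<inter> b = {}" using disj by blast
    show "{} \<notin> E" by (auto simp: E)
    have "card {p, e p} = 2" if "p \<in> points n" for p using e[OF that] by (metis card_2_iff)
    then show "\<forall>\<alpha>\<in>E. card \<alpha> = 2" unfolding E by blast
  qed
  have pe: "partner n E = e"
  proof
    fix p
    show "partner n E p = e p"
    proof (cases "p \<in> points n")
      case True
      then show ?thesis by (intro partner_eqI[OF flat]) (simp add: E)
    qed (simp add: partner_def out)
  qed
  have fl: "f {p, e p} = (if pless p (e p) then l p else lrev (l p))" if p: "p \<in> points n" for p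
  proof (cases "pless p (e p)")
    case False
    then have "pless (e p) p" using pless_iff_not[of p n "e p"] e[OF p] p by auto
    then have "f {e p, e (e p)} = l (e p)" using e[OF p] ee by (intro lab) auto
    then show ?thesis using False by (simp add: ee ll insert_commute)
  qed (use lab p in simp)
  have "even (f {p, q}) \<longleftrightarrow> fst p \<noteq> fst q" if pq: "{p, q} \<in> E" for p q
  proof -
    have "p \<in> points n" "q = e p" using flat_edge_points[OF flat pq] partner_eqI[OF flat pq] pe by auto
    then show ?thesis using fl par by auto
  qed
  then show "(E, f) \<in> arrow_flat_tangles n"
    using flat f by (auto simp: arrow_flat_tangles_def PiE_def)
  have "dart_label n (E, f) p = l p" for p
    using fl out by (auto simp: dart_label_def pe Let_def)
  then show "diagram n (E, f) = (e, l, 1)" by (simp add: diagram_def pe fun_eq_iff)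
qed

text \<open>Carries equations between diagrams, where the computations take place, back to
  tangles.\<close>

lemma diagram_inject:
  assumes F: "F \<in> arrow_flat_tangles n" and F': "F' \<in> arrow_flat_tangles n"
    and eq: "diagram n F = diagram n F'"
  shows "F = F'"
proof -
  note E = arrow_flat_tanglesD(1)[OF F] and E' = arrow_flat_tanglesD(1)[OF F']
  have p: "partner n (fst F) = partner n (fst F')" and l: "dart_label n F = dart_label n F'"
    using eq by (auto simp: diagram_def)
  have fs: "fst F = fst F'"
    using flat_eq_partner[OF E] flat_eq_partner[OF E'] p by simp
  have "snd F \<alpha> = snd F' \<alpha>" if "\<alpha> \<in> fst F" for \<alpha>
  proof -
    obtain x where x: "x \<in> points n" "\<alpha> = {x, partner n (fst F) x}"
      using \<open>\<alpha> \<in> fst F\<close> flat_eq_partner[OF E] by blast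
    then show ?thesis
      using fun_cong[OF l, of x] fs lrev_lrev
      by (simp add: dart_label_def Let_def split: if_splits) (metis lrev_lrev)
  qed
  then have "snd F = snd F'"
    using arrow_flat_tanglesD(2)[OF F] arrow_flat_tanglesD(2)[OF F'] fs
    by (metis extensionalityI)
  then show ?thesis using fs by (simp add: prod_eq_iff)
qed

section \<open>Products as gluings\<close>

lemma partner_outside [simp]: "p \<notin> points n \<Longrightarrow> partner n E p = p"
  by (simp add: partner_def)

lemma dart_label_outside [simp]: "p \<notin> points n \<Longrightarrow> dart_label n F p = 0"
  by (simp add: dart_label_def)

definition beside :: "'p diagram \<Rightarrow> 'p diagram \<Rightarrow> (layer \<times> 'p) diagram" where
  "beside = (\<lambda>(e, l, w) (e', l', w').
     (\<lambda>(L, p). case L of First \<Rightarrow> (First, e p) | Second \<Rightarrow> (Second, e' p),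
      \<lambda>(L, p). case L of First \<Rightarrow> l p | Second \<Rightarrow> l' p, w * w'))"

text \<open>The arc carries the neutral label 0. So does the strand left behind; its ends lie on
  opposite sides, so this even label obeys the parity rule of \<open>regular\<close>.\<close>

definition glue_at :: "nat \<Rightarrow> (layer \<times> point) diagram \<Rightarrow> (layer \<times> point) diagram" where
  "glue_at k = hook (First, (1, k)) (Second, (0, k)) 0 0"

definition glue :: "nat \<Rightarrow> nat \<Rightarrow> (layer \<times> point) diagram \<Rightarrow> (layer \<times> point) diagram" where
  "glue k n = foldr glue_at [k..<Suc n]"

text \<open>The levels are glued in descending order, so a loop closed at level \<open>k\<close> is traversed from its
  smallest level on, which is how \<open>cycles\<close> lists it.\<close>

lemma glue_Suc: "k \<le> n \<Longrightarrow> glue k n D = glue_at k (glue (Suc k) n D)"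
  by (simp add: glue_def upt_conv_Cons del: upt_Suc)

lemma glue_empty: "glue (Suc n) n D = D"
  by (simp add: glue_def)

text \<open>\<open>outer\<close> places the boundary points of a product in the two stacked diagrams, and \<open>trim\<close> forgets
  the glued points, on which \<open>glue\<close> leaves cups.\<close>

definition outer :: "point \<Rightarrow> layer \<times> point" where
  "outer p = (if fst p = 0 then First else Second, p)"

definition trim :: "(layer \<times> point) diagram \<Rightarrow> point diagram" where
  "trim = (\<lambda>(e, l, w). (\<lambda>p. snd (e (outer p)), \<lambda>p. l (outer p), w))"

definition weighted :: "R0a \<Rightarrow> 'p diagram \<Rightarrow> 'p diagram" where
  "weighted c = (\<lambda>(e, l, w). (e, l, c * w))"

definition dart_src :: "step \<Rightarrow> layer \<times> point" where "dart_src s = (layer s, src s)"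

definition dart_tgt :: "step \<Rightarrow> layer \<times> point" where "dart_tgt s = (layer s, tgt s)"

definition glued :: "nat set \<Rightarrow> layer \<times> point \<Rightarrow> bool" where
  "glued K x \<longleftrightarrow> (\<exists>k\<in>K. x = (First, (1, k)) \<or> x = (Second, (0, k)))"

text \<open>On a glued point this is the point across the seam; subtraction from 1 exchanges the
  sides 0 and 1.\<close>

definition mate :: "layer \<times> point \<Rightarrow> layer \<times> point" where
  "mate x = (case fst x of First \<Rightarrow> Second | Second \<Rightarrow> First, (1 - fst (snd x), snd (snd x)))"

lemma glued_Suc: "glued {k..} x \<longleftrightarrow> glued {Suc k..} x \<or> x = (First, (1, k)) \<or> x = (Second, (0, k))"
proof -
  have "{k..} = insert k {Suc k..}" by auto
  then show ?thesis by (auto simp: glued_def)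
qed

lemma not_glued_outer: "p \<in> points n \<Longrightarrow> \<not> glued K (outer p)"
  by (auto simp: glued_def outer_def points_def)

lemma outer_if_not_glued: "snd x \<in> points n \<Longrightarrow> \<not> glued {1..} x \<Longrightarrow> x = outer (snd x)"
  by (cases x; cases "fst x") (auto simp: glued_def outer_def points_def)

section \<open>Gluing two tangles preserves the parity rule\<close>

locale tangle_pair =
  fixes n :: nat and F F' :: arrow_flat
  assumes F: "F \<in> arrow_flat_tangles n" and F': "F' \<in> arrow_flat_tangles n"
begin

definition "stacked = beside (diagram n F) (diagram n F')"

abbreviation "gsteps \<equiv> steps (fst F) (fst F')"

text \<open>An invariant of the gluing. Its parity clause makes the labels of closed loops even,
  where \<open>loop_index\<close> agrees with \<open>zeta_index\<close>, and makes the product an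
  arrow flat tangle.\<close>

definition regular :: "(layer \<times> point) diagram \<Rightarrow> bool" where
  "regular D \<longleftrightarrow> well_paired D \<and>
     (\<forall>x. if snd x \<in> points n then fst D x \<noteq> x \<and> snd (fst D x) \<in> points n \<and>
             (even (fst (snd D) x) \<longleftrightarrow> fst (snd x) \<noteq> fst (snd (fst D x)))
          else fst D x = x \<and> fst (snd D) x = 0)"

lemma regular_stacked: "regular stacked"
proof -
  note E = arrow_flat_tanglesD(1)[OF F] and E' = arrow_flat_tanglesD(1)[OF F']
  have "well_paired stacked"
    using well_paired_diagram[OF F] well_paired_diagram[OF F']
    by (auto simp: stacked_def beside_def well_paired_def diagram_def split: layer.splits)
  moreover have "if snd x \<in> points n then fst stacked x \<noteq> x \<and> snd (fst stacked x) \<in> points n \<and>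
             (even (fst (snd stacked) x) \<longleftrightarrow> fst (snd x) \<noteq> fst (snd (fst stacked x)))
          else fst stacked x = x \<and> fst (snd stacked) x = 0" for x
  proof -
    obtain L p where x: "x = (L, p)" by (cases x)
    show ?thesis
      unfolding x using partner_neq[OF E, of p] partner_neq[OF E', of p] even_dart_label[OF F, of p] even_dart_label[OF F', of p]
        partner_points[OF E, of p] partner_points[OF E', of p]
      by (cases L) (simp_all add: stacked_def beside_def diagram_def)
  qed
  ultimately show ?thesis unfolding regular_def by blast
qed

text \<open>The label of a joined strand is even iff the labels of its two pieces have equal parity.
  Since the glued points lie on opposite sides, this happens iff the far ends lie on opposite
  sides.\<close>

lemma regular_glue_at:
  assumes D: "regular D" and k: "1 \<le> k" "k \<le> n"
  shows "regular (glue_at k D)"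
proof -
  obtain e l w where De: "D = (e, l, w)" by (metis prod_cases3)
  define p q where "p = (First, (1::nat, k))" and "q = (Second, (0::nat, k))"
  have wp: "well_paired D" using D by (simp add: regular_def)
  then have ee: "\<And>x. e (e x) = x" by (auto simp: De well_paired_def)
  have pt: "snd p \<in> points n" "snd q \<in> points n" using k by (auto simp: p_def q_def points_def)
  have reg: "e x \<noteq> x" "snd (e x) \<in> points n" "even (l x) \<longleftrightarrow> fst (snd x) \<noteq> fst (snd (e x))"
    if "snd x \<in> points n" for x
    using D that unfolding regular_def De by (metis fst_conv snd_conv)+
  have irr: "e x = x" "l x = 0" if "snd x \<notin> points n" for x
    using D that unfolding regular_def De by (metis fst_conv snd_conv)+
  have pq: "p \<noteq> q" by (simp add: p_def q_def)
  note act = reg(1)[OF pt(1)] reg(1)[OF pt(2)]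
  have g: "glue_at k D = hook p q 0 0 D" by (simp add: glue_at_def p_def q_def)
  have wp': "well_paired (hook p q 0 0 D)"
    using wp pq act by (intro well_paired_hook) (simp_all add: De)
  have side: "fst (snd x) = 0 \<or> fst (snd x) = 1" if "snd x \<in> points n" for x :: "layer \<times> point"
    using that by (auto simp: points_def)
  have "if snd x \<in> points n then fst (hook p q 0 0 D) x \<noteq> x \<and> snd (fst (hook p q 0 0 D) x) \<in> points n \<and>
             (even (fst (snd (hook p q 0 0 D)) x) \<longleftrightarrow> fst (snd x) \<noteq> fst (snd (fst (hook p q 0 0 D) x)))
          else fst (hook p q 0 0 D) x = x \<and> fst (snd (hook p q 0 0 D)) x = 0" for x
  proof (cases "snd x \<in> points n")
    case False
    then show ?thesis
      using hook_fixpoint[OF wp, of p q x 0 0] act irr[OF False] by (simp add: De)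
  next
    case True
    have 1: "fst (hook p q 0 0 D) x \<noteq> x"
      using hook_no_fixpoint[OF wp pq, of x 0 0] act reg(1)[OF True] by (simp add: De)
    have 2: "snd (fst (hook p q 0 0 D) x) \<in> points n"
      using reg(2)[OF True] reg(2)[OF pt(1)] reg(2)[OF pt(2)] pt by (simp add: De hook_def)
    have sp: "fst (snd p) = 1" "fst (snd q) = 0" by (simp_all add: p_def q_def)
    have 3: "even (fst (snd (hook p q 0 0 D)) x) \<longleftrightarrow> fst (snd x) \<noteq> fst (snd (fst (hook p q 0 0 D) x))"
    proof (cases "e p = q")
      case True
      then have "e q = p" using ee by metis
      then show ?thesis using True \<open>snd x \<in> points n\<close> reg(3)[of x] sp by (simp add: De hook_def)
    next
      case False
      have ne: "e q \<noteq> p" "e p \<noteq> e q" using ee False pq by metis+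
      have parp: "even (l p) \<longleftrightarrow> fst (snd (e p)) = 0" "even (l (e p)) \<longleftrightarrow> fst (snd (e p)) = 0"
        using reg(3)[OF pt(1)] reg(3)[OF reg(2)[OF pt(1)]] side[OF reg(2)[OF pt(1)]] sp
        by (cases "fst (snd (e p)) = 0"; simp add: ee)+
      have parq: "even (l q) \<longleftrightarrow> fst (snd (e q)) = 1" "even (l (e q)) \<longleftrightarrow> fst (snd (e q)) = 1"
        using reg(3)[OF pt(2)] reg(3)[OF reg(2)[OF pt(2)]] side[OF reg(2)[OF pt(2)]] sp
        by (cases "fst (snd (e q)) = 0"; simp add: ee)+
      note sides = side[OF reg(2)[OF pt(1)]] side[OF reg(2)[OF pt(2)]]
      consider "x = p" | "x = q" | "x = e p" "x \<noteq> p" "x \<noteq> q" | "x = e q" "x \<noteq> p" "x \<noteq> q" "x \<noteq> e p"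
        | "x \<noteq> p" "x \<noteq> q" "x \<noteq> e p" "x \<noteq> e q" by blast
      then show ?thesis
      proof cases
        case 3
        then show ?thesis using False ne sides act parp parq
          by (cases "fst (snd (e p)) = 0"; cases "fst (snd (e q)) = 0"; simp add: De hook_def)
      next
        case 4
        then show ?thesis using False ne sides act parp parq
          by (cases "fst (snd (e p)) = 0"; cases "fst (snd (e q)) = 0"; simp add: De hook_def)
      qed (use False ne act sp pq reg(3)[OF True] in \<open>simp_all add: De hook_def\<close>)
    qed
    show ?thesis using True 1 2 3 by simp
  qed
  then show ?thesis unfolding g regular_def using wp' by blast
qed

lemma regular_glue:
  assumes "1 \<le> k" "k \<le> Suc n"
  shows "regular (glue k n stacked)"
  using assms(2,1)
proof (induction k rule: inc_induct)
  case base
  then show ?case by (simp add: glue_empty regular_stacked)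
next
  case (step k)
  then show ?case by (simp add: glue_Suc regular_glue_at)
qed

lemma gsteps_iff: "s \<in> gsteps \<longleftrightarrow> src s \<in> points n \<and> dart_tgt s = fst stacked (dart_src s)"
proof (cases s)
  case (Step L x y)
  note E = arrow_flat_tanglesD(1)[OF F] and E' = arrow_flat_tanglesD(1)[OF F']
  have "{x, y} \<in> G \<longleftrightarrow> x \<in> points n \<and> y = partner n G x" if G: "G \<in> flat_tangles n" for G
    using flat_edge_points(1)[OF G] partner_eqI[OF G] partner_edge[OF G] by metis
  then show ?thesis using E E'
    by (cases L) (simp_all add: Step steps_def dart_tgt_def dart_src_def stacked_def beside_def diagram_def)
qed

lemma gsteps_points:
  assumes "s \<in> gsteps"
  shows "src s \<in> points n" "tgt s \<in> points n"
proof -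
  have s: "src s \<in> points n" "dart_tgt s = fst stacked (dart_src s)" using assms gsteps_iff by auto
  have "snd (fst stacked (dart_src s)) \<in> points n"
    using regular_stacked s(1) unfolding regular_def by (metis dart_src_def snd_conv)
  then show "src s \<in> points n" "tgt s \<in> points n" using s by (simp_all add: dart_tgt_def flip: s(2))
qed

lemma gsteps_eqI: "s \<in> gsteps \<Longrightarrow> t \<in> gsteps \<Longrightarrow> dart_src s = dart_src t \<Longrightarrow> s = t"
  by (metis gsteps_iff dart_src_def dart_tgt_def prod.inject step.expand)

section \<open>Paths of steps across the glued levels\<close>

definition chain :: "nat set \<Rightarrow> step list \<Rightarrow> bool" where
  "chain K xs \<longleftrightarrow> xs \<noteq> [] \<and> set xs \<subseteq> gsteps \<and>
     successively (\<lambda>s t. glued K (dart_tgt s) \<and> dart_src t = mate (dart_tgt s)) xs"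

definition chain_label :: "step list \<Rightarrow> int" where
  "chain_label xs = foldr (\<lambda>s a. fst (snd stacked) (dart_src s) \<star> a) xs 0"

lemma chain_label_append: "chain_label (xs @ ys) = chain_label xs \<star> chain_label ys"
  by (induction xs) (simp_all add: chain_label_def lmul_assoc)

text \<open>The label of a step is odd exactly when its parity is - 1, so composing with it from the
  left multiplies what follows by that parity. Read from its larger end, the label itself is
  multiplied by the parity too.\<close>

lemma step_label_stacked:
  assumes "s \<in> gsteps"
  shows "fst (snd stacked) (dart_src s) \<star> a =
    (if pless (src s) (tgt s) then 1 else parity s) * step_label (snd F) (snd F') s + parity s * a"
proof (cases s)
  case (Step L x y)
  note E = arrow_flat_tanglesD(1)[OF F] and E' = arrow_flat_tanglesD(1)[OF F']
  have "x \<in> points n" using gsteps_points(1)[OF assms] Step by simp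
  show ?thesis
  proof (cases L)
    case First
    then have xy: "{x, y} \<in> fst F" using assms by (simp add: Step steps_def)
    show ?thesis
      using \<open>x \<in> points n\<close> arrow_flat_tanglesD(3)[OF F xy] partner_eqI[OF E xy]
      by (auto simp: First Step dart_src_def stacked_def beside_def diagram_def dart_label_def
          step_label_def parity_def Let_def lmul_def lrev_def)
  next
    case Second
    then have xy: "{x, y} \<in> fst F'" using assms by (simp add: Step steps_def)
    show ?thesis
      using \<open>x \<in> points n\<close> arrow_flat_tanglesD(3)[OF F' xy] partner_eqI[OF E' xy]
      by (auto simp: Second Step dart_src_def stacked_def beside_def diagram_def dart_label_def
          step_label_def parity_def Let_def lmul_def lrev_def)
  qed
qed

text \<open>Horner's scheme: the parity of the first step is a factor of every later cumulated
  parity.\<close>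

lemma total_label_eq_chain_label:
  "set xs \<subseteq> gsteps \<Longrightarrow> total_label (snd F) (snd F') xs = chain_label xs"
proof (induction xs)
  case Nil
  then show ?case by (simp add: total_label_def chain_label_def)
next
  case (Cons s xs)
  have "cum_parity (s # xs) (Suc i) = parity s * cum_parity xs i" for i
    by (simp add: cum_parity_def prod.lessThan_Suc_shift prod.atMost_Suc_shift del: prod.lessThan_Suc prod.atMost_Suc)
  then have "total_label (snd F) (snd F') (s # xs) =
      (if pless (src s) (tgt s) then 1 else parity s) * step_label (snd F) (snd F') s
      + parity s * total_label (snd F) (snd F') xs"
    by (simp add: total_label_def sum.lessThan_Suc_shift sum_distrib_left mult.assoc cum_parity_def[of _ 0]
        del: sum.lessThan_Suc)
  also have "\<dots> = chain_label (s # xs)"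
    using Cons step_label_stacked[of s "chain_label xs"] by (simp add: chain_label_def)
  finally show ?case .
qed

text \<open>A step is determined by its source, and the source of the next step by its target. Both
  lists stop at the first target that is not glued.\<close>

lemma chain_unique:
  assumes "chain K xs" "chain K ys" "dart_src (hd xs) = dart_src (hd ys)"
    "\<not> glued K (dart_tgt (last xs))" "\<not> glued K (dart_tgt (last ys))"
  shows "xs = ys"
  using assms
proof (induction xs arbitrary: ys)
  case Nil
  then show ?case by (simp add: chain_def)
next
  case (Cons s xs)
  obtain t zs where ys: "ys = t # zs" using Cons.prems(2) by (cases ys) (auto simp: chain_def)
  have st: "s = t" using Cons.prems ys by (intro gsteps_eqI) (auto simp: chain_def)
  show ?case
  proof (cases "xs = [] \<or> zs = []")
    case True
    then show ?thesis using Cons.prems st ys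
      by (auto simp: chain_def successively_Cons split: if_splits)
  next
    case False
    have "xs = zs"
      using Cons.prems False ys st
      by (intro Cons.IH) (auto simp: chain_def successively_Cons)
    then show ?thesis using st ys by simp
  qed
qed

lemma chain_mono: "chain K xs \<Longrightarrow> K \<subseteq> K' \<Longrightarrow> chain K' xs"
  unfolding chain_def glued_def by (auto elim!: successively_mono)

lemma chain_append:
  assumes "chain K xs" "chain K ys" "glued K (dart_tgt (last xs))" "dart_src (hd ys) = mate (dart_tgt (last xs))"
  shows "chain K (xs @ ys)"
  using assms by (auto simp: chain_def successively_append_iff)

text \<open>The link between diagrams and lists: outside the levels from \<open>k\<close> on, every
  strand is realised by a list of steps that crosses only those levels. Points on these levels are
  left out, since their strands are the ones left behind by the gluing.\<close>

definition traced :: "nat \<Rightarrow> (layer \<times> point) diagram \<Rightarrow> bool" where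
  "traced k D \<longleftrightarrow> (\<forall>x. snd x \<in> points n \<longrightarrow> \<not> glued {k..} x \<longrightarrow> \<not> glued {k..} (fst D x) \<and>
     (\<exists>xs. chain {k..} xs \<and> dart_src (hd xs) = x \<and> dart_tgt (last xs) = fst D x \<and>
        chain_label xs = fst (snd D) x))"

text \<open>No point lies above level \<open>n\<close>, so nothing is glued yet and every strand is
  a single step.\<close>

lemma traced_stacked: "traced (Suc n) stacked"
proof -
  have ng: "\<not> glued {Suc n..} x" if "snd x \<in> points n" for x
    using that by (auto simp: glued_def points_def)
  have "\<exists>xs. chain {Suc n..} xs \<and> dart_src (hd xs) = x \<and> dart_tgt (last xs) = fst stacked x \<and>
        chain_label xs = fst (snd stacked) x" if x: "snd x \<in> points n" for x
  proof -
    define s where "s = Step (fst x) (snd x) (snd (fst stacked x))"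
    have "fst (fst stacked x) = fst x"
      by (cases x; cases "fst x") (simp_all add: stacked_def beside_def diagram_def)
    then have s: "dart_src s = x" "dart_tgt s = fst stacked x"
      by (simp_all add: s_def dart_src_def dart_tgt_def prod_eq_iff)
    then have "s \<in> gsteps" using x by (simp add: gsteps_iff) (simp add: s_def)
    then have "chain {Suc n..} [s]" by (simp add: chain_def)
    then show ?thesis using s by (intro exI[of _ "[s]"]) (simp add: chain_label_def)
  qed
  moreover have "snd (fst stacked x) \<in> points n" if "snd x \<in> points n" for x
    using regular_stacked that unfolding regular_def by metis
  ultimately show ?thesis using ng unfolding traced_def by blast
qed

lemma traced_glue_at:
  assumes reg: "regular D" and tr: "traced (Suc k) D" and k: "1 \<le> k" "k \<le> n"
  shows "traced k (glue_at k D)"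
proof -
  obtain e l w where De: "D = (e, l, w)" by (metis prod_cases3)
  define p q where "p = (First, (1::nat, k))" and "q = (Second, (0::nat, k))"
  have ee: "\<And>x. e (e x) = x" using reg by (auto simp: De well_paired_def regular_def)
  have pt: "snd p \<in> points n" "snd q \<in> points n" using k by (auto simp: p_def q_def points_def)
  have pts: "snd (e x) \<in> points n" if "snd x \<in> points n" for x
    using reg that unfolding regular_def De by (metis fst_conv)
  have pq: "p \<noteq> q" by (simp add: p_def q_def)
  have g: "glue_at k D = hook p q 0 0 D" by (simp add: glue_at_def p_def q_def)
  have gl: "glued {k..} x \<longleftrightarrow> glued {Suc k..} x \<or> x = p \<or> x = q" for x
    unfolding p_def q_def by (rule glued_Suc)
  have mate: "mate p = q" "mate q = p" by (simp_all add: mate_def p_def q_def)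
  have npq: "\<not> glued {Suc k..} p" "\<not> glued {Suc k..} q" by (auto simp: glued_def p_def q_def)
  have sub: "{Suc k..} \<subseteq> {k..}" by auto
  have T: "\<not> glued {Suc k..} (e x)"
     "\<exists>xs. chain {k..} xs \<and> dart_src (hd xs) = x \<and> dart_tgt (last xs) = e x \<and> chain_label xs = l x"
    if "snd x \<in> points n" "\<not> glued {Suc k..} x" for x
    using tr that chain_mono[OF _ sub] unfolding traced_def De by (metis fst_conv, metis fst_conv snd_conv)
  \<comment> \<open>Run along the strand from \<open>e a\<close> to \<open>a\<close>, cross the seam
    to \<open>b\<close>, and follow the strand of \<open>b\<close>.\<close>
  have join: "\<exists>xs. chain {k..} xs \<and> dart_src (hd xs) = e a \<and> dart_tgt (last xs) = e b \<and>
      chain_label xs = l (e a) \<star> l b"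
    if ab: "(a, b) = (p, q) \<or> (a, b) = (q, p)" for a b
  proof -
    have a: "snd (e a) \<in> points n" "\<not> glued {Suc k..} (e a)"
      using ab pts[OF pt(1)] pts[OF pt(2)] T(1)[OF pt(1) npq(1)] T(1)[OF pt(2) npq(2)] by auto
    have b: "snd b \<in> points n" "\<not> glued {Suc k..} b" using ab pt npq by auto
    obtain xs where xs: "chain {k..} xs" "dart_src (hd xs) = e a" "dart_tgt (last xs) = a"
      "chain_label xs = l (e a)" using T(2)[OF a] ee by metis
    obtain ys where ys: "chain {k..} ys" "dart_src (hd ys) = b" "dart_tgt (last ys) = e b"
      "chain_label ys = l b" using T(2)[OF b] by metis
    have "chain {k..} (xs @ ys)"
      using xs ys ab mate by (intro chain_append) (auto simp: gl)
    moreover have "xs \<noteq> []" "ys \<noteq> []" using xs ys by (auto simp: chain_def)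
    ultimately show ?thesis using xs ys by (intro exI[of _ "xs @ ys"]) (simp add: chain_label_append)
  qed
  show ?thesis
  proof (cases "e p = q")
    \<comment> \<open>The strand from \<open>p\<close> to \<open>q\<close> becomes a loop, and all
      other strands stay as they are.\<close>
    case True
    then have qp: "e q = p" using ee by metis
    let ?H = "hook p q 0 0 D"
    have "\<not> glued {k..} (fst ?H x) \<and>
     (\<exists>xs. chain {k..} xs \<and> dart_src (hd xs) = x \<and> dart_tgt (last xs) = fst ?H x \<and> chain_label xs = fst (snd ?H) x)"
      if x: "snd x \<in> points n" "\<not> glued {k..} x" for x
    proof -
      have xn: "x \<noteq> p" "x \<noteq> q" "\<not> glued {Suc k..} x" using x gl by auto
      moreover have "e x \<noteq> p" "e x \<noteq> q" using xn True qp ee by metis+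
      moreover have "fst ?H x = e x" "fst (snd ?H) x = l x" using True xn by (simp_all add: De hook_def)
      ultimately show ?thesis using T[of x] x by (simp add: gl)
    qed
    then show ?thesis unfolding traced_def g by blast
  next
    case False
    have ne: "e q \<noteq> p" "e p \<noteq> e q" using ee False pq by metis+
    let ?H = "hook p q 0 0 D"
    have "\<not> glued {k..} (fst ?H x) \<and>
     (\<exists>xs. chain {k..} xs \<and> dart_src (hd xs) = x \<and> dart_tgt (last xs) = fst ?H x \<and> chain_label xs = fst (snd ?H) x)"
      if x: "snd x \<in> points n" "\<not> glued {k..} x" for x
    proof -
      have xn: "x \<noteq> p" "x \<noteq> q" "\<not> glued {Suc k..} x" using x gl by auto
      have epq: "\<not> glued {Suc k..} (e p)" "\<not> glued {Suc k..} (e q)"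
        using T(1)[OF pt(1) npq(1)] T(1)[OF pt(2) npq(2)] by auto
      consider "x = e p" | "x = e q" "x \<noteq> e p" | "x \<noteq> e p" "x \<noteq> e q" by blast
      then show ?thesis
      proof cases
        case 1
        then have "e p \<noteq> p" using xn by simp
        have "e q \<noteq> q"
          using reg pt(2) unfolding regular_def De by (metis fst_conv)
        then have "fst ?H x = e q" "fst (snd ?H) x = l (e p) \<star> l q" "\<not> glued {k..} (e q)"
          using 1 xn ne False epq by (auto simp: De hook_def gl)
        then show ?thesis using join[of p q] 1 by simp
      next
        case 2
        have "e p \<noteq> p"
          using reg pt(1) unfolding regular_def De by (metis fst_conv)
        then have "fst ?H x = e p" "fst (snd ?H) x = l (e q) \<star> l p" "\<not> glued {k..} (e p)"
          using 2 xn ne False epq by (auto simp: De hook_def gl)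
        then show ?thesis using join[of q p] 2 by simp
      next
        case 3
        then have "e x \<noteq> p" "e x \<noteq> q" using ee by metis+
        moreover have "fst ?H x = e x" "fst (snd ?H) x = l x"
          using 3 xn False by (auto simp: De hook_def)
        ultimately show ?thesis using T[of x] x xn by (simp add: gl)
      qed
    qed
    then show ?thesis unfolding traced_def g by blast
  qed
qed

lemma traced_glue:
  assumes "1 \<le> k" "k \<le> Suc n"
  shows "traced k (glue k n stacked)"
  using assms(2,1)
proof (induction k rule: inc_induct)
  case base
  then show ?case by (simp add: glue_empty traced_stacked)
next
  case (step k)
  then show ?case by (simp add: glue_Suc traced_glue_at regular_glue)
qed

section \<open>Closed loops and the coefficient\<close>

lemma chain_nth:
  assumes "chain K xs" "Suc i < length xs"
  shows "glued K (dart_tgt (xs ! i))" "dart_src (xs ! Suc i) = mate (dart_tgt (xs ! i))"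
  using assms by (auto simp: chain_def successively_conv_nth)

text \<open>The condition on \<open>b_0\<close> says that a cycle starts at its smallest level
  \<open>k\<close>; cut open there, it is a chain crossing only levels above \<open>k\<close>.
  Conversely, every crossing changes the layer, so a chain that starts in \<open>First\<close> and
  ends in \<open>Second\<close> has even length.\<close>

lemma cycles_iff_chain:
  "xs \<in> cycles (fst F) (fst F') \<and> snd (src (hd xs)) = k \<longleftrightarrow>
   chain {Suc k..} xs \<and> dart_src (hd xs) = (First, (1, k)) \<and> dart_tgt (last xs) = (Second, (0, k))"
proof (intro iffI conjI)
  assume "xs \<in> cycles (fst F) (fst F') \<and> snd (src (hd xs)) = k"
  then have ev: "even (length xs)" "2 \<le> length xs" and st: "set xs \<subseteq> gsteps" and k: "snd (src (hd xs)) = k"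
    and c: "\<And>i. Suc i < length xs \<Longrightarrow> snd (tgt (xs ! i)) = snd (src (xs ! Suc i))"
    and e: "\<And>i. i < length xs \<Longrightarrow> even i \<Longrightarrow>
        layer (xs ! i) = First \<and> fst (src (xs ! i)) = 1 \<and> fst (tgt (xs ! i)) = 1"
    and o: "\<And>i. i < length xs \<Longrightarrow> odd i \<Longrightarrow>
        layer (xs ! i) = Second \<and> fst (src (xs ! i)) = 0 \<and> fst (tgt (xs ! i)) = 0"
    and l: "snd (src (hd xs)) = snd (tgt (last xs))"
    and m: "\<And>i. Suc i < length xs \<Longrightarrow> snd (src (hd xs)) < snd (tgt (xs ! i))"
    by (auto simp: cycles_def)
  have ne: "xs \<noteq> []" using ev by auto
  have "glued {Suc k..} (dart_tgt (xs ! i)) \<and> dart_src (xs ! Suc i) = mate (dart_tgt (xs ! i))"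
    if i: "Suc i < length xs" for i
  proof (cases "even i")
    case True
    then show ?thesis using e[of i] o[of "Suc i"] c[OF i] m[OF i] k i
      by (auto simp: glued_def dart_tgt_def dart_src_def mate_def prod_eq_iff)
  next
    case False
    then show ?thesis using o[of i] e[of "Suc i"] c[OF i] m[OF i] k i
      by (auto simp: glued_def dart_tgt_def dart_src_def mate_def prod_eq_iff)
  qed
  then show "chain {Suc k..} xs" using ne st by (simp add: chain_def successively_conv_nth)
  show "dart_src (hd xs) = (First, (1, k))"
    using e[of 0] ev k ne by (simp add: hd_conv_nth dart_src_def prod_eq_iff)
  show "dart_tgt (last xs) = (Second, (0, k))"
    using o[of "length xs - 1"] ev l k ne by (simp add: last_conv_nth dart_tgt_def prod_eq_iff)
next
  assume "chain {Suc k..} xs \<and> dart_src (hd xs) = (First, (1, k)) \<and> dart_tgt (last xs) = (Second, (0, k))"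
  then have ch: "chain {Suc k..} xs" and h: "dart_src (hd xs) = (First, (1, k))"
    and l: "dart_tgt (last xs) = (Second, (0, k))" by auto
  have ne: "xs \<noteq> []" and st: "set xs \<subseteq> gsteps" using ch by (auto simp: chain_def)
  have tg: "fst (tgt (xs ! i)) = (if layer (xs ! i) = First then 1 else 0)" "k < snd (tgt (xs ! i))"
    if "Suc i < length xs" for i
    using chain_nth(1)[OF ch that] by (auto simp: glued_def dart_tgt_def)
  have alt: "layer (xs ! i) = (if even i then First else Second) \<and> fst (src (xs ! i)) = (if even i then 1 else 0)"
    if "i < length xs" for i
    using that
  proof (induction i)
    case 0
    then show ?case using h ne by (simp add: hd_conv_nth dart_src_def)
  next
    case (Suc i)
    then show ?case using chain_nth(2)[OF ch Suc.prems] tg(1)[OF Suc.prems]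
      by (simp add: dart_src_def dart_tgt_def mate_def)
  qed
  have odd: "odd (length xs - 1)"
    using alt[of "length xs - 1"] l ne by (auto simp: last_conv_nth dart_tgt_def split: if_splits)
  moreover obtain m where m: "length xs = Suc m" using ne by (cases xs) auto
  ultimately have len: "even (length xs)" "2 \<le> length xs" by (auto elim: oddE)
  have tg': "fst (tgt (xs ! i)) = (if even i then 1 else 0)" if "i < length xs" for i
  proof (cases "Suc i < length xs")
    case True
    then show ?thesis using tg(1)[OF True] alt[OF that] by simp
  next
    case False
    then have "i = length xs - 1" using that by simp
    then show ?thesis using odd l ne by (simp add: last_conv_nth dart_tgt_def)
  qed
  have sk: "snd (src (hd xs)) = k" "snd (tgt (last xs)) = k" using h l by (simp_all add: dart_src_def dart_tgt_def)
  have c: "snd (tgt (xs ! i)) = snd (src (xs ! Suc i))" if "Suc i < length xs" for i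
    using chain_nth(2)[OF ch that] by (simp add: dart_src_def dart_tgt_def mate_def)
  show "xs \<in> cycles (fst F) (fst F')"
    using len st alt tg' sk c tg(2) by (auto simp: cycles_def)
  show "snd (src (hd xs)) = k" by (rule sk(1))
qed

definition cycles_from :: "nat \<Rightarrow> step list set" where
  "cycles_from k = {xs \<in> cycles (fst F) (fst F'). k \<le> snd (src (hd xs))}"

definition loop_weight :: "step list set \<Rightarrow> R0a" where
  "loop_weight C = (\<Prod>xs\<in>C. z_var (zeta_index (snd F) (snd F') xs))"

lemma cycle_hd_points:
  assumes "xs \<in> cycles (fst F) (fst F')"
  shows "src (hd xs) \<in> points n"
proof -
  have "xs \<noteq> []" "set xs \<subseteq> gsteps" using assms by (auto simp: cycles_def)
  then show ?thesis using gsteps_points(1) by (meson hd_in_set subsetD)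
qed

text \<open>Gluing level \<open>k\<close> closes a loop only if a strand connects the two points of
  that level, and this loop is the one cycle with smallest level \<open>k\<close>.\<close>

lemma glue_weight:
  assumes "1 \<le> k" "k \<le> Suc n"
  shows "finite (cycles_from k) \<and> snd (snd (glue k n stacked)) = loop_weight (cycles_from k)"
  using assms(2,1)
proof (induction k rule: inc_induct)
  case base
  have "snd (src (hd xs)) \<le> n" if "xs \<in> cycles (fst F) (fst F')" for xs
    using cycle_hd_points[OF that] by (auto simp: points_def)
  then have "cycles_from (Suc n) = {}" by (fastforce simp: cycles_from_def)
  then show ?case by (simp add: glue_empty loop_weight_def stacked_def beside_def diagram_def)
next
  case (step k)
  let ?D = "glue (Suc k) n stacked"
  obtain e l w where De: "?D = (e, l, w)" by (metis prod_cases3)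
  have k: "1 \<le> k" "k \<le> n" using step by auto
  have IH: "finite (cycles_from (Suc k))" "w = loop_weight (cycles_from (Suc k))"
    using step by (auto simp: De)
  have reg: "regular ?D" and tr: "traced (Suc k) ?D" using k by (auto intro: regular_glue traced_glue)
  define p q where "p = (First, (1::nat, k))" and "q = (Second, (0::nat, k))"
  have pt: "snd p \<in> points n" using k by (auto simp: p_def points_def)
  have npq: "\<not> glued {Suc k..} p" "\<not> glued {Suc k..} q" by (auto simp: glued_def p_def q_def)
  obtain xs where xs: "chain {Suc k..} xs" "dart_src (hd xs) = p" "dart_tgt (last xs) = e p" "chain_label xs = l p"
    and ng: "\<not> glued {Suc k..} (e p)"
    using tr pt npq(1) unfolding traced_def De by (metis fst_conv snd_conv)
  \<comment> \<open>Neither \<open>e p\<close> nor \<open>q\<close> is glued at the levels above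
    \<open>k\<close>, so by \<open>chain_unique\<close> a cycle starting at level \<open>k\<close>
    has to be the list that traces the strand of \<open>p\<close>.\<close>
  have new: "{ys \<in> cycles (fst F) (fst F'). snd (src (hd ys)) = k} = (if e p = q then {xs} else {})"
  proof -
    have "ys = xs \<and> e p = q" if "ys \<in> cycles (fst F) (fst F')" "snd (src (hd ys)) = k" for ys
    proof -
      have ys: "chain {Suc k..} ys" "dart_src (hd ys) = p" "dart_tgt (last ys) = q"
        using that cycles_iff_chain[of ys k] by (auto simp: p_def q_def)
      then have "ys = xs" using xs ng npq by (intro chain_unique[of "{Suc k..}"]) auto
      then show ?thesis using xs ys by simp
    qed
    moreover have "xs \<in> cycles (fst F) (fst F') \<and> snd (src (hd xs)) = k" if "e p = q"
      using cycles_iff_chain[of xs k] xs that by (simp add: p_def q_def)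
    ultimately show ?thesis by auto
  qed
  have split: "cycles_from k = {ys \<in> cycles (fst F) (fst F'). snd (src (hd ys)) = k} \<union> cycles_from (Suc k)"
    by (auto simp: cycles_from_def)
  have gl: "glue k n stacked = hook p q 0 0 (e, l, w)"
    using k by (simp add: glue_Suc De glue_at_def p_def q_def)
  show ?case
  proof (cases "e p = q")
    case True
    \<comment> \<open>The ends \<open>p\<close> and \<open>q\<close> lie on opposite sides. Only for
      even labels is \<open>loop_index\<close> half the absolute value, as in
      \<open>zeta_index\<close>.\<close>
    have "even (l p)"
      using reg pt True unfolding regular_def De by (metis fst_conv snd_conv p_def q_def zero_neq_one)
    moreover have "total_label (snd F) (snd F') xs = l p"
      using total_label_eq_chain_label[of xs] xs by (simp add: chain_def)
    ultimately have "zeta_index (snd F) (snd F') xs = loop_index (l p)"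
      by (simp add: zeta_index_def loop_index_def)
    moreover have "xs \<notin> cycles_from (Suc k)"
      using xs(2) by (auto simp: cycles_from_def dart_src_def p_def)
    ultimately show ?thesis
      using IH True unfolding split new gl
      by (simp add: hook_def loop_weight_def mult.commute)
  next
    case False
    then show ?thesis using IH unfolding split new gl by (simp add: hook_def)
  qed
qed

lemma cycle_weight_glue: "cycle_weight F F' = snd (snd (glue 1 n stacked))"
proof -
  have "cycles_from 1 = cycles (fst F) (fst F')"
    using cycle_hd_points by (fastforce simp: cycles_from_def points_def)
  then show ?thesis
    using glue_weight[of 1] by (simp add: cycle_weight_def loop_weight_def case_prod_beta)
qed

section \<open>Arcs and the product tangle\<close>

lemma arcs_iff_chain:
  "xs \<in> arcs (fst F) (fst F') \<longleftrightarrow> chain {1..} xs \<and> dart_src (hd xs) = outer (src (hd xs)) \<and>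
     dart_tgt (last xs) = outer (tgt (last xs)) \<and> pless (src (hd xs)) (tgt (last xs))"
proof (cases "xs \<noteq> [] \<and> set xs \<subseteq> gsteps")
  case False
  then show ?thesis by (auto simp: arcs_def chain_def)
next
  case True
  have pts: "fst (src s) \<in> {0, 1}" "fst (tgt s) \<in> {0, 1}" "1 \<le> snd (src s)" "1 \<le> snd (tgt s)" if "s \<in> set xs" for s
  proof -
    have "s \<in> gsteps" using True that by blast
    from gsteps_points[OF this]
    show "fst (src s) \<in> {0, 1}" "fst (tgt s) \<in> {0, 1}" "1 \<le> snd (src s)" "1 \<le> snd (tgt s)"
      by (auto simp: points_def mem_Times_iff)
  qed
  have "(snd (tgt s) = snd (src t) \<and>
        (layer s = First \<longrightarrow> fst (tgt s) = 1 \<and> layer t = Second \<and> fst (src t) = 0) \<and>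
        (layer s = Second \<longrightarrow> fst (tgt s) = 0 \<and> layer t = First \<and> fst (src t) = 1)) \<longleftrightarrow>
      glued {1..} (dart_tgt s) \<and> dart_src t = mate (dart_tgt s)" if "s \<in> set xs" for s t
    using pts[OF that]
    by (cases "layer s") (auto simp: glued_def dart_tgt_def dart_src_def mate_def prod_eq_iff)
  then have "(\<forall>i. Suc i < length xs \<longrightarrow>
        snd (tgt (xs ! i)) = snd (src (xs ! Suc i)) \<and>
        (layer (xs ! i) = First \<longrightarrow>
           fst (tgt (xs ! i)) = 1 \<and> layer (xs ! Suc i) = Second \<and> fst (src (xs ! Suc i)) = 0) \<and>
        (layer (xs ! i) = Second \<longrightarrow>
           fst (tgt (xs ! i)) = 0 \<and> layer (xs ! Suc i) = First \<and> fst (src (xs ! Suc i)) = 1)) \<longleftrightarrow> chain {1..} xs"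
    using True by (simp add: chain_def successively_conv_nth)
  moreover have "fst (src (hd xs)) = (case layer (hd xs) of First \<Rightarrow> 0 | Second \<Rightarrow> 1) \<longleftrightarrow>
      dart_src (hd xs) = outer (src (hd xs))"
    using pts(1)[of "hd xs"] True by (cases "layer (hd xs)") (auto simp: dart_src_def outer_def)
  moreover have "fst (tgt (last xs)) = (case layer (last xs) of First \<Rightarrow> 0 | Second \<Rightarrow> 1) \<longleftrightarrow>
      dart_tgt (last xs) = outer (tgt (last xs))"
    using pts(2)[of "last xs"] True by (cases "layer (last xs)") (auto simp: dart_tgt_def outer_def)
  ultimately show ?thesis unfolding arcs_def using True by simp
qed

lemma glue_outer: "fst (glue 1 n stacked) (outer p) = outer (snd (fst (glue 1 n stacked) (outer p)))"
proof -
  have reg: "regular (glue 1 n stacked)" and tr: "traced 1 (glue 1 n stacked)"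
    by (simp_all add: regular_glue traced_glue)
  have so: "snd (outer p) = p" by (simp add: outer_def)
  show ?thesis
  proof (cases "p \<in> points n")
    case True
    then have "\<not> glued {1..} (fst (glue 1 n stacked) (outer p))"
      using tr not_glued_outer[OF True, of "{1..}"] so unfolding traced_def by metis
    moreover have "snd (fst (glue 1 n stacked) (outer p)) \<in> points n"
      using reg so True unfolding regular_def by metis
    ultimately show ?thesis by (rule outer_if_not_glued[rotated])
  next
    case False
    then have "fst (glue 1 n stacked) (outer p) = outer p"
      using reg so unfolding regular_def by metis
    then show ?thesis using so by simp
  qed
qed

text \<open>Reads partner and label in the product off an explicit path; this is how products with
  the identity tangle are computed.\<close>

lemma chain_product:
  assumes "chain {1..} xs" "dart_src (hd xs) = outer p" "dart_tgt (last xs) = outer q"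
    "p \<in> points n" "q \<in> points n"
  shows "trim (glue 1 n stacked) = (e, l, w) \<Longrightarrow> e p = q \<and> l p = chain_label xs"
proof -
  obtain e' l' w' where De: "glue 1 n stacked = (e', l', w')" by (metis prod_cases3)
  have so: "snd (outer p) = p" for p by (simp add: outer_def)
  have tr: "traced 1 (e', l', w')" using traced_glue[of 1] unfolding De by simp
  obtain ys where ys: "chain {1..} ys" "dart_src (hd ys) = outer p" "dart_tgt (last ys) = e' (outer p)"
    "chain_label ys = l' (outer p)" and ng: "\<not> glued {1..} (e' (outer p))"
    using tr not_glued_outer[OF assms(4), of "{1..}"] assms(4) so unfolding traced_def by (metis fst_conv snd_conv)
  have "xs = ys"
    using assms ys ng not_glued_outer[OF assms(5), of "{1..}"] by (intro chain_unique[of "{1..}"]) simp_all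
  then show "trim (glue 1 n stacked) = (e, l, w) \<Longrightarrow> e p = q \<and> l p = chain_label xs"
    using ys assms unfolding De by (auto simp: trim_def so)
qed

theorem product_diagram:
  "arrow_comp F F' \<in> arrow_flat_tangles n"
  "trim (glue 1 n stacked) = weighted (cycle_weight F F') (diagram n (arrow_comp F F'))"
proof -
  obtain e l w where De: "glue 1 n stacked = (e, l, w)" by (metis prod_cases3)
  have reg: "regular (e, l, w)" and tr: "traced 1 (e, l, w)"
    using regular_glue[of 1] traced_glue[of 1] unfolding De by simp_all
  define e' l' where "e' = (\<lambda>p. snd (e (outer p)))" and "l' = (\<lambda>p. l (outer p))"
  have so [simp]: "snd (outer p) = p" for p by (simp add: outer_def)
  have ee: "\<And>x. e (e x) = x" and ll: "\<And>x. l (e x) = lrev (l x)"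
    using reg by (auto simp: regular_def well_paired_def)
  have irr: "e (outer p) = outer p" "l (outer p) = 0" if "p \<notin> points n" for p
    using reg that unfolding regular_def by (metis fst_conv snd_conv so)+
  have rg: "e (outer p) \<noteq> outer p" "e' p \<in> points n" "even (l' p) \<longleftrightarrow> fst p \<noteq> fst (e' p)"
    if "p \<in> points n" for p
    using reg that unfolding regular_def e'_def l'_def by (metis fst_conv snd_conv so)+
  have tc: "\<not> glued {1..} (e (outer p))"
     "\<exists>xs. chain {1..} xs \<and> dart_src (hd xs) = outer p \<and> dart_tgt (last xs) = e (outer p) \<and> chain_label xs = l' p"
    if "p \<in> points n" for p
    using tr that not_glued_outer[OF that, of "{1..}"] unfolding traced_def l'_def by (metis fst_conv so, metis fst_conv snd_conv so)
  have eo: "e (outer p) = outer (e' p)" for p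
    using glue_outer[of p] unfolding De by (simp add: e'_def)
  have wp: "well_paired (e', l', w)"
    using ee ll eo by (simp add: well_paired_def l'_def) (metis so)
  then have ee': "\<And>p. e' (e' p) = p" by (simp add: well_paired_def del: split_paired_All)
  have dst: "src s = snd (dart_src s)" "tgt s = snd (dart_tgt s)" for s by (simp_all add: dart_src_def dart_tgt_def)
  have pth: "\<exists>xs. chain {1..} xs \<and> src (hd xs) = p \<and> tgt (last xs) = e' p \<and> chain_label xs = l' p \<and>
      dart_src (hd xs) = outer p \<and> dart_tgt (last xs) = outer (e' p)" if "p \<in> points n" for p
    using tc(2)[OF that] unfolding eo by (metis dst so)
  have arc: "src (hd xs) \<in> points n \<and> tgt (last xs) = e' (src (hd xs)) \<and> total_label (snd F) (snd F') xs = l' (src (hd xs))"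
    and arcu: "ys \<in> arcs (fst F) (fst F') \<Longrightarrow> src (hd ys) = src (hd xs) \<Longrightarrow> ys = xs"
    if xs: "xs \<in> arcs (fst F) (fst F')" for xs ys
  proof -
    have c: "chain {1..} zs" "dart_src (hd zs) = outer (src (hd zs))" "dart_tgt (last zs) = outer (tgt (last zs))"
      "src (hd zs) \<in> points n" "tgt (last zs) \<in> points n" "set zs \<subseteq> gsteps" if "zs \<in> arcs (fst F) (fst F')" for zs
    proof -
      show 1: "chain {1..} zs" "dart_src (hd zs) = outer (src (hd zs))" "dart_tgt (last zs) = outer (tgt (last zs))"
        using that by (auto simp: arcs_iff_chain)
      then show "set zs \<subseteq> gsteps" by (simp add: chain_def)
      then show "src (hd zs) \<in> points n" "tgt (last zs) \<in> points n"
        using 1(1) gsteps_points by (auto simp: chain_def subset_iff)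
    qed
    note cx = c[OF xs]
    obtain zs where zs: "chain {1..} zs" "tgt (last zs) = e' (src (hd xs))" "chain_label zs = l' (src (hd xs))"
      "dart_src (hd zs) = outer (src (hd xs))" "dart_tgt (last zs) = outer (e' (src (hd xs)))"
      using pth[OF cx(4)] by blast
    have "zs = xs"
      using cx zs not_glued_outer[OF cx(5), of "{1..}"] not_glued_outer[OF rg(2)[OF cx(4)], of "{1..}"]
      by (intro chain_unique[of "{1..}"]) simp_all
    then show "src (hd xs) \<in> points n \<and> tgt (last xs) = e' (src (hd xs)) \<and> total_label (snd F) (snd F') xs = l' (src (hd xs))"
      using zs cx by (simp add: total_label_eq_chain_label)
    show "ys = xs" if "ys \<in> arcs (fst F) (fst F')" "src (hd ys) = src (hd xs)"
      using c[OF that(1)] that(2) cx not_glued_outer[OF cx(5), of "{1..}"] not_glued_outer[of "tgt (last ys)" n "{1..}"]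
      by (intro chain_unique[of "{1..}"]) simp_all
  qed
  have ex: "\<exists>xs\<in>arcs (fst F) (fst F'). src (hd xs) = p \<and> tgt (last xs) = e' p" if "p \<in> points n" "pless p (e' p)" for p
    using pth[OF that(1)] that(2) unfolding Bex_def arcs_iff_chain by metis
  define f where "f = (\<lambda>\<beta>\<in>flat_comp (fst F) (fst F'). total_label (snd F) (snd F') (THE xs. xs \<in> arcs (fst F) (fst F') \<and> arc_boundary xs = \<beta>))"
  have ac: "arrow_comp F F' = (flat_comp (fst F) (fst F'), f)"
    by (simp add: arrow_comp_def f_def case_prod_beta)
  have en: "e' p \<noteq> p" if "p \<in> points n" for p using rg(1)[OF that] eo by metis
  have E: "flat_comp (fst F) (fst F') = (\<lambda>p. {p, e' p}) ` points n"
  proof (intro equalityI subsetI)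
    fix \<beta> assume "\<beta> \<in> flat_comp (fst F) (fst F')"
    then show "\<beta> \<in> (\<lambda>p. {p, e' p}) ` points n"
      using arc by (auto simp: flat_comp_def arc_boundary_def)
  next
    fix \<beta> assume "\<beta> \<in> (\<lambda>p. {p, e' p}) ` points n"
    then obtain p where p: "p \<in> points n" "\<beta> = {p, e' p}" by blast
    \<comment> \<open>\<open>arcs\<close> lists a strand only from its smaller end, so the pair is
      named by that end.\<close>
    obtain r where r: "r \<in> points n" "pless r (e' r)" "\<beta> = {r, e' r}"
    proof (cases "pless p (e' p)")
      case True
      then show ?thesis using p that by blast
    next
      case False
      then have "pless (e' p) (e' (e' p))" using pless_iff_not[of p n "e' p"] p rg(2)[OF p(1)] en[OF p(1)]
        by (simp add: ee')
      then show ?thesis using p that[of "e' p"] rg(2)[OF p(1)] ee'[of p] by (simp add: insert_commute)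
    qed
    obtain xs where "xs \<in> arcs (fst F) (fst F')" "src (hd xs) = r" "tgt (last xs) = e' r" using ex[OF r(1,2)] by blast
    then show "\<beta> \<in> flat_comp (fst F) (fst F')" unfolding flat_comp_def r(3)
      by (intro image_eqI[of _ _ xs]) (simp_all add: arc_boundary_def)
  qed
  have lab: "f {p, e' p} = l' p" if p: "p \<in> points n" "pless p (e' p)" for p
  proof -
    obtain xs where xs: "xs \<in> arcs (fst F) (fst F')" "src (hd xs) = p" "tgt (last xs) = e' p" using ex[OF p] by blast
    have "(THE xs. xs \<in> arcs (fst F) (fst F') \<and> arc_boundary xs = {p, e' p}) = xs"
    proof (rule the_equality)
      show "xs \<in> arcs (fst F) (fst F') \<and> arc_boundary xs = {p, e' p}" using xs by (simp add: arc_boundary_def)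
      fix ys assume ys: "ys \<in> arcs (fst F) (fst F') \<and> arc_boundary ys = {p, e' p}"
      then have "pless (src (hd ys)) (tgt (last ys))" by (simp add: arcs_iff_chain)
      \<comment> \<open>The order excludes the reversed list, so the arc with this boundary is
        unique and the definite description in \<open>f\<close> denotes it.\<close>
      moreover have "\<not> pless (e' p) p" using pless_iff_not[of p n "e' p"] p rg(2)[OF p(1)] en[OF p(1)] by simp
      ultimately have "src (hd ys) = p"
        using ys by (auto simp: arc_boundary_def doubleton_eq_iff)
      then show "ys = xs" using arcu[OF xs(1)] ys xs(2) by simp
    qed
    moreover have "{p, e' p} \<in> flat_comp (fst F) (fst F')" using E p by blast
    ultimately show ?thesis using arc[OF xs(1)] xs(2) by (simp add: f_def)
  qed
  have "(flat_comp (fst F) (fst F'), f) \<in> arrow_flat_tangles n \<and> diagram n (flat_comp (fst F) (fst F'), f) = (e', l', 1)"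
  proof (rule conjI)
    have ext: "f \<in> extensional (flat_comp (fst F) (fst F'))" by (simp add: f_def)
    have o: "e' p = p \<and> l' p = 0" if "p \<notin> points n" for p using irr[OF that] by (simp add: e'_def l'_def)
    have i: "e' p \<in> points n \<and> e' p \<noteq> p" if "p \<in> points n" for p using en rg(2) that by blast
    show "(flat_comp (fst F) (fst F'), f) \<in> arrow_flat_tangles n"
      by (rule tangle_of_diagram(1)[OF E ext i lab rg(3) wp o])
    show "diagram n (flat_comp (fst F) (fst F'), f) = (e', l', 1)"
      by (rule tangle_of_diagram(2)[OF E ext i lab rg(3) wp o])
  qed
  then show "arrow_comp F F' \<in> arrow_flat_tangles n"
    "trim (glue 1 n stacked) = weighted (cycle_weight F F') (diagram n (arrow_comp F F'))"
    unfolding cycle_weight_glue ac De by (simp_all add: trim_def weighted_def e'_def l'_def)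
qed

end

section \<open>The action of the generators\<close>

definition id_diagram :: "nat \<Rightarrow> point diagram" where
  "id_diagram n = (\<lambda>p. if p \<in> points n then (1 - fst p, snd p) else p, \<lambda>p. 0, 1)"

lemma points_cases:
  assumes "p \<in> points n"
  shows "p = (0, i) \<or> p = (0, i + 1) \<or> p = (1, i) \<or> p = (1, i + 1) \<or> snd p \<notin> {i, i + 1}"
  using assms by (cases p) (auto simp: points_def)

lemma well_paired_id_diagram: "well_paired (id_diagram n)"
  by (auto simp: well_paired_def id_diagram_def points_def)

lemma id_tangle_diagram:
  "id_tangle n \<in> arrow_flat_tangles n" "diagram n (id_tangle n) = id_diagram n"
proof -
  let ?e = "\<lambda>p::point. if p \<in> points n then (1 - fst p, snd p) else p"
  let ?l = "\<lambda>p::point. 0::int"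
  let ?f = "\<lambda>\<alpha>\<in>vertical {1..n}. 0::int"
  have E: "vertical {1..n} = (\<lambda>p. {p, ?e p}) ` points n"
  proof (intro equalityI subsetI)
    fix \<alpha> assume "\<alpha> \<in> vertical {1..n}"
    then obtain k where "k \<in> {1..n}" "\<alpha> = {(0, k), (1, k)}" by (auto simp: vertical_def)
    then show "\<alpha> \<in> (\<lambda>p. {p, ?e p}) ` points n"
      by (intro image_eqI[of _ _ "(0, k)"]) (auto simp: points_def)
  next
    fix \<alpha> assume "\<alpha> \<in> (\<lambda>p. {p, ?e p}) ` points n"
    then show "\<alpha> \<in> vertical {1..n}" by (auto simp: vertical_def points_def insert_commute)
  qed
  have "(vertical {1..n}, ?f) \<in> arrow_flat_tangles n \<and> diagram n (vertical {1..n}, ?f) = (?e, ?l, 1)"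
    by (rule conjI; rule tangle_of_diagram[where w = 1, OF E])
      (use well_paired_id_diagram[of n] in \<open>auto simp: id_diagram_def points_def vertical_def\<close>)
  then show "id_tangle n \<in> arrow_flat_tangles n" "diagram n (id_tangle n) = id_diagram n"
    by (simp_all add: id_tangle_def id_diagram_def)
qed

definition strand_swap :: "nat \<Rightarrow> point \<Rightarrow> point" where
  "strand_swap i p = (if p = (0, i) then (0, i + 1) else if p = (0, i + 1) then (0, i) else p)"

lemma strand_swap_swap [simp]: "strand_swap i (strand_swap i p) = p"
  by (simp add: strand_swap_def)

lemma w_tangle_diagram:
  assumes i: "1 \<le> i" "i < n"
  shows "w_tangle n i \<in> arrow_flat_tangles n"
    "diagram n (w_tangle n i) = relabel (strand_swap i) (id_diagram n)"
proof -
  define e where "e p = (if p \<in> points n then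
     if p = (0, i) then (1, i + 1) else if p = (0, i + 1) then (1, i)
     else if p = (1, i) then (0, i + 1) else if p = (1, i + 1) then (0, i)
     else (1 - fst p, snd p) else p)" for p :: point
  define E where "E = {{(0, i), (1, i + 1)}, {(0, i + 1), (1, i)}} \<union> vertical ({1..n} - {i, i + 1})"
  define f where "f = (\<lambda>\<alpha>\<in>E. 0::int)"
  let ?l = "\<lambda>p::point. 0::int"
  have ip: "(0, i) \<in> points n" "(0, i + 1) \<in> points n" "(1, i) \<in> points n" "(1, i + 1) \<in> points n"
    using i by (auto simp: points_def)
  have E: "E = (\<lambda>p. {p, e p}) ` points n"
  proof (intro equalityI subsetI)
    fix \<alpha> assume "\<alpha> \<in> E"
    then have "\<alpha> = {(0, i), (1, i + 1)} \<or> \<alpha> = {(0, i + 1), (1, i)} \<or> (\<exists>k\<in>{1..n} - {i, i + 1}. \<alpha> = {(0, k), (1, k)})"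
      unfolding E_def vertical_def by blast
    then consider "\<alpha> = {(0, i), (1, i + 1)}" | "\<alpha> = {(0, i + 1), (1, i)}"
      | k where "k \<in> {1..n} - {i, i + 1}" "\<alpha> = {(0, k), (1, k)}" by blast
    then show "\<alpha> \<in> (\<lambda>p. {p, e p}) ` points n"
    proof cases
      case 1
      then show ?thesis using ip by (intro image_eqI[of _ _ "(0, i)"]) (auto simp: e_def)
    next
      case 2
      then show ?thesis using ip by (intro image_eqI[of _ _ "(0, i + 1)"]) (auto simp: e_def)
    next
      case 3
      then show ?thesis by (intro image_eqI[of _ _ "(0, k)"]) (auto simp: e_def points_def)
    qed
  next
    fix \<alpha> assume "\<alpha> \<in> (\<lambda>p. {p, e p}) ` points n"
    then obtain p where p: "p \<in> points n" "\<alpha> = {p, e p}" by blast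
    consider "p = (0, i)" | "p = (0, i + 1)" | "p = (1, i)" | "p = (1, i + 1)"
      | "snd p \<notin> {i, i + 1}" using points_cases[OF p(1), of i] by blast
    then show "\<alpha> \<in> E"
    proof cases
      case 5
      then have "\<alpha> = {(0, snd p), (1, snd p)}" using p by (auto simp: e_def points_def)
      moreover have "snd p \<in> {1..n} - {i, i + 1}" using p 5 by (auto simp: points_def)
      ultimately show ?thesis unfolding E_def vertical_def by blast
    qed (use p in \<open>auto simp: e_def E_def insert_commute\<close>)
  qed
  have wp: "well_paired (e, ?l, 1)"
    using i by (auto simp: well_paired_def e_def points_def)
  have "(E, f) \<in> arrow_flat_tangles n \<and> diagram n (E, f) = (e, ?l, 1)"
    by (rule conjI; rule tangle_of_diagram[OF E _ _ _ _ wp])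
      (use i in \<open>auto simp: E f_def e_def points_def\<close>)
  moreover have "relabel (strand_swap i) (id_diagram n) = (e, ?l, 1)"
    using ip by (auto simp: relabel_def id_diagram_def fun_eq_iff strand_swap_def e_def points_def)
  ultimately show "w_tangle n i \<in> arrow_flat_tangles n"
    "diagram n (w_tangle n i) = relabel (strand_swap i) (id_diagram n)"
    by (simp_all add: w_tangle_def E_def f_def Let_def)
qed

text \<open>Joining the ends \<open>(0, i)\<close> and \<open>(0, i + 1)\<close> of two vertical
  strands creates the pair on side 1, and the strand left behind is the pair on side 0. The arc
  label is - 1 because the order on side 1 is reversed: the label 1 is read from
  \<open>(1, i + 1)\<close> to \<open>(1, i)\<close>, against the direction of the arc.\<close>

lemma F_tangle_diagram:
  assumes i: "1 \<le> i" "i < n"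
  shows "F_tangle n i \<in> arrow_flat_tangles n"
    "diagram n (F_tangle n i) = hook (0, i) (0, i + 1) (- 1) 1 (id_diagram n)"
proof -
  define e where "e p = (if p \<in> points n then
     if p = (0, i) then (0, i + 1) else if p = (0, i + 1) then (0, i)
     else if p = (1, i) then (1, i + 1) else if p = (1, i + 1) then (1, i)
     else (1 - fst p, snd p) else p)" for p :: point
  define l where "l p = (if p = (0, i) \<or> p = (1, i + 1) then 1
     else if p = (1, i) \<or> p = (0, i + 1) then - 1 else 0 :: int)" for p :: point
  define H :: flat where "H = {{(0, i), (0, i + 1)}, {(1, i), (1, i + 1)}}"
  define E where "E = H \<union> vertical ({1..n} - {i, i + 1})"
  define f where "f = (\<lambda>\<alpha>\<in>E. if \<alpha> \<in> H then 1 else 0::int)"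
  have ip: "(0, i) \<in> points n" "(0, i + 1) \<in> points n" "(1, i) \<in> points n" "(1, i + 1) \<in> points n"
    using i by (auto simp: points_def)
  have E: "E = (\<lambda>p. {p, e p}) ` points n"
  proof (intro equalityI subsetI)
    fix \<alpha> assume "\<alpha> \<in> E"
    then have "\<alpha> = {(0, i), (0, i + 1)} \<or> \<alpha> = {(1, i), (1, i + 1)} \<or> (\<exists>k\<in>{1..n} - {i, i + 1}. \<alpha> = {(0, k), (1, k)})"
      unfolding E_def H_def vertical_def by blast
    then consider "\<alpha> = {(0, i), (0, i + 1)}" | "\<alpha> = {(1, i), (1, i + 1)}"
      | k where "k \<in> {1..n} - {i, i + 1}" "\<alpha> = {(0, k), (1, k)}" by blast
    then show "\<alpha> \<in> (\<lambda>p. {p, e p}) ` points n"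
    proof cases
      case 1
      then show ?thesis using ip by (intro image_eqI[of _ _ "(0, i)"]) (auto simp: e_def)
    next
      case 2
      then show ?thesis using ip by (intro image_eqI[of _ _ "(1, i)"]) (auto simp: e_def)
    next
      case 3
      then show ?thesis by (intro image_eqI[of _ _ "(0, k)"]) (auto simp: e_def points_def)
    qed
  next
    fix \<alpha> assume "\<alpha> \<in> (\<lambda>p. {p, e p}) ` points n"
    then obtain p where p: "p \<in> points n" "\<alpha> = {p, e p}" by blast
    consider "p = (0, i)" | "p = (0, i + 1)" | "p = (1, i)" | "p = (1, i + 1)"
      | "snd p \<notin> {i, i + 1}" using points_cases[OF p(1), of i] by blast
    then show "\<alpha> \<in> E"
    proof cases
      case 5
      then have "\<alpha> = {(0, snd p), (1, snd p)}" using p by (auto simp: e_def points_def)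
      moreover have "snd p \<in> {1..n} - {i, i + 1}" using p 5 by (auto simp: points_def)
      ultimately show ?thesis unfolding E_def vertical_def by blast
    qed (use p in \<open>auto simp: e_def E_def H_def insert_commute\<close>)
  qed
  have wp: "well_paired (e, l, 1)"
    using i by (auto simp: well_paired_def e_def l_def points_def lrev_def)
  have lab: "f {p, e p} = l p" if p: "p \<in> points n" "pless p (e p)" for p
  proof -
    have "{p, e p} \<in> E" using E p by blast
    moreover consider "p = (0, i)" | "p = (0, i + 1)" | "p = (1, i)" | "p = (1, i + 1)"
      | "snd p \<notin> {i, i + 1}" using points_cases[OF p(1), of i] by blast
    then have "(if {p, e p} \<in> H then 1 else 0) = l p"
    proof cases
      case 5
      then have "{p, e p} \<notin> H" "l p = 0" by (auto simp: H_def l_def doubleton_eq_iff)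
      then show ?thesis by simp
    qed (use p in \<open>auto simp: e_def l_def H_def pless_def insert_commute\<close>)
    ultimately show ?thesis by (simp add: f_def)
  qed
  have par: "even (l p) \<longleftrightarrow> fst p \<noteq> fst (e p)" if "p \<in> points n" for p
    using that by (auto simp: l_def e_def points_def)
  have fx: "f \<in> extensional E" by (simp add: f_def)
  have ep: "e p \<in> points n \<and> e p \<noteq> p" if "p \<in> points n" for p
    using that ip by (auto simp: e_def points_def)
  have out: "e p = p \<and> l p = 0" if "p \<notin> points n" for p
    using that ip by (auto simp: e_def l_def)
  note tangle_of_diagram[OF E fx ep lab par wp out]
  moreover have "hook (0, i) (0, i + 1) (- 1) 1 (id_diagram n) = (e, l, 1)"
    using ip by (auto simp: hook_def id_diagram_def fun_eq_iff e_def l_def lmul_def lrev_def)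
  moreover have "F_tangle n i = (E, f)"
    by (simp add: F_tangle_def E_def f_def H_def Let_def)
  ultimately show "F_tangle n i \<in> arrow_flat_tangles n"
    "diagram n (F_tangle n i) = hook (0, i) (0, i + 1) (- 1) 1 (id_diagram n)"
    by simp_all
qed

section \<open>Left multiplication by generators\<close>

definition dprod :: "nat \<Rightarrow> point diagram \<Rightarrow> point diagram \<Rightarrow> point diagram" where
  "dprod n D D' = trim (glue 1 n (beside D D'))"

lemma hook_weighted: "hook p q c d (weighted z D) = weighted z (hook p q c d D)"
  by (cases D) (simp add: hook_def weighted_def mult.assoc)

lemma relabel_weighted: "relabel \<pi> (weighted z D) = weighted z (relabel \<pi> D)"
  by (cases D) (simp add: relabel_def weighted_def)

lemma weighted_weighted: "weighted z (weighted z' D) = weighted (z * z') D"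
  by (cases D) (simp add: weighted_def mult.assoc)

lemma weighted_1 [simp]: "weighted 1 D = D"
  by (cases D) (simp add: weighted_def)

lemma dprod_weighted:
  "dprod n (weighted z D) D' = weighted z (dprod n D D')"
  "dprod n D (weighted z D') = weighted z (dprod n D D')"
proof -
  have g: "glue k n (weighted z S) = weighted z (glue k n S)" for k S
  proof -
    have "foldr glue_at ks (weighted z S) = weighted z (foldr glue_at ks S)" for ks
      by (induction ks) (simp_all add: glue_at_def hook_weighted)
    then show ?thesis by (simp only: glue_def)
  qed
  have b: "beside (weighted z D) D' = weighted z (beside D D')" "beside D (weighted z D') = weighted z (beside D D')"
    by (cases D; cases D'; simp add: beside_def weighted_def mult_ac)+
  have t: "trim (weighted z S) = weighted z (trim S)" for S
    by (cases S) (simp add: trim_def weighted_def)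
  show "dprod n (weighted z D) D' = weighted z (dprod n D D')"
    "dprod n D (weighted z D') = weighted z (dprod n D D')"
    by (simp_all only: dprod_def b g t)
qed

lemma beside_hook:
  "beside (hook p q c d D) D' = hook (First, p) (First, q) c d (beside D D')"
  by (cases D; cases D') (auto simp: beside_def hook_def fun_eq_iff mult_ac split: layer.splits)

definition on_first :: "('p \<Rightarrow> 'p) \<Rightarrow> layer \<times> 'p \<Rightarrow> layer \<times> 'p" where
  "on_first \<pi> = (\<lambda>(L, p). case L of First \<Rightarrow> (First, \<pi> p) | Second \<Rightarrow> (Second, p))"

lemma beside_relabel: "beside (relabel \<pi> D) D' = relabel (on_first \<pi>) (beside D D')"
  by (cases D; cases D') (auto simp: beside_def relabel_def on_first_def fun_eq_iff split: layer.splits)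

lemma glue_relabel:
  assumes "\<And>p. \<pi> (\<pi> p) = p" "\<And>k. \<pi> (1, k) = (1, k)"
  shows "glue k n (relabel (on_first \<pi>) S) = relabel (on_first \<pi>) (glue k n S)"
proof -
  have inv: "on_first \<pi> (on_first \<pi> x) = x" for x
    using assms(1) by (cases x) (auto simp: on_first_def split: layer.splits)
  have "glue_at j (relabel (on_first \<pi>) S) = relabel (on_first \<pi>) (glue_at j S)" for j S
    using hook_relabel[OF inv, of "(First, (1, j))" "(Second, (0, j))" 0 0 S] assms(2)
    by (simp add: glue_at_def on_first_def)
  then have "foldr glue_at ks (relabel (on_first \<pi>) S) = relabel (on_first \<pi>) (foldr glue_at ks S)" for ks
    by (induction ks) simp_all
  then show ?thesis by (simp only: glue_def)
qed

fun act :: "vb_gen \<Rightarrow> point diagram \<Rightarrow> point diagram" where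
  "act (Sigma_gen i) = hook (0, i) (0, i + 1) (- 1) 1"
| "act (Tau_gen i) = relabel (strand_swap i)"

fun gen_tangle :: "nat \<Rightarrow> vb_gen \<Rightarrow> arrow_flat" where
  "gen_tangle n (Sigma_gen i) = F_tangle n i"
| "gen_tangle n (Tau_gen i) = w_tangle n i"

lemma act_weighted: "act g (weighted z D) = weighted z (act g D)"
  by (cases g) (simp_all add: hook_weighted relabel_weighted)

lemma outer_inject: "outer p = outer q \<longleftrightarrow> p = q"
  by (auto simp: outer_def)

lemma snd_outer [simp]: "snd (outer p) = p"
  by (simp add: outer_def)

text \<open>\<open>trim\<close> sees only outer points. By assumption strands from outer points end
  at outer points, so this hook changes nothing at the glued ones.\<close>

lemma trim_hook:
  assumes eo: "\<And>p. e (outer p) = outer (snd (e (outer p)))"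
  shows "trim (hook (outer p) (outer q) c d (e, l, w)) = hook p q c d (trim (e, l, w))"
proof -
  define e' where "e' = (\<lambda>p. snd (e (outer p)))"
  have e: "e (outer p) = outer (e' p)" for p unfolding e'_def by (rule eo)
  have t: "trim (e, l, w) = (e', \<lambda>p. l (outer p), w)" by (simp add: trim_def e'_def)
  show ?thesis
    unfolding t by (simp add: hook_def trim_def e outer_inject fun_eq_iff del: split_paired_All)
qed

context tangle_pair
begin

lemma dprod_stacked: "dprod n (diagram n F) (diagram n F') = trim (glue 1 n stacked)"
  by (simp add: dprod_def stacked_def)

text \<open>The two outer points differ from the two points glued at any level, so
  \<open>hook_commute\<close> applies level by level.\<close>

lemma glue_hook:
  assumes k: "1 \<le> k" "k \<le> Suc n" and i: "1 \<le> i" "i < n"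
  shows "glue k n (hook (First, (0, i)) (First, (0, i + 1)) c d stacked) =
    hook (First, (0, i)) (First, (0, i + 1)) c d (glue k n stacked)"
  using k(2,1)
proof (induction k rule: inc_induct)
  case base
  then show ?case by (simp add: glue_empty)
next
  case (step k)
  have reg: "regular (glue (Suc k) n stacked)" using step by (intro regular_glue) auto
  have act: "fst (glue (Suc k) n stacked) x \<noteq> x" if "snd x \<in> points n" for x
    using reg that unfolding regular_def by metis
  have "hook (First, (0, i)) (First, (0, i + 1)) c d (hook (First, (1, k)) (Second, (0, k)) 0 0 (glue (Suc k) n stacked)) =
    hook (First, (1, k)) (Second, (0, k)) 0 0 (hook (First, (0, i)) (First, (0, i + 1)) c d (glue (Suc k) n stacked))"
  proof (rule hook_commute)
    show "well_paired (glue (Suc k) n stacked)" using reg by (simp add: regular_def)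
  qed (use act i step in \<open>simp_all add: points_def\<close>)
  then show ?case using step by (simp add: glue_Suc glue_at_def)
qed

lemma dprod_hook:
  assumes i: "1 \<le> i" "i < n"
  shows "dprod n (hook (0, i) (0, i + 1) c d (diagram n F)) (diagram n F') =
    hook (0, i) (0, i + 1) c d (dprod n (diagram n F) (diagram n F'))"
proof -
  obtain e l w where S: "glue 1 n stacked = (e, l, w)" by (metis prod_cases3)
  have eo: "e (outer p) = outer (snd (e (outer p)))" for p
    using glue_outer[of p] unfolding S by simp
  have oi: "outer (0, k) = (First, (0, k))" for k by (simp add: outer_def)
  have "dprod n (hook (0, i) (0, i + 1) c d (diagram n F)) (diagram n F')
      = trim (hook (outer (0, i)) (outer (0, i + 1)) c d (e, l, w))"
    using glue_hook[of 1 i c d] i S by (simp add: dprod_def beside_hook oi stacked_def)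
  also have "\<dots> = hook (0, i) (0, i + 1) c d (trim (e, l, w))"
    by (rule trim_hook) (rule eo)
  finally show ?thesis by (simp only: dprod_stacked S)
qed

text \<open>The renaming moves only points of side 0 in the first layer, so it leaves the seam
  fixed.\<close>

lemma dprod_relabel:
  assumes \<pi>: "\<And>p. \<pi> (\<pi> p) = p" "\<And>k. \<pi> (1, k) = (1, k)" "\<And>p. fst (\<pi> p) = fst p"
    and id: "\<And>p. fst p \<noteq> 0 \<Longrightarrow> \<pi> p = p"
  shows "dprod n (relabel \<pi> (diagram n F)) (diagram n F') =
    relabel \<pi> (dprod n (diagram n F) (diagram n F'))"
proof -
  obtain e l w where S: "glue 1 n stacked = (e, l, w)" by (metis prod_cases3)
  have eo: "e (outer p) = outer (snd (e (outer p)))" for p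
    using glue_outer[of p] unfolding S by simp
  have of: "on_first \<pi> (outer p) = outer (\<pi> p)" for p
    using \<pi>(3)[of p] id[of p] by (auto simp: on_first_def outer_def)
  have "dprod n (relabel \<pi> (diagram n F)) (diagram n F') = trim (relabel (on_first \<pi>) (e, l, w))"
    using S by (simp add: dprod_def beside_relabel glue_relabel[OF \<pi>(1,2)] stacked_def)
  also have "\<dots> = relabel \<pi> (trim (e, l, w))"
    using eo by (simp add: trim_def relabel_def of fun_eq_iff) (metis of snd_outer)
  finally show ?thesis by (simp only: dprod_stacked S)
qed

end

lemma dprod_act:
  assumes "F \<in> arrow_flat_tangles n" "F' \<in> arrow_flat_tangles n" "g \<in> vb_gens n"
  shows "dprod n (act g (diagram n F)) (diagram n F') = act g (dprod n (diagram n F) (diagram n F'))"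
proof -
  interpret tangle_pair n F F' using assms by unfold_locales
  show ?thesis
  proof (cases g)
    case (Sigma_gen i)
    then show ?thesis using dprod_hook[of i] assms(3) by (auto simp: vb_gens_def)
  next
    case (Tau_gen i)
    have "dprod n (relabel (strand_swap i) (diagram n F)) (diagram n F') =
        relabel (strand_swap i) (dprod n (diagram n F) (diagram n F'))"
      by (rule dprod_relabel) (auto simp: strand_swap_def)
    then show ?thesis using Tau_gen by simp
  qed
qed

lemma dprod_diagram:
  assumes "F \<in> arrow_flat_tangles n" "F' \<in> arrow_flat_tangles n"
  shows "dprod n (diagram n F) (diagram n F') = weighted (cycle_weight F F') (diagram n (arrow_comp F F'))"
    "arrow_comp F F' \<in> arrow_flat_tangles n"
proof -
  interpret tangle_pair n F F' using assms by unfold_locales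
  show "dprod n (diagram n F) (diagram n F') = weighted (cycle_weight F F') (diagram n (arrow_comp F F'))"
    "arrow_comp F F' \<in> arrow_flat_tangles n"
    using product_diagram by (simp_all add: dprod_stacked)
qed

lemma dprod_id:
  assumes X: "X \<in> arrow_flat_tangles n"
  shows "dprod n (id_diagram n) (diagram n X) = diagram n X"
proof -
  let ?I = "id_tangle n"
  interpret tangle_pair n ?I X using X id_tangle_diagram(1) by unfold_locales
  note EX = arrow_flat_tanglesD(1)[OF X]
  \<comment> \<open>A cycle begins with a pair of the first factor that has both ends on side 1, and
    the identity has no such pair.\<close>
  have "cycles (fst ?I) (fst X) = {}"
  proof -
    have False if xs: "xs \<in> cycles (fst ?I) (fst X)" for xs
    proof -
      have "xs ! 0 \<in> gsteps" "layer (xs ! 0) = First" "fst (src (xs ! 0)) = 1" "fst (tgt (xs ! 0)) = 1"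
        using xs by (force simp: cycles_def)+
      then have "{src (xs ! 0), tgt (xs ! 0)} \<in> vertical {1..n}" by (simp add: steps_def id_tangle_def)
      then obtain k where "{src (xs ! 0), tgt (xs ! 0)} = {(0, k), (1, k)}" by (auto simp: vertical_def)
      then have "(0, k) \<in> {src (xs ! 0), tgt (xs ! 0)}" by simp
      then show False using \<open>fst (src (xs ! 0)) = 1\<close> \<open>fst (tgt (xs ! 0)) = 1\<close>
        by (metis fst_conv insert_iff singletonD zero_neq_one)
    qed
    then show ?thesis by blast
  qed
  then have cw: "cycle_weight ?I X = 1" by (simp add: cycle_weight_def case_prod_beta)
  then have tr: "trim (glue 1 n stacked) = diagram n (arrow_comp ?I X)"
    using product_diagram by simp
  have st1: "fst stacked (First, p) = (First, (1 - fst p, snd p))" "fst (snd stacked) (First, p) = 0"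
    if "p \<in> points n" for p
    using that by (simp_all add: stacked_def beside_def id_tangle_diagram id_diagram_def diagram_def[of n X])
  have st2: "fst stacked (Second, p) = (Second, partner n (fst X) p)"
    "fst (snd stacked) (Second, p) = dart_label n X p" for p
    by (simp_all add: stacked_def beside_def id_tangle_diagram id_diagram_def diagram_def[of n X])
  have main: "partner n (fst (arrow_comp ?I X)) p = partner n (fst X) p \<and>
      dart_label n (arrow_comp ?I X) p = dart_label n X p" if p: "p \<in> points n" for p
  proof -
    define y where "y = partner n (fst X) p"
    have y: "y \<in> points n" using p EX by (simp add: y_def)
    \<comment> \<open>An end on side 0 is reached through a vertical strand of the identity; an
      outer end on side 1 already belongs to the second layer.\<close>
    define pre where "pre = (if fst p = 0 then [Step First p (1, snd p)] else [])"
    define post where "post = (if fst y = 0 then [Step First (1, snd y) y] else [])"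
    define mid where "mid = Step Second p y"
    have m: "mid \<in> gsteps" using p by (simp add: mid_def gsteps_iff dart_src_def dart_tgt_def st2 y_def)
    have pr: "set pre \<subseteq> gsteps"
      using p st1(1)[OF p] by (auto simp: pre_def gsteps_iff dart_src_def dart_tgt_def)
    have py: "(1, snd y) \<in> points n" "fst p \<le> 1" "fst y \<le> 1" "1 \<le> snd p" "1 \<le> snd y" using y p by (auto simp: points_def)
    have po: "set post \<subseteq> gsteps"
      using py st1(1)[OF py(1)] by (cases y) (auto simp: post_def gsteps_iff dart_src_def dart_tgt_def)
    have "chain {1..} (pre @ [mid] @ post)"
      using m pr po py unfolding chain_def
      by (cases p; cases y) (auto simp: pre_def post_def mid_def glued_def mate_def dart_src_def dart_tgt_def)
    moreover have "dart_src (hd (pre @ [mid] @ post)) = outer p"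
      by (simp add: pre_def mid_def dart_src_def outer_def)
    moreover have "dart_tgt (last (pre @ [mid] @ post)) = outer y"
      by (simp add: post_def mid_def dart_tgt_def outer_def)
    moreover have "chain_label (pre @ [mid] @ post) = dart_label n X p"
      using st1(2)[OF p] st1(2)[OF py(1)] st2(2)[of p]
      by (simp add: chain_label_def pre_def mid_def post_def dart_src_def)
    ultimately show ?thesis using chain_product[of _ p y] p y tr unfolding diagram_def y_def by metis
  qed
  have "partner n (fst (arrow_comp ?I X)) p = partner n (fst X) p \<and>
      dart_label n (arrow_comp ?I X) p = dart_label n X p" for p
    using main[of p] by (cases "p \<in> points n") auto
  then have "diagram n (arrow_comp ?I X) = diagram n X" by (simp add: diagram_def fun_eq_iff del: split_paired_All)
  then show ?thesis using dprod_stacked tr id_tangle_diagram(2) by simp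
qed

lemma gen_tangle_diagram:
  assumes "g \<in> vb_gens n"
  shows "gen_tangle n g \<in> arrow_flat_tangles n" "diagram n (gen_tangle n g) = act g (id_diagram n)"
  using assms by (auto simp: vb_gens_def F_tangle_diagram w_tangle_diagram)

lemma weighted_diagram_inject:
  assumes "X \<in> arrow_flat_tangles n" "Y \<in> arrow_flat_tangles n"
    and "weighted c (diagram n X) = weighted d (diagram n Y)"
  shows "X = Y" "c = d"
proof -
  have "diagram n X = diagram n Y" "c = d" using assms(3) by (auto simp: weighted_def diagram_def)
  then show "X = Y" "c = d" using diagram_inject assms by blast+
qed

text \<open>A generator is \<open>act g\<close> applied to the identity. Since the action commutes
  with products and the identity is a left unit, multiplying by the generator is the action.\<close>

lemma gen_comp_diagram:
  assumes g: "g \<in> vb_gens n" and X: "X \<in> arrow_flat_tangles n"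
  shows "weighted (cycle_weight (gen_tangle n g) X) (diagram n (arrow_comp (gen_tangle n g) X)) = act g (diagram n X)"
  using dprod_diagram(1)[OF gen_tangle_diagram(1)[OF g] X] gen_tangle_diagram(2)[OF g]
    dprod_act[OF id_tangle_diagram(1) X g] dprod_id[OF X] id_tangle_diagram(2)[of n] by simp

text \<open>Both products come from the action of \<open>g\<close> on the weighted diagram of the
  product of \<open>X\<close> and \<open>Y\<close>; tangle and coefficient are then compared
  separately.\<close>

lemma gen_comp_assoc:
  assumes g: "g \<in> vb_gens n" and X: "X \<in> arrow_flat_tangles n" and Y: "Y \<in> arrow_flat_tangles n"
  defines "G \<equiv> gen_tangle n g"
  shows "arrow_comp (arrow_comp G X) Y = arrow_comp G (arrow_comp X Y)"
    "cycle_weight G X * cycle_weight (arrow_comp G X) Y = cycle_weight X Y * cycle_weight G (arrow_comp X Y)"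
proof -
  have G: "G \<in> arrow_flat_tangles n" using gen_tangle_diagram(1)[OF g] by (simp add: G_def)
  note GX = dprod_diagram(2)[OF G X] and XY = dprod_diagram(2)[OF X Y]
  have "weighted (cycle_weight G X * cycle_weight (arrow_comp G X) Y) (diagram n (arrow_comp (arrow_comp G X) Y))
      = dprod n (weighted (cycle_weight G X) (diagram n (arrow_comp G X))) (diagram n Y)"
    by (simp add: dprod_weighted dprod_diagram(1)[OF GX Y] weighted_weighted)
  also have "\<dots> = dprod n (act g (diagram n X)) (diagram n Y)"
    using gen_comp_diagram[OF g X] by (simp add: G_def)
  also have "\<dots> = act g (weighted (cycle_weight X Y) (diagram n (arrow_comp X Y)))"
    by (simp add: dprod_act[OF X Y g] dprod_diagram(1)[OF X Y])
  also have "\<dots> = weighted (cycle_weight X Y * cycle_weight G (arrow_comp X Y)) (diagram n (arrow_comp G (arrow_comp X Y)))"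
    using gen_comp_diagram[OF g XY] by (simp add: act_weighted G_def flip: weighted_weighted)
  finally have eq: "weighted (cycle_weight G X * cycle_weight (arrow_comp G X) Y) (diagram n (arrow_comp (arrow_comp G X) Y))
    = weighted (cycle_weight X Y * cycle_weight G (arrow_comp X Y)) (diagram n (arrow_comp G (arrow_comp X Y)))" .
  show "arrow_comp (arrow_comp G X) Y = arrow_comp G (arrow_comp X Y)"
    "cycle_weight G X * cycle_weight (arrow_comp G X) Y = cycle_weight X Y * cycle_weight G (arrow_comp X Y)"
    using weighted_diagram_inject[OF dprod_diagram(2)[OF GX Y] dprod_diagram(2)[OF G XY] eq] by auto
qed

lemma id_comp:
  assumes X: "X \<in> arrow_flat_tangles n"
  shows "arrow_comp (id_tangle n) X = X" "cycle_weight (id_tangle n) X = 1"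
proof -
  have "weighted (cycle_weight (id_tangle n) X) (diagram n (arrow_comp (id_tangle n) X)) = weighted 1 (diagram n X)"
    using dprod_id[OF X] dprod_diagram(1)[OF id_tangle_diagram(1) X] id_tangle_diagram(2) by simp
  then show "arrow_comp (id_tangle n) X = X" "cycle_weight (id_tangle n) X = 1"
    using weighted_diagram_inject[OF dprod_diagram(2)[OF id_tangle_diagram(1) X] X] by blast+
qed

section \<open>Relations between the actions of the generators\<close>

lemma relabel_involution: "(\<And>x. \<pi> (\<pi> x) = x) \<Longrightarrow> relabel \<pi> (relabel \<pi> D) = D"
  by (cases D) (simp add: relabel_def comp_def)

lemma act_tau_tau: "act (Tau_gen i) (act (Tau_gen i) D) = D"
  by (simp add: relabel_involution)

lemma act_tau_commute:
  assumes "i \<noteq> j" "Suc i \<noteq> j" "Suc j \<noteq> i"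
  shows "act (Tau_gen i) (act (Tau_gen j) D) = act (Tau_gen j) (act (Tau_gen i) D)"
proof -
  have "strand_swap i (strand_swap j p) = strand_swap j (strand_swap i p)" for p
    using assms by (auto simp: strand_swap_def)
  then show ?thesis by (cases D) (simp add: relabel_def fun_eq_iff del: split_paired_All)
qed

lemma act_tau_braid:
  assumes "j = Suc i \<or> i = Suc j"
  shows "act (Tau_gen i) (act (Tau_gen j) (act (Tau_gen i) D)) = act (Tau_gen j) (act (Tau_gen i) (act (Tau_gen j) D))"
proof -
  have "strand_swap i (strand_swap j (strand_swap i p)) = strand_swap j (strand_swap i (strand_swap j p))" for p
    using assms by (auto simp: strand_swap_def)
  then show ?thesis by (cases D) (simp add: relabel_def fun_eq_iff del: split_paired_All)
qed

text \<open>A renaming carries a hook to the hook at the renamed points, so the mixed relations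
  reduce to following two points through the swaps.\<close>

lemma act_tau_sigma:
  "act (Tau_gen j) (act (Sigma_gen i) D) =
    hook (strand_swap j (0, i)) (strand_swap j (0, i + 1)) (- 1) 1 (act (Tau_gen j) D)"
  by (simp add: hook_relabel[of "strand_swap j", symmetric])

lemma act_tau_sigma_commute:
  assumes "i \<noteq> j" "Suc i \<noteq> j" "Suc j \<noteq> i"
  shows "act (Tau_gen i) (act (Sigma_gen j) D) = act (Sigma_gen j) (act (Tau_gen i) D)"
proof -
  have "strand_swap i (0, j) = (0, j)" "strand_swap i (0, j + 1) = (0, j + 1)"
    using assms by (auto simp: strand_swap_def)
  then show ?thesis using act_tau_sigma[of i j D] by simp
qed

lemma act_tau_tau_sigma:
  assumes "j = Suc i \<or> i = Suc j"
  shows "act (Tau_gen i) (act (Tau_gen j) (act (Sigma_gen i) D)) = act (Sigma_gen j) (act (Tau_gen i) (act (Tau_gen j) D))"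
proof -
  have "act (Tau_gen i) (act (Tau_gen j) (act (Sigma_gen i) D)) =
      hook (strand_swap i (strand_swap j (0, i))) (strand_swap i (strand_swap j (0, i + 1))) (- 1) 1
        (act (Tau_gen i) (act (Tau_gen j) D))"
    unfolding act_tau_sigma by (simp add: hook_relabel[of "strand_swap i", symmetric])
  moreover have "strand_swap i (strand_swap j (0, i)) = (0, j)" "strand_swap i (strand_swap j (0, i + 1)) = (0, j + 1)"
    using assms by (auto simp: strand_swap_def)
  ultimately show ?thesis by simp
qed

text \<open>On the identity all four points are in use, as \<open>hook_commute\<close>
  requires.\<close>

lemma act_sigma_commute:
  assumes "i \<noteq> j" "Suc i \<noteq> j" "Suc j \<noteq> i" "1 \<le> i" "i < n" "1 \<le> j" "j < n"
  shows "act (Sigma_gen i) (act (Sigma_gen j) (id_diagram n)) = act (Sigma_gen j) (act (Sigma_gen i) (id_diagram n))"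
  unfolding act.simps
  by (rule hook_commute[OF well_paired_id_diagram]) (use assms in \<open>auto simp: id_diagram_def points_def\<close>)

text \<open>The second hook closes the strand left by the first, and the loop has label
  \<open>1 \<star> lrev (- 1) = 0\<close>.\<close>

lemma act_sigma_sigma:
  "act (Sigma_gen i) (act (Sigma_gen i) D) = weighted (z_var 0) (act (Sigma_gen i) D)"
proof -
  obtain e l w where D: "D = (e, l, w)" by (metis prod_cases3)
  obtain e' l' w' where D': "hook (0, i) (0, i + 1) (- 1) 1 D = (e', l', w')" by (metis prod_cases3)
  have "e' (0, i) = (0, i + 1)" "l' (0, i) = 1" "l' (0, i + 1) = - 1"
    using D' by (auto simp: D hook_def lrev_def split: if_splits)
  then show ?thesis
    by (simp add: D'[simplified] weighted_def)
      (auto simp: hook_def lrev_def lmul_def loop_index_def fun_eq_iff mult.commute)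
qed

text \<open>A zigzag is pulled straight. It contributes \<open>1 \<star> (- 1) = 2\<close> and
  \<open>(- 1) \<star> 1 = - 2\<close> to the label of the strand between \<open>r\<close> and
  \<open>v\<close>, and these cancel.\<close>

lemma hook_zigzag:
  assumes e: "e p = q" "e q = p" "e r = v" "e v = r" and dist: "distinct [p, q, r, v]"
    and l: "l p = 1" "l q = - 1" "l v = lrev (l r)"
  shows "hook p q (- 1) 1 (hook q r (- 1) 1 (e, l, w)) = (e, l, w)"
    "hook p q (- 1) 1 (hook r p (- 1) 1 (e, l, w)) = (e, l, w)"
proof -
  have ne: "p \<noteq> q" "p \<noteq> r" "p \<noteq> v" "q \<noteq> r" "q \<noteq> v" "r \<noteq> v" using dist by auto
  note ne = ne ne[symmetric]
  show "hook p q (- 1) 1 (hook q r (- 1) 1 (e, l, w)) = (e, l, w)"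
    apply (subst hook_join[of e, OF e(2,3)], simp add: ne)
    apply (subst hook_join[of _ p v q r], simp_all add: ne e)
    apply (intro conjI ext)
    subgoal for x
      by (cases "x \<in> {p, q, r, v}", elim insertE emptyE; simp add: ne e)
    subgoal for x
      by (cases "x \<in> {p, q, r, v}", elim insertE emptyE; simp add: ne l; simp add: lmul_def lrev_def)
    done
  show "hook p q (- 1) 1 (hook r p (- 1) 1 (e, l, w)) = (e, l, w)"
    apply (subst hook_join[of e, OF e(3,1)], simp add: ne)
    apply (subst hook_join[of _ p r q v], simp_all add: ne e)
    apply (intro conjI ext)
    subgoal for x
      by (cases "x \<in> {p, q, r, v}", elim insertE emptyE; simp add: ne e)
    subgoal for x
      by (cases "x \<in> {p, q, r, v}", elim insertE emptyE; simp add: ne l; simp add: lmul_def lrev_def)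
    done
qed

lemma act_sigma_zigzag:
  assumes ij: "j = Suc i \<or> i = Suc j" and i: "1 \<le> i" "i < n" and j: "1 \<le> j" "j < n"
  shows "act (Sigma_gen i) (act (Sigma_gen j) (act (Sigma_gen i) (id_diagram n))) = act (Sigma_gen i) (id_diagram n)"
proof -
  obtain e l w where D: "hook (0, i) (0, i + 1) (- 1) 1 (id_diagram n) = (e, l, w)" by (metis prod_cases3)
  have ip: "(0, i) \<in> points n" "(0, i + 1) \<in> points n" using i by (auto simp: points_def)
  have e: "e (0, i) = (0, i + 1)" "e (0, i + 1) = (0, i)"
    and l: "l (0, i) = 1" "l (0, i + 1) = - 1"
    using D ip by (auto simp: hook_def id_diagram_def lrev_def)
  \<comment> \<open>The strand met by \<open>F_j\<close> but not by \<open>F_i\<close>.\<close>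
  define k where "k = (if j = Suc i then i + 2 else j)"
  have "(0, k) \<in> points n" "(1, k) \<in> points n" "k \<noteq> i" "k \<noteq> i + 1" using i j ij by (auto simp: k_def points_def)
  then have k: "e (0, k) = (1, k)" "e (1, k) = (0, k)" "l (0, k) = 0" "l (1, k) = 0"
    using D ip by (auto simp: hook_def id_diagram_def)
  show ?thesis
  proof (cases "j = Suc i")
    case True
    then show ?thesis
      using hook_zigzag(1)[of e "(0, i)" "(0, i + 1)" "(0, k)" "(1, k)" l w] e l k D by (simp add: k_def)
  next
    case False
    then show ?thesis
      using hook_zigzag(2)[of e "(0, i)" "(0, i + 1)" "(0, k)" "(1, k)" l w] e l k D ij by (simp add: k_def)
  qed
qed

section \<open>Linear extension\<close>

lemma scale_simps:
  "scale c (x + y) = scale c x + scale c y" "scale (a + b) x = scale a x + scale b x"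
  "scale a (scale b x) = scale (a * b) x" "scale 1 x = x" "scale c 0 = 0" "scale 0 x = 0"
  by (auto intro!: poly_mapping_eqI simp: lookup_add algebra_simps)

lemma scale_sum: "scale c (\<Sum>i\<in>I. f i) = (\<Sum>i\<in>I. scale c (f i))"
  by (induction I rule: infinite_finite_induct) (simp_all add: scale_simps)

lemma scale_single: "scale c (Poly_Mapping.single b d) = Poly_Mapping.single b (c * d)"
  by (rule poly_mapping_eqI) (simp add: lookup_single when_def)

lemma keys_scale: "Poly_Mapping.keys (scale c x) \<subseteq> Poly_Mapping.keys x"
  by (auto simp: in_keys_iff)

text \<open>Linearity on all finitely supported functions, whatever their support; by
  \<open>free_algebra_mult_linear\<close> the product formula has this property in each
  argument.\<close>

definition linear :: "(('b \<Rightarrow>\<^sub>0 'r::comm_ring_1) \<Rightarrow> ('c \<Rightarrow>\<^sub>0 'r)) \<Rightarrow> bool" where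
  "linear f \<longleftrightarrow> (\<forall>x y. f (x + y) = f x + f y) \<and> (\<forall>c x. f (scale c x) = scale c (f x))"

lemma linear_sum: "linear f \<Longrightarrow> f (\<Sum>i\<in>I. g i) = (\<Sum>i\<in>I. f (g i))"
proof (induction I rule: infinite_finite_induct)
  case (infinite A)
  then have "f (scale 0 0) = scale 0 (f 0)" by (simp only: linear_def)
  then show ?case using infinite by (simp add: scale_simps)
next
  case empty
  then have "f (scale 0 0) = scale 0 (f 0)" by (simp only: linear_def)
  then show ?case by (simp add: scale_simps)
qed (simp add: linear_def)

lemma linear_expand:
  assumes "linear f"
  shows "f x = (\<Sum>b\<in>Poly_Mapping.keys x. scale (Poly_Mapping.lookup x b) (f (Poly_Mapping.single b 1)))"
proof -
  have "f x = f (\<Sum>b\<in>Poly_Mapping.keys x. scale (Poly_Mapping.lookup x b) (Poly_Mapping.single b 1))"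
    using sum_singles[of x] by (simp add: scale_single)
  then show ?thesis using assms by (simp add: linear_sum) (simp add: linear_def)
qed

lemma linear_eqI:
  assumes "linear f" "linear g" "Poly_Mapping.keys x \<subseteq> B"
    and "\<And>b. b \<in> B \<Longrightarrow> f (Poly_Mapping.single b 1) = g (Poly_Mapping.single b 1)"
  shows "f x = g x"
  unfolding linear_expand[OF assms(1), of x] linear_expand[OF assms(2), of x]
  using assms by (intro sum.cong) auto

lemma linear_comp: "linear f \<Longrightarrow> linear g \<Longrightarrow> linear (\<lambda>x. f (g x))"
  by (simp add: linear_def)

lemma linear_id: "linear (\<lambda>x. x)"
  by (simp add: linear_def)

lemma linear_extension:
  fixes r :: "'b \<Rightarrow> ('c \<Rightarrow>\<^sub>0 'r::comm_ring_1)"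
  defines "f \<equiv> \<lambda>x. \<Sum>b\<in>Poly_Mapping.keys x. scale (Poly_Mapping.lookup x b) (r b)"
  shows "linear f" "f (Poly_Mapping.single b 1) = r b"
proof -
  have sup: "f x = (\<Sum>b\<in>K. scale (Poly_Mapping.lookup x b) (r b))" if "finite K" "Poly_Mapping.keys x \<subseteq> K" for x K
    unfolding f_def using that by (intro sum.mono_neutral_left) (auto simp: in_keys_iff scale_simps)
  have "f (x + y) = f x + f y" for x y
    using keys_add[of x y]
    by (subst (1 2 3) sup[of "Poly_Mapping.keys x \<union> Poly_Mapping.keys y"])
      (auto simp: lookup_add scale_simps sum.distrib)
  moreover have "f (scale c x) = scale c (f x)" for c x
    using keys_scale[of c x]
    by (subst (1 2) sup[of "Poly_Mapping.keys x"]) (auto simp: scale_sum scale_simps)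
  ultimately show "linear f" by (simp add: linear_def)
  show "f (Poly_Mapping.single b 1) = r b" by (subst sup[of "{b}"]) (auto simp: scale_simps)
qed

lemma keys_sum_scale_subset:
  assumes "\<And>i. i \<in> I \<Longrightarrow> Poly_Mapping.keys (f i) \<subseteq> B"
  shows "Poly_Mapping.keys (\<Sum>i\<in>I. scale (c i) (f i)) \<subseteq> B"
  using assms
proof (induction I rule: infinite_finite_induct)
  case (insert i I)
  then have "Poly_Mapping.keys (f i) \<subseteq> B" "Poly_Mapping.keys (\<Sum>i\<in>I. scale (c i) (f i)) \<subseteq> B"
    by blast+
  then have "Poly_Mapping.keys (scale (c i) (f i) + (\<Sum>i\<in>I. scale (c i) (f i))) \<subseteq> B"
    using keys_add[of "scale (c i) (f i)" "\<Sum>i\<in>I. scale (c i) (f i)"] keys_scale[of "c i" "f i"]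
    by (meson le_sup_iff subset_trans)
  then show ?case using insert.hyps by simp
qed auto

lemma carrier_free_algebra: "x \<in> carrier (free_algebra B \<mu> u) \<longleftrightarrow> Poly_Mapping.keys x \<subseteq> B"
  by (simp add: free_algebra_def)

lemma free_algebra_mult_linear:
  shows "linear (\<lambda>x. x \<otimes>\<^bsub>free_algebra B \<mu> u\<^esub> y)" "linear (\<lambda>y. x \<otimes>\<^bsub>free_algebra B \<mu> u\<^esub> y)"
proof -
  let ?m = "\<lambda>x y. x \<otimes>\<^bsub>free_algebra B \<mu> u\<^esub> y"
  have "linear (\<lambda>x. \<Sum>a\<in>Poly_Mapping.keys x. scale (Poly_Mapping.lookup x a)
      (\<Sum>b\<in>Poly_Mapping.keys y. scale (Poly_Mapping.lookup y b) (\<mu> a b)))"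
    by (rule linear_extension)
  then show "linear (\<lambda>x. ?m x y)"
    by (simp add: free_algebra_def scale_sum scale_simps)
  have "linear (\<lambda>y. \<Sum>b\<in>Poly_Mapping.keys y. scale (Poly_Mapping.lookup y b)
      (\<Sum>a\<in>Poly_Mapping.keys x. scale (Poly_Mapping.lookup x a) (\<mu> a b)))"
    by (rule linear_extension)
  moreover have "?m x y = (\<Sum>b\<in>Poly_Mapping.keys y. scale (Poly_Mapping.lookup y b)
      (\<Sum>a\<in>Poly_Mapping.keys x. scale (Poly_Mapping.lookup x a) (\<mu> a b)))" for y
    by (simp add: free_algebra_def scale_sum scale_simps mult.commute) (rule sum.swap)
  ultimately show "linear (\<lambda>y. ?m x y)" by simp
qed

lemma free_algebra_mult_closed:
  assumes "\<And>a b. a \<in> B \<Longrightarrow> b \<in> B \<Longrightarrow> Poly_Mapping.keys (\<mu> a b) \<subseteq> B"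
    and "Poly_Mapping.keys x \<subseteq> B" "Poly_Mapping.keys y \<subseteq> B"
  shows "Poly_Mapping.keys (x \<otimes>\<^bsub>free_algebra B \<mu> u\<^esub> y) \<subseteq> B"
proof -
  have "x \<otimes>\<^bsub>free_algebra B \<mu> u\<^esub> y = (\<Sum>a\<in>Poly_Mapping.keys x. scale 1 (\<Sum>b\<in>Poly_Mapping.keys y.
      scale (Poly_Mapping.lookup x a * Poly_Mapping.lookup y b) (\<mu> a b)))"
    by (simp add: free_algebra_def scale_simps)
  also have "Poly_Mapping.keys \<dots> \<subseteq> B"
    using assms by (intro keys_sum_scale_subset) auto
  finally show ?thesis .
qed

lemma group_algebra_hom_exists:
  fixes r :: "'g \<Rightarrow> ('b \<Rightarrow>\<^sub>0 'r::comm_ring_1)" and \<mu> u B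
  defines "T \<equiv> free_algebra B \<mu> u"
  assumes r: "\<And>g. g \<in> carrier G \<Longrightarrow> r g \<in> carrier T"
    and r_mult: "\<And>g h. g \<in> carrier G \<Longrightarrow> h \<in> carrier G \<Longrightarrow> r (g \<otimes>\<^bsub>G\<^esub> h) = r g \<otimes>\<^bsub>T\<^esub> r h"
    and r_one: "r \<one>\<^bsub>G\<^esub> = \<one>\<^bsub>T\<^esub>"
  shows "\<exists>\<rho>\<in>alg_hom (group_algebra G) T. \<forall>g. \<rho> (Poly_Mapping.single g 1) = r g"
proof -
  define \<rho> where "\<rho> = (\<lambda>x. \<Sum>g\<in>Poly_Mapping.keys x. scale (Poly_Mapping.lookup x g) (r g))"
  let ?A = "group_algebra G :: ('r, 'g \<Rightarrow>\<^sub>0 'r) module"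
  have lin: "linear \<rho>" and single: "\<rho> (Poly_Mapping.single g 1) = r g" for g
    unfolding \<rho>_def by (rule linear_extension)+
  have ml: "linear (\<lambda>x. x \<otimes>\<^bsub>T\<^esub> y)" "linear (\<lambda>x. y \<otimes>\<^bsub>T\<^esub> x)" for y
    unfolding T_def by (rule free_algebra_mult_linear)+
  have ml': "linear (\<lambda>x. x \<otimes>\<^bsub>?A\<^esub> y)" "linear (\<lambda>x. y \<otimes>\<^bsub>?A\<^esub> x)" for y
    unfolding group_algebra_def by (rule free_algebra_mult_linear)+
  \<comment> \<open>Both sides are linear in each argument, so it is enough to compare them on group
    elements.\<close>
  have mult: "\<rho> (x \<otimes>\<^bsub>?A\<^esub> y) = \<rho> x \<otimes>\<^bsub>T\<^esub> \<rho> y" if x: "x \<in> carrier ?A" and y: "y \<in> carrier ?A" for x y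
  proof (rule linear_eqI[of "\<lambda>x. \<rho> (x \<otimes>\<^bsub>?A\<^esub> y)" "\<lambda>x. \<rho> x \<otimes>\<^bsub>T\<^esub> \<rho> y" x "carrier G"])
    show "linear (\<lambda>x. \<rho> (x \<otimes>\<^bsub>?A\<^esub> y))" "linear (\<lambda>x. \<rho> x \<otimes>\<^bsub>T\<^esub> \<rho> y)"
      using linear_comp[OF lin ml'(1)] linear_comp[OF ml(1) lin] by simp_all
    show "Poly_Mapping.keys x \<subseteq> carrier G" using x by (simp add: group_algebra_def carrier_free_algebra)
    fix g assume g: "g \<in> carrier G"
    show "\<rho> (Poly_Mapping.single g 1 \<otimes>\<^bsub>?A\<^esub> y) = \<rho> (Poly_Mapping.single g 1) \<otimes>\<^bsub>T\<^esub> \<rho> y"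
    proof (rule linear_eqI[of "\<lambda>y. \<rho> (Poly_Mapping.single g 1 \<otimes>\<^bsub>?A\<^esub> y)"
          "\<lambda>y. \<rho> (Poly_Mapping.single g 1) \<otimes>\<^bsub>T\<^esub> \<rho> y" y "carrier G"])
      show "linear (\<lambda>y. \<rho> (Poly_Mapping.single g 1 \<otimes>\<^bsub>?A\<^esub> y))" "linear (\<lambda>y. \<rho> (Poly_Mapping.single g 1) \<otimes>\<^bsub>T\<^esub> \<rho> y)"
        using linear_comp[OF lin ml'(2)] linear_comp[OF ml(2) lin] by simp_all
      show "Poly_Mapping.keys y \<subseteq> carrier G" using y by (simp add: group_algebra_def carrier_free_algebra)
      fix h assume "h \<in> carrier G"
      then show "\<rho> (Poly_Mapping.single g 1 \<otimes>\<^bsub>?A\<^esub> Poly_Mapping.single h 1) =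
          \<rho> (Poly_Mapping.single g 1) \<otimes>\<^bsub>T\<^esub> \<rho> (Poly_Mapping.single h 1)"
        using g by (simp add: group_algebra_def free_algebra_mult_single single r_mult)
    qed
  qed
  have closed: "\<rho> x \<in> carrier T" if "x \<in> carrier ?A" for x
    using that r unfolding \<rho>_def T_def carrier_free_algebra group_algebra_def
    by (intro keys_sum_scale_subset) auto
  have "\<rho> \<in> ring_hom ?A T"
  proof (rule ring_hom_memI)
    show "\<rho> \<one>\<^bsub>?A\<^esub> = \<one>\<^bsub>T\<^esub>" using r_one single by (simp add: group_algebra_def free_algebra_def)
    show "\<rho> (x \<oplus>\<^bsub>?A\<^esub> y) = \<rho> x \<oplus>\<^bsub>T\<^esub> \<rho> y" for x y
      using lin by (simp add: group_algebra_def free_algebra_def T_def linear_def)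
  qed (use mult closed in auto)
  moreover have "\<rho> (c \<odot>\<^bsub>?A\<^esub> x) = c \<odot>\<^bsub>T\<^esub> \<rho> x" for c x
    using lin by (simp add: group_algebra_def free_algebra_def T_def linear_def)
  ultimately show ?thesis using single by (auto simp: alg_hom_def)
qed

lemma map_single:
  assumes "f 0 = 0"
  shows "Poly_Mapping.map f (Poly_Mapping.single b c) = Poly_Mapping.single b (f c)"
  by (rule poly_mapping_eqI) (simp add: lookup_map_zero[of f, OF assms] lookup_single when_def assms)

lemma R0a_embed_zero: "R0a_embed 0 = 0"
  by (simp add: R0a_embed_def)

lemma ATL_Ra_eq:
  "ATL_Ra n = free_algebra (arrow_flat_tangles n)
     (\<lambda>F F'. Poly_Mapping.single (arrow_comp F F') (R0a_embed (cycle_weight F F')))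
     (Poly_Mapping.single (id_tangle n) 1)"
proof -
  have "\<one>\<^bsub>ATL n\<^esub> = Poly_Mapping.single (id_tangle n) 1" by (simp add: ATL_def free_algebra_def)
  moreover have "Poly_Mapping.single F 1 \<otimes>\<^bsub>ATL n\<^esub> Poly_Mapping.single F' 1 =
      Poly_Mapping.single (arrow_comp F F') (cycle_weight F F')" for F F'
    unfolding ATL_def by (rule free_algebra_mult_single)
  ultimately show ?thesis
    by (simp add: ATL_Ra_def base_change_def map_single R0a_embed_zero R0a_embed_one)
qed

section \<open>The representation\<close>

lemma A_pow_mult: "A_pow a * A_pow b = A_pow (a + b)"
  by (simp add: A_pow_def mult_single)

lemma A_pow_0: "A_pow 0 = 1"
  by (simp add: A_pow_def flip: zero_prod_def)

context
  fixes n :: nat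
begin

abbreviation atl_times (infixl "\<cdot>" 70) where "x \<cdot> y \<equiv> x \<otimes>\<^bsub>ATL_Ra n\<^esub> y"

abbreviation "tangles \<equiv> arrow_flat_tangles n"

abbreviation "unit \<equiv> Poly_Mapping.single (id_tangle n) (1::Ra)"

lemma carrier_ATL_Ra: "x \<in> carrier (ATL_Ra n) \<longleftrightarrow> Poly_Mapping.keys x \<subseteq> tangles"
  unfolding ATL_Ra_eq by (rule carrier_free_algebra)

lemma ATL_Ra_simps: "\<one>\<^bsub>ATL_Ra n\<^esub> = unit" "x \<oplus>\<^bsub>ATL_Ra n\<^esub> y = x + y" "c \<odot>\<^bsub>ATL_Ra n\<^esub> x = scale c x"
  by (simp_all add: ATL_Ra_eq free_algebra_def)

lemma ATL_Ra_mult_linear: "linear (\<lambda>x. x \<cdot> y)" "linear (\<lambda>y. x \<cdot> y)"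
  unfolding ATL_Ra_eq by (rule free_algebra_mult_linear)+

lemma ATL_Ra_mult_simps:
  "(x + y) \<cdot> z = x \<cdot> z + y \<cdot> z" "z \<cdot> (x + y) = z \<cdot> x + z \<cdot> y"
  "scale c x \<cdot> z = scale c (x \<cdot> z)" "z \<cdot> scale c x = scale c (z \<cdot> x)"
  using ATL_Ra_mult_linear[of z] unfolding linear_def by blast+

lemma ATL_Ra_mult_closed:
  "Poly_Mapping.keys x \<subseteq> tangles \<Longrightarrow> Poly_Mapping.keys y \<subseteq> tangles \<Longrightarrow> Poly_Mapping.keys (x \<cdot> y) \<subseteq> tangles"
  unfolding ATL_Ra_eq by (rule free_algebra_mult_closed) (auto simp: dprod_diagram)

lemma ATL_Ra_mult_single:
  "Poly_Mapping.single F c \<cdot> Poly_Mapping.single F' d =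
    Poly_Mapping.single (arrow_comp F F') (c * d * R0a_embed (cycle_weight F F'))"
proof -
  have "Poly_Mapping.single F 1 \<cdot> Poly_Mapping.single F' 1 =
      Poly_Mapping.single (arrow_comp F F') (R0a_embed (cycle_weight F F'))"
    unfolding ATL_Ra_eq by (rule free_algebra_mult_single)
  then have "scale c (Poly_Mapping.single F 1) \<cdot> scale d (Poly_Mapping.single F' 1) =
      scale (c * d) (Poly_Mapping.single (arrow_comp F F') (R0a_embed (cycle_weight F F')))"
    by (simp add: ATL_Ra_mult_simps scale_simps mult.commute)
  then show ?thesis by (simp add: scale_single)
qed

lemma unit_mult:
  assumes "Poly_Mapping.keys y \<subseteq> tangles"
  shows "unit \<cdot> y = y"
  by (rule linear_eqI[OF ATL_Ra_mult_linear(2) linear_id assms])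
    (simp add: ATL_Ra_mult_single id_comp R0a_embed_one)

definition gen :: "vb_gen \<Rightarrow> arrow_flat \<Rightarrow>\<^sub>0 Ra" where
  "gen g = Poly_Mapping.single (gen_tangle n g) 1"

lemma gen_assoc:
  assumes g: "g \<in> vb_gens n" and y: "Poly_Mapping.keys y \<subseteq> tangles" and z: "Poly_Mapping.keys z \<subseteq> tangles"
  shows "gen g \<cdot> y \<cdot> z = gen g \<cdot> (y \<cdot> z)"
proof (rule linear_eqI[of "\<lambda>y. gen g \<cdot> y \<cdot> z" "\<lambda>y. gen g \<cdot> (y \<cdot> z)", OF _ _ y])
  show "linear (\<lambda>y. gen g \<cdot> y \<cdot> z)" "linear (\<lambda>y. gen g \<cdot> (y \<cdot> z))"
    by (simp_all add: linear_def ATL_Ra_mult_simps)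
  fix X assume X: "X \<in> tangles"
  let ?X = "Poly_Mapping.single X (1::Ra)"
  show "gen g \<cdot> ?X \<cdot> z = gen g \<cdot> (?X \<cdot> z)"
  proof (rule linear_eqI[of "\<lambda>z. gen g \<cdot> ?X \<cdot> z" "\<lambda>z. gen g \<cdot> (?X \<cdot> z)", OF _ _ z])
    show "linear (\<lambda>z. gen g \<cdot> ?X \<cdot> z)" "linear (\<lambda>z. gen g \<cdot> (?X \<cdot> z))"
      by (simp_all add: linear_def ATL_Ra_mult_simps)
    fix Y assume Y: "Y \<in> tangles"
    have "R0a_embed (cycle_weight (gen_tangle n g) X) * R0a_embed (cycle_weight (arrow_comp (gen_tangle n g) X) Y) =
        R0a_embed (cycle_weight X Y) * R0a_embed (cycle_weight (gen_tangle n g) (arrow_comp X Y))"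
      using gen_comp_assoc(2)[OF g X Y] by (metis R0a_embed_mult)
    then show "gen g \<cdot> ?X \<cdot> Poly_Mapping.single Y 1 = gen g \<cdot> (?X \<cdot> Poly_Mapping.single Y 1)"
      using gen_comp_assoc(1)[OF g X Y] by (simp add: gen_def ATL_Ra_mult_single)
  qed
qed

section \<open>Monomials in the generators and values of words\<close>

definition mon :: "vb_gen list \<Rightarrow> arrow_flat \<Rightarrow>\<^sub>0 Ra" where
  "mon gs = foldr (\<lambda>g x. gen g \<cdot> x) gs unit"

lemma keys_unit: "Poly_Mapping.keys unit \<subseteq> tangles"
  using id_tangle_diagram(1) by simp

lemma keys_gen: "g \<in> vb_gens n \<Longrightarrow> Poly_Mapping.keys (gen g) \<subseteq> tangles"
  using gen_tangle_diagram(1) by (simp add: gen_def)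

text \<open>A monomial remains a multiple of one tangle, and both can be read off the diagram that
  the generators produce from the identity. Equations between monomials thus become equations
  between diagrams.\<close>

lemma mon_single:
  "set gs \<subseteq> vb_gens n \<Longrightarrow> \<exists>X c. X \<in> tangles \<and> mon gs = Poly_Mapping.single X (R0a_embed c) \<and>
     weighted c (diagram n X) = foldr act gs (id_diagram n)"
proof (induction gs)
  case Nil
  then show ?case using id_tangle_diagram[of n]
    by (intro exI[of _ "id_tangle n"] exI[of _ 1]) (simp add: mon_def R0a_embed_one)
next
  case (Cons g gs)
  then obtain X c where X: "X \<in> tangles" "mon gs = Poly_Mapping.single X (R0a_embed c)"
    "weighted c (diagram n X) = foldr act gs (id_diagram n)" by auto
  have g: "g \<in> vb_gens n" using Cons by simp
  let ?G = "gen_tangle n g"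
  have "mon (g # gs) = Poly_Mapping.single (arrow_comp ?G X) (R0a_embed (c * cycle_weight ?G X))"
    using X(2) by (simp add: mon_def gen_def ATL_Ra_mult_single R0a_embed_mult)
  moreover have "weighted (c * cycle_weight ?G X) (diagram n (arrow_comp ?G X)) = foldr act (g # gs) (id_diagram n)"
    using gen_comp_diagram[OF g X(1)] by (simp add: X(3)[symmetric] act_weighted flip: weighted_weighted)
  moreover have "arrow_comp ?G X \<in> tangles"
    by (rule dprod_diagram(2)[OF gen_tangle_diagram(1)[OF g] X(1)])
  ultimately show ?case by blast
qed

lemma mon_eqI:
  assumes "set gs \<subseteq> vb_gens n" "set hs \<subseteq> vb_gens n"
    and eq: "foldr act gs (id_diagram n) = weighted z (foldr act hs (id_diagram n))"
  shows "mon gs = scale (R0a_embed z) (mon hs)"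
proof -
  obtain X c where X: "X \<in> tangles" "mon gs = Poly_Mapping.single X (R0a_embed c)"
    "weighted c (diagram n X) = foldr act gs (id_diagram n)" using mon_single[OF assms(1)] by blast
  obtain Y d where Y: "Y \<in> tangles" "mon hs = Poly_Mapping.single Y (R0a_embed d)"
    "weighted d (diagram n Y) = foldr act hs (id_diagram n)" using mon_single[OF assms(2)] by blast
  have "weighted c (diagram n X) = weighted (z * d) (diagram n Y)"
    using eq X(3) Y(3) by (metis weighted_weighted)
  then have "X = Y" "c = z * d" using weighted_diagram_inject[OF X(1) Y(1)] by blast+
  then show ?thesis using X(2) Y(2) by (simp add: scale_single R0a_embed_mult)
qed

lemma mon_eqI_unweighted:
  assumes "set gs \<subseteq> vb_gens n" "set hs \<subseteq> vb_gens n"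
    and "foldr act gs (id_diagram n) = foldr act hs (id_diagram n)"
  shows "mon gs = mon hs"
  using mon_eqI[of gs hs 1] assms by (simp add: R0a_embed_one scale_simps)

text \<open>The inverse of a \<open>\<sigma>\<close> letter is found by replacing \<open>A\<close>
  with its inverse, see \<open>sigma_cancel\<close>. A \<open>\<tau>\<close> letter has one value
  for both signs because \<open>w_i\<close> is an involution.\<close>

fun letter :: "vb_gen \<times> bool \<Rightarrow> arrow_flat \<Rightarrow>\<^sub>0 Ra" where
  "letter (Sigma_gen i, b) = scale (- A_pow (if b then - 2 else 2)) unit
     + scale (- A_pow (if b then - 4 else 4)) (gen (Sigma_gen i))"
| "letter (Tau_gen i, b) = gen (Tau_gen i)"

definition word_val :: "vb_gen word \<Rightarrow> arrow_flat \<Rightarrow>\<^sub>0 Ra" where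
  "word_val w = foldr (\<lambda>l x. letter l \<cdot> x) w unit"

lemma keys_add_subset:
  "Poly_Mapping.keys x \<subseteq> tangles \<Longrightarrow> Poly_Mapping.keys y \<subseteq> tangles \<Longrightarrow> Poly_Mapping.keys (x + y) \<subseteq> tangles"
  for x y :: "arrow_flat \<Rightarrow>\<^sub>0 Ra"
  using keys_add[of x y] by blast

lemma keys_scale_subset:
  "Poly_Mapping.keys x \<subseteq> tangles \<Longrightarrow> Poly_Mapping.keys (scale c x) \<subseteq> tangles"
  for x :: "arrow_flat \<Rightarrow>\<^sub>0 Ra"
  using keys_scale[of c x] by blast

lemma keys_letter: "fst l \<in> vb_gens n \<Longrightarrow> Poly_Mapping.keys (letter l) \<subseteq> tangles"
  by (cases l rule: letter.cases)
    (simp_all only: letter.simps fst_conv keys_add_subset keys_scale_subset keys_unit keys_gen)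

lemma letter_assoc:
  assumes "fst l \<in> vb_gens n" "Poly_Mapping.keys y \<subseteq> tangles" "Poly_Mapping.keys z \<subseteq> tangles"
  shows "letter l \<cdot> y \<cdot> z = letter l \<cdot> (y \<cdot> z)"
  using assms
  by (cases l rule: letter.cases)
    (simp_all add: ATL_Ra_mult_simps unit_mult ATL_Ra_mult_closed gen_assoc del: keys_single)

lemma keys_word_val: "w \<in> lists (vb_gens n \<times> UNIV) \<Longrightarrow> Poly_Mapping.keys (word_val w) \<subseteq> tangles"
proof (induction w)
  case Nil
  then show ?case using keys_unit by (simp add: word_val_def)
next
  case (Cons l w)
  then have "fst l \<in> vb_gens n" by auto
  with Cons show ?case using ATL_Ra_mult_closed[OF keys_letter] by (simp add: word_val_def)
qed

lemma word_val_append: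
  assumes "u \<in> lists (vb_gens n \<times> UNIV)" "v \<in> lists (vb_gens n \<times> UNIV)"
  shows "word_val (u @ v) = word_val u \<cdot> word_val v"
  using assms(1)
proof (induction u)
  case Nil
  then show ?case using unit_mult[OF keys_word_val[OF assms(2)]] by (simp add: word_val_def)
next
  case (Cons l u)
  then have l: "fst l \<in> vb_gens n" and u: "u \<in> lists (vb_gens n \<times> UNIV)" by auto
  have "word_val (l # u @ v) = letter l \<cdot> (word_val u \<cdot> word_val v)"
    using Cons.IH by (simp add: word_val_def)
  also have "\<dots> = word_val (l # u) \<cdot> word_val v"
    using letter_assoc[OF l keys_word_val[OF u] keys_word_val[OF assms(2)]] by (simp add: word_val_def)
  finally show ?case by simp
qed

section \<open>The defining relations\<close>

lemma sigma_mult: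
  assumes "Poly_Mapping.keys y \<subseteq> tangles"
  shows "letter (Sigma_gen i, b) \<cdot> y = scale (- A_pow (if b then - 2 else 2)) y
     + scale (- A_pow (if b then - 4 else 4)) (gen (Sigma_gen i) \<cdot> y)"
  by (simp add: ATL_Ra_mult_simps unit_mult[OF assms])

lemma sigma_cancel:
  assumes "Sigma_gen i \<in> vb_gens n"
  shows "word_val [(Sigma_gen i, b), (Sigma_gen i, \<not> b)] = unit"
proof -
  let ?F = "gen (Sigma_gen i)"
  have FF: "?F \<cdot> (?F \<cdot> unit) = scale (z_img 0) (?F \<cdot> unit)"
    using mon_eqI[of "[Sigma_gen i, Sigma_gen i]" "[Sigma_gen i]" "z_var 0"] assms act_sigma_sigma
    by (simp add: mon_def R0a_embed_z_var del: act.simps)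
  have k: "Poly_Mapping.keys (?F \<cdot> unit) \<subseteq> tangles"
    by (rule ATL_Ra_mult_closed[OF keys_gen[OF assms] keys_unit])
  define x where "x = ?F \<cdot> unit"
  have x: "?F \<cdot> x = scale (z_img 0) x" using FF by (simp only: x_def)
  have kk: "Poly_Mapping.keys (word_val [(Sigma_gen i, \<not> b)]) \<subseteq> tangles"
    by (rule keys_word_val) (use assms in auto)
  have 1: "word_val [(Sigma_gen i, \<not> b)] = scale (- A_pow (if b then 2 else - 2)) unit + scale (- A_pow (if b then 4 else - 4)) x"
    using sigma_mult[OF keys_unit, of i "\<not> b"] by (simp add: word_val_def x_def del: letter.simps)
  have "word_val [(Sigma_gen i, b), (Sigma_gen i, \<not> b)] = letter (Sigma_gen i, b) \<cdot> word_val [(Sigma_gen i, \<not> b)]"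
    by (simp add: word_val_def del: letter.simps)
  \<comment> \<open>Since \<open>F_i F_i = z_0 F_i\<close>, the coefficient of \<open>x\<close> is
    \<open>A^2 + A^-2 + z_0\<close>, which is 0.\<close>
  also have "\<dots> = scale (A_pow (if b then - 2 else 2) * A_pow (if b then 2 else - 2)) unit +
     scale (A_pow (if b then - 2 else 2) * A_pow (if b then 4 else - 4)
        + A_pow (if b then - 4 else 4) * A_pow (if b then 2 else - 2)
        + A_pow (if b then - 4 else 4) * A_pow (if b then 4 else - 4) * z_img 0) x"
    unfolding sigma_mult[OF kk]
    by (simp add: 1 ATL_Ra_mult_simps x x_def[symmetric] scale_simps mult.assoc)
  also have "\<dots> = unit"
    by (cases b) (simp_all add: A_pow_mult A_pow_0 z_img_def scale_simps)
  finally show ?thesis .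
qed

lemma sigma_braid:
  assumes g: "Sigma_gen i \<in> vb_gens n" "Sigma_gen j \<in> vb_gens n" and ij: "j = Suc i \<or> i = Suc j"
  shows "word_val [sg i, sg j, sg i] = word_val [sg j, sg i, sg j]"
proof -
  define a b z where "a = - A_pow (- 2)" and "b = - A_pow (- 4)" and "z = z_img 0"
  \<comment> \<open>The three terms are \<open>- A^-8\<close>, \<open>A^-8 + A^-12\<close> and
    \<open>- A^-12\<close>.\<close>
  have coeff: "a * a * b + a * b * b * z + b * b * b = 0"
    by (simp add: a_def b_def z_def z_img_def A_pow_mult algebra_simps)
  define f where "f k x = gen (Sigma_gen k) \<cdot> x" for k x
  have fl: "f k (x + y) = f k x + f k y" "f k (scale c x) = scale c (f k x)" for k x y c
    by (simp_all add: f_def ATL_Ra_mult_simps)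
  have r: "1 \<le> i" "i < n" "1 \<le> j" "j < n" using g by (auto simp: vb_gens_def)
  have ff: "f k (f k unit) = scale z (f k unit)" if "Sigma_gen k \<in> vb_gens n" for k
    using mon_eqI[of "[Sigma_gen k, Sigma_gen k]" "[Sigma_gen k]" "z_var 0"] that act_sigma_sigma
    by (simp add: mon_def R0a_embed_z_var f_def z_def del: act.simps)
  have fff: "f k (f m (f k unit)) = f k unit" if "Sigma_gen k \<in> vb_gens n" "Sigma_gen m \<in> vb_gens n" "m = Suc k \<or> k = Suc m" for k m
    using mon_eqI_unweighted[of "[Sigma_gen k, Sigma_gen m, Sigma_gen k]" "[Sigma_gen k]"] that act_sigma_zigzag[of m k n]
    by (auto simp: mon_def f_def vb_gens_def simp del: act.simps)
  have sig: "word_val (sg k # w) = scale a (word_val w) + scale b (f k (word_val w))"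
    if "w \<in> lists (vb_gens n \<times> UNIV)" for k w
    using sigma_mult[OF keys_word_val[OF that], of k True] by (simp add: word_val_def a_def b_def f_def del: letter.simps)
  have nil: "word_val [] = unit" by (simp add: word_val_def)
  \<comment> \<open>The coefficient of \<open>F_k\<close> is \<open>2 a^2 b + a b^2 z + b^3\<close>.
    One \<open>a^2 b\<close> is split off to pair with \<open>F_m\<close>; the rest vanishes by
    \<open>coeff\<close>, and what remains is symmetric in \<open>k\<close> and
    \<open>m\<close>.\<close>
  have expand: "word_val [sg k, sg m, sg k] =
      scale (a * a * a) unit + scale (a * a * b) (f k unit + f m unit)
      + scale (a * b * b) (f k (f m unit) + f m (f k unit)) + scale (a * a * b + a * b * b * z + b * b * b) (f k unit)"
    if "Sigma_gen k \<in> vb_gens n" "Sigma_gen m \<in> vb_gens n" "m = Suc k \<or> k = Suc m" for k m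
    using that(1,2)
    by (simp add: sig nil fl ff[OF that(1)] fff[OF that] scale_simps)
      (rule poly_mapping_eqI, simp add: lookup_add algebra_simps)
  have "word_val [sg i, sg j, sg i] = scale (a * a * a) unit + scale (a * a * b) (f i unit + f j unit)
      + scale (a * b * b) (f i (f j unit) + f j (f i unit))"
    using expand[OF g ij] by (simp add: coeff scale_simps)
  moreover have "word_val [sg j, sg i, sg j] = scale (a * a * a) unit + scale (a * a * b) (f j unit + f i unit)
      + scale (a * b * b) (f j (f i unit) + f i (f j unit))"
    using expand[OF g(2,1)] ij by (auto simp: coeff scale_simps)
  ultimately show ?thesis by (simp add: add.commute)
qed

lemma sigma_commute:
  assumes g: "Sigma_gen i \<in> vb_gens n" "Sigma_gen j \<in> vb_gens n" and ij: "i \<noteq> j" "Suc i \<noteq> j" "Suc j \<noteq> i"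
  shows "word_val [sg i, sg j] = word_val [sg j, sg i]"
proof -
  have r: "1 \<le> i" "i < n" "1 \<le> j" "j < n" using g by (auto simp: vb_gens_def)
  have m: "gen (Sigma_gen i) \<cdot> (gen (Sigma_gen j) \<cdot> unit) = gen (Sigma_gen j) \<cdot> (gen (Sigma_gen i) \<cdot> unit)"
    using mon_eqI_unweighted[of "[Sigma_gen i, Sigma_gen j]" "[Sigma_gen j, Sigma_gen i]"] g act_sigma_commute[OF ij r]
    by (simp add: mon_def del: act.simps)
  have sig: "word_val (sg k # w) = scale (- A_pow (- 2)) (word_val w) + scale (- A_pow (- 4)) (gen (Sigma_gen k) \<cdot> word_val w)"
    if "w \<in> lists (vb_gens n \<times> UNIV)" for k w
    using sigma_mult[OF keys_word_val[OF that], of k True] by (simp add: word_val_def del: letter.simps)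
  have nil: "word_val [] = unit" by (simp add: word_val_def)
  show ?thesis using g
    by (simp add: sig nil ATL_Ra_mult_simps scale_simps m) (simp add: algebra_simps)
qed

lemma tau_sigma_commute:
  assumes g: "Tau_gen i \<in> vb_gens n" "Sigma_gen j \<in> vb_gens n" and ij: "i \<noteq> j" "Suc i \<noteq> j" "Suc j \<noteq> i"
  shows "word_val [tg i, sg j] = word_val [sg j, tg i]"
proof -
  have m: "gen (Tau_gen i) \<cdot> (gen (Sigma_gen j) \<cdot> unit) = gen (Sigma_gen j) \<cdot> (gen (Tau_gen i) \<cdot> unit)"
    using mon_eqI_unweighted[of "[Tau_gen i, Sigma_gen j]" "[Sigma_gen j, Tau_gen i]"] g act_tau_sigma_commute[OF ij]
    by (simp add: mon_def del: act.simps)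
  show ?thesis
    using sigma_mult[OF ATL_Ra_mult_closed[OF keys_gen[OF g(1)] keys_unit], of j True] sigma_mult[OF keys_unit, of j True]
    by (simp add: word_val_def ATL_Ra_mult_simps m del: letter.simps(1))
qed

text \<open>After expanding the \<open>\<sigma>\<close> letter, the unit terms of both sides agree
  literally and the \<open>F\<close> terms are an equation between monomials.\<close>

lemma tau_tau_sigma:
  assumes g: "Tau_gen i \<in> vb_gens n" "Tau_gen j \<in> vb_gens n" "Sigma_gen i \<in> vb_gens n" "Sigma_gen j \<in> vb_gens n"
    and ij: "j = Suc i \<or> i = Suc j"
  shows "word_val [tg i, tg j, sg i] = word_val [sg j, tg i, tg j]"
proof -
  have m: "gen (Tau_gen i) \<cdot> (gen (Tau_gen j) \<cdot> (gen (Sigma_gen i) \<cdot> unit)) =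
      gen (Sigma_gen j) \<cdot> (gen (Tau_gen i) \<cdot> (gen (Tau_gen j) \<cdot> unit))"
    using mon_eqI_unweighted[of "[Tau_gen i, Tau_gen j, Sigma_gen i]" "[Sigma_gen j, Tau_gen i, Tau_gen j]"] g
      act_tau_tau_sigma[OF ij]
    by (simp add: mon_def del: act.simps)
  show ?thesis
    using sigma_mult[OF ATL_Ra_mult_closed[OF keys_gen[OF g(1)] ATL_Ra_mult_closed[OF keys_gen[OF g(2)] keys_unit]], of j True]
      sigma_mult[OF keys_unit, of i True]
    by (simp add: word_val_def ATL_Ra_mult_simps m del: letter.simps(1))
qed

lemma tau_relations:
  assumes "set is \<subseteq> {1..<n}" "set js \<subseteq> {1..<n}"
    "foldr act (map Tau_gen is) (id_diagram n) = foldr act (map Tau_gen js) (id_diagram n)"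
  shows "word_val (map (\<lambda>i. (Tau_gen i, b i)) is) = word_val (map (\<lambda>i. (Tau_gen i, c i)) js)"
proof -
  have "word_val (map (\<lambda>i. (Tau_gen i, b i)) ks) = mon (map Tau_gen ks)" for b ks
    by (induction ks) (simp_all add: word_val_def mon_def)
  moreover have "mon (map Tau_gen is) = mon (map Tau_gen js)"
    using assms by (intro mon_eqI_unweighted) (auto simp: vb_gens_def)
  ultimately show ?thesis by simp
qed

lemma word_val_vb_rels:
  assumes "(u, v) \<in> vb_rels n"
  shows "word_val u = word_val v"
proof -
  have gens: "Sigma_gen i \<in> vb_gens n" "Tau_gen i \<in> vb_gens n" if "i \<in> {1..<n}" for i
    using that by (auto simp: vb_gens_def)
  consider (square) i where "i \<in> {1..<n}" "u = [tg i, tg i]" "v = []"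
    | (far) i j where "i \<in> {1..<n}" "j \<in> {1..<n}" "\<bar>int i - int j\<bar> \<ge> 2"
        "(u, v) \<in> {([sg i, sg j], [sg j, sg i]), ([tg i, tg j], [tg j, tg i]), ([tg i, sg j], [sg j, tg i])}"
    | (near) i j where "i \<in> {1..<n}" "j \<in> {1..<n}" "\<bar>int i - int j\<bar> = 1"
        "(u, v) \<in> {([sg i, sg j, sg i], [sg j, sg i, sg j]), ([tg i, tg j, tg i], [tg j, tg i, tg j]),
          ([tg i, tg j, sg i], [sg j, tg i, tg j])}"
    using assms unfolding vb_rels_def by blast
  then show ?thesis
  proof cases
    case square
    then show ?thesis using tau_relations[of "[i, i]" "[]"] by (simp add: act_tau_tau del: act.simps)
  next
    case far
    then have ij: "i \<noteq> j" "Suc i \<noteq> j" "Suc j \<noteq> i" by auto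
    have "word_val [tg i, tg j] = word_val [tg j, tg i]"
      using tau_relations[of "[i, j]" "[j, i]"] far act_tau_commute[OF ij] by (simp del: act.simps)
    then show ?thesis
      using far sigma_commute[OF _ _ ij] tau_sigma_commute[OF _ _ ij] gens by auto
  next
    case near
    then have ij: "j = Suc i \<or> i = Suc j" by auto
    have "word_val [tg i, tg j, tg i] = word_val [tg j, tg i, tg j]"
      using tau_relations[of "[i, j, i]" "[j, i, j]"] near act_tau_braid[OF ij] by (simp del: act.simps)
    then show ?thesis
      using near sigma_braid[OF _ _ ij] tau_tau_sigma[OF _ _ _ _ ij] gens by auto
  qed
qed

lemma word_val_cong: "pres_cong (vb_gens n) (vb_rels n) u v \<Longrightarrow> word_val u = word_val v"
proof (induction rule: pres_cong.induct)
  case (append u u' v v')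
  then show ?case
    using pres_cong_lists[OF append.hyps(1)] pres_cong_lists[OF append.hyps(2)] by (simp add: word_val_append)
next
  case (cancel x b)
  show ?case
  proof (cases x)
    case (Sigma_gen i)
    then show ?thesis using sigma_cancel[of i b] cancel by (simp add: word_val_def)
  next
    \<comment> \<open>A \<open>\<tau>\<close> letter and its inverse have the same value, so
      cancellation amounts to \<open>w_i w_i = 1\<close>.\<close>
    case (Tau_gen i)
    then show ?thesis
      using tau_relations[of "[i, i]" "[]" "\<lambda>_. b"] cancel
      by (simp add: word_val_def vb_gens_def image_iff act_tau_tau del: act.simps)
  qed
qed (simp_all add: word_val_vb_rels)

end

theorem theorem3p4:
  fixes n :: nat
  assumes "n \<ge> 1"
  shows "\<exists>\<rho> \<in> alg_hom (group_algebra (VB n) :: (Ra, vb_gen word set \<Rightarrow>\<^sub>0 Ra) module) (ATL_Ra n).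
    \<forall>i\<in>{1..n - 1}.
      \<rho> (Poly_Mapping.single (vb_sigma n i) 1) =
        (- A_pow (- 2)) \<odot>\<^bsub>ATL_Ra n\<^esub> \<one>\<^bsub>ATL_Ra n\<^esub> \<oplus>\<^bsub>ATL_Ra n\<^esub>
        (- A_pow (- 4)) \<odot>\<^bsub>ATL_Ra n\<^esub> Poly_Mapping.single (F_tangle n i) 1 \<and>
      \<rho> (Poly_Mapping.single (vb_tau n i) 1) = Poly_Mapping.single (w_tangle n i) 1"
proof -
  let ?L = "lists (vb_gens n \<times> UNIV)" and ?c = "pres_class (vb_gens n) (vb_rels n)"
  \<comment> \<open>Any representative serves, since \<open>word_val\<close> is constant on classes
    by \<open>word_val_cong\<close>.\<close>
  define r where "r P = word_val n (SOME u. u \<in> P)" for P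
  have r: "r (?c u) = word_val n u" if "u \<in> ?L" for u
  proof -
    have "u \<in> ?c u" using that by (simp add: pres_class_def pres_cong.refl)
    then have "(SOME v. v \<in> ?c u) \<in> ?c u" by (rule someI)
    then show ?thesis using word_val_cong[of n u] by (simp add: r_def pres_class_def)
  qed
  have car: "carrier (VB n) = ?c ` ?L" by (simp add: VB_def presented_group_def)
  have r_closed: "r g \<in> carrier (ATL_Ra n)" if "g \<in> carrier (VB n)" for g
  proof -
    obtain u where "u \<in> ?L" "g = ?c u" using \<open>g \<in> carrier (VB n)\<close> car by blast
    then show ?thesis using r keys_word_val by (simp only: carrier_ATL_Ra)
  qed
  have r_mult: "r (g \<otimes>\<^bsub>VB n\<^esub> h) = r g \<otimes>\<^bsub>ATL_Ra n\<^esub> r h" if "g \<in> carrier (VB n)" "h \<in> carrier (VB n)" for g h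
  proof -
    obtain u where u: "u \<in> ?L" "g = ?c u" using \<open>g \<in> carrier (VB n)\<close> car by blast
    obtain v where v: "v \<in> ?L" "h = ?c v" using \<open>h \<in> carrier (VB n)\<close> car by blast
    have "g \<otimes>\<^bsub>VB n\<^esub> h = ?c (u @ v)"
      unfolding u(2) v(2) VB_def by (rule presented_group_mult[OF u(1) v(1)])
    moreover have "u @ v \<in> ?L" using u(1) v(1) by (simp only: append_in_lists_conv simp_thms)
    ultimately show ?thesis using u v by (simp only: r word_val_append)
  qed
  have r_one: "r \<one>\<^bsub>VB n\<^esub> = \<one>\<^bsub>ATL_Ra n\<^esub>"
    using r[of "[]"] by (simp add: VB_def presented_group_def ATL_Ra_simps word_val_def)
  obtain B \<mu> u where eq: "ATL_Ra n = free_algebra B \<mu> u" using ATL_Ra_eq by blast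
  have "\<exists>\<rho>\<in>alg_hom (group_algebra (VB n)) (ATL_Ra n). \<forall>g. \<rho> (Poly_Mapping.single g 1) = r g"
    unfolding eq
    by (rule group_algebra_hom_exists) (use r_closed r_mult r_one in \<open>simp_all only: eq\<close>)
  then obtain \<rho> where \<rho>: "\<rho> \<in> alg_hom (group_algebra (VB n)) (ATL_Ra n)"
    "\<And>g. \<rho> (Poly_Mapping.single g 1) = r g" by blast
  \<comment> \<open>The value of a one-letter word is the letter times the unit, so here the
    identity is needed as a right unit for generators.\<close>
  have mult_unit: "gen n g \<otimes>\<^bsub>ATL_Ra n\<^esub> Poly_Mapping.single (id_tangle n) 1 = gen n g" if "g \<in> vb_gens n" for g
  proof -
    note G = gen_tangle_diagram[OF that] and I = id_tangle_diagram[of n]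
    have "weighted (cycle_weight (gen_tangle n g) (id_tangle n)) (diagram n (arrow_comp (gen_tangle n g) (id_tangle n)))
        = weighted 1 (diagram n (gen_tangle n g))"
      using gen_comp_diagram[OF that I(1)] G(2) I(2) by simp
    from weighted_diagram_inject[OF dprod_diagram(2)[OF G(1) I(1)] G(1) this]
    show ?thesis by (simp add: gen_def ATL_Ra_mult_single R0a_embed_one)
  qed
  have "r (vb_sigma n i) = scale (- A_pow (- 2)) (Poly_Mapping.single (id_tangle n) 1)
        + scale (- A_pow (- 4)) (Poly_Mapping.single (F_tangle n i) 1)"
    "r (vb_tau n i) = Poly_Mapping.single (w_tangle n i) 1" if "i \<in> {1..n - 1}" for i
  proof -
    have g: "Sigma_gen i \<in> vb_gens n" "Tau_gen i \<in> vb_gens n" using that by (auto simp: vb_gens_def)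
    have "r (vb_sigma n i) = word_val n [sg i]" "r (vb_tau n i) = word_val n [tg i]"
      using r[of "[sg i]"] r[of "[tg i]"] g by (simp_all add: vb_sigma_def vb_tau_def)
    then show "r (vb_sigma n i) = scale (- A_pow (- 2)) (Poly_Mapping.single (id_tangle n) 1)
        + scale (- A_pow (- 4)) (Poly_Mapping.single (F_tangle n i) 1)"
      "r (vb_tau n i) = Poly_Mapping.single (w_tangle n i) 1"
      using sigma_mult[OF keys_unit, of n i True] mult_unit[OF g(1)] mult_unit[OF g(2)]
      by (simp_all add: word_val_def gen_def del: letter.simps(1))
  qed
  then show ?thesis using \<rho> by (intro bexI[of _ \<rho>]) (simp_all add: ATL_Ra_simps)
qed

end
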